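(* Let $\Omega$ be a bounded strictly convex domain of $\mathbb{R}^n$. Let $T$ be a closed $m$-positive current of bidimension $(p,p)$ on $\Omega\times\mathbb{R}^n$ such that $m+p\ge n+1$ and $T\wedge\beta^{n-m}$ is positive. Let $u$ be an $m$-convex function on $\Omega$ which is bounded near $\partial\Omega\cap\mathrm{Supp}\,T$. Then the current $uT\wedge\beta^{n-m}$ has locally finite mass on $\Omega\times\mathbb{R}^n$.
   Context: Superforms and supercurrents (called forms and currents). On $\mathbb{R}^n\times\mathbb{R}^n$ with coordinates $(x,\xi)$, a form of bidegree $(p,q)$ is $\sum_{|K|=p,|L|=q}\alpha_{KL}(x)\,dx_K\wedge d\xi_L$, coefficients depending only on $x$; for $p=q$ it is symmetric if $\alpha_{KL}=\alpha_{LK}$. $J(\sum\alpha_K dx_K)=\sum\alpha_K d\xi_K$ on $(p,0)$-forms; $d=\sum_i\partial_{x_i}dx_i\wedge\cdot$, $d^{\#}=\sum_j\partial_{x_j}d\xi_j\wedge\cdot$; $\beta=\sum_i dx_i\wedge d\xi_i$; $\sigma_k=(-1)^{k(k-1)/2}$. An $(n,n)$-form $f\,dx_1\wedge d\xi_1\wedge\dots\wedge dx_n\wedge d\xi_n$ is positive if $f\ge0$. A current of bidimension $(p,p)$ on $\Omega\times\mathbb{R}^n$ is a form of bidegree $(n-p,n-p)$ with distribution coefficients on $\Omega$, acting on compactly supported (in $x$) smooth $(p,p)$-forms; a symmetric one is positive if $\langle T,\sigma_p\alpha\wedge J(\alpha)\rangle\ge0$ for all compactly supported smooth $(p,0)$-forms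 $\alpha$ (then its coefficients are measures); closed if $dT=0$. The mass of a current with measure coefficients $T_{IJ}$ on a compact set $K$ is $\|T\|_K=\sum_{I,J}|T_{IJ}|(K)$. $m$-positivity ($1\le m\le n$): a symmetric $(1,1)$-form $\alpha$ is $m$-positive if $\alpha^j\wedge\beta^{n-j}\ge0$ at every point for $j=1,\dots,m$. A symmetric current $T$ of bidimension $(p,p)$ with $n-p\le m\le n$ is $m$-positive if $T\wedge\beta^{n-m}\wedge\alpha_1\wedge\dots\wedge\alpha_{m+p-n}\ge0$ for all $m$-positive $(1,1)$-forms $\alpha_i$. A function $u:\Omega\to[-\infty,+\infty)$ is $m$-convex if it is subharmonic and $dd^{\#}u$ is $m$-positive. "$u$ is bounded near $\partial\Omega\cap\mathrm{Supp}\,T$" means $u$ is bounded on the intersection of $\Omega$ with some neighbourhood of $\partial\Omega\cap\mathrm{Supp}\,T$, where $\mathrm{Supp}\,T$ is understood as its closure in $\overline\Omega$. *)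

theory Defs
  imports "HOL-Analysis.Analysis"
begin

section \<open>Smooth functions, test functions and distributions\<close>

definition partial :: "'n::finite \<Rightarrow> (real^'n \<Rightarrow> real) \<Rightarrow> real^'n \<Rightarrow> real" where
  "partial i f x = frechet_derivative f (at x) (axis i 1)"

definition partials :: "'n::finite list \<Rightarrow> (real^'n \<Rightarrow> real) \<Rightarrow> real^'n \<Rightarrow> real" where
  "partials is f = foldr partial is f"

text \<open>The set is meant to be open, so that all derivatives only depend on the function on the set.\<close>

definition smooth_on :: "(real^'n::finite) set \<Rightarrow> (real^'n \<Rightarrow> real) \<Rightarrow> bool" where
  "smooth_on \<Omega> f \<longleftrightarrow> (\<forall>is. \<forall>x\<in>\<Omega>. partials is f differentiable (at x))"

definition fun_support :: "('a::topological_space \<Rightarrow> real) \<Rightarrow> 'a set" where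
  "fun_support f = closure {x. f x \<noteq> 0}"

text \<open>Test functions on the open set are extended by zero to the whole space.\<close>

definition test_fun :: "(real^'n::finite) set \<Rightarrow> (real^'n \<Rightarrow> real) \<Rightarrow> bool" where
  "test_fun \<Omega> \<phi> \<longleftrightarrow> smooth_on UNIV \<phi> \<and> compact (fun_support \<phi>) \<and> fun_support \<phi> \<subseteq> \<Omega>"

text \<open>Distributions are total functionals; only their values on test functions are meaningful.\<close>

type_synonym 'n functional = "(real^'n \<Rightarrow> real) \<Rightarrow> real"

definition distribution :: "(real^'n::finite) set \<Rightarrow> 'n functional \<Rightarrow> bool" where
  "distribution \<Omega> S \<longleftrightarrow>
     (\<forall>\<phi> \<psi>. test_fun \<Omega> \<phi> \<longrightarrow> test_fun \<Omega> \<psi> \<longrightarrow> S (\<lambda>x. \<phi> x + \<psi> x) = S \<phi> + S \<psi>) \<and>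
     (\<forall>c \<phi>. test_fun \<Omega> \<phi> \<longrightarrow> S (\<lambda>x. c * \<phi> x) = c * S \<phi>) \<and>
     (\<forall>K. compact K \<longrightarrow> K \<subseteq> \<Omega> \<longrightarrow>
       (\<exists>C N. \<forall>\<phi> B. test_fun \<Omega> \<phi> \<longrightarrow> fun_support \<phi> \<subseteq> K \<longrightarrow>
          (\<forall>is x. length is \<le> N \<longrightarrow> \<bar>partials is \<phi> x\<bar> \<le> B) \<longrightarrow> \<bar>S \<phi>\<bar> \<le> C * B))"

section \<open>Superforms\<close>

text \<open>
  \<open>\<alpha> K L\<close> is the coefficient function of \<open>dx\<^sub>K \<and> d\<xi>\<^sub>L\<close>, where the indices in \<open>K\<close> and in \<open>L\<close>
  are listed in increasing order.
\<close>

type_synonym 'n form = "'n set \<Rightarrow> 'n set \<Rightarrow> real^'n \<Rightarrow> real"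

text \<open>For disjoint \<open>A\<close> and \<open>B\<close>: \<open>dx\<^sub>A \<and> dx\<^sub>B = shuffle_sign A B *\<^sub>R dx\<^sub>A\<^sub>\<union>\<^sub>B\<close>.\<close>

definition shuffle_sign :: "'n::{finite,linorder} set \<Rightarrow> 'n set \<Rightarrow> real" where
  "shuffle_sign A B = (-1) ^ card {(a, b) \<in> A \<times> B. b < a}"

text \<open>
  For \<open>K \<inter> K' = {}\<close> and \<open>L \<inter> L' = {}\<close>:
  \<open>(dx\<^sub>K \<and> d\<xi>\<^sub>L) \<and> (dx\<^sub>K\<^sub>' \<and> d\<xi>\<^sub>L\<^sub>') = wedge_sign K L K' L' *\<^sub>R (dx\<^sub>K\<^sub>\<union>\<^sub>K\<^sub>' \<and> d\<xi>\<^sub>L\<^sub>\<union>\<^sub>L\<^sub>')\<close>;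
  the first factor arises from moving \<open>dx\<^sub>K\<^sub>'\<close> past \<open>d\<xi>\<^sub>L\<close>.
\<close>

definition wedge_sign :: "'n::{finite,linorder} set \<Rightarrow> 'n set \<Rightarrow> 'n set \<Rightarrow> 'n set \<Rightarrow> real" where
  "wedge_sign K L K' L' = (-1) ^ (card L * card K') * shuffle_sign K K' * shuffle_sign L L'"

definition form_wedge :: "'n::{finite,linorder} form \<Rightarrow> 'n form \<Rightarrow> 'n form" where
  "form_wedge \<alpha> \<gamma> K L x =
     (\<Sum>K'\<in>Pow K. \<Sum>L'\<in>Pow L. wedge_sign K' L' (K - K') (L - L') * \<alpha> K' L' x * \<gamma> (K - K') (L - L') x)"

definition form_one :: "'n form" where
  "form_one K L x = (if K = {} \<and> L = {} then 1 else 0)"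

definition form_power :: "'n::{finite,linorder} form \<Rightarrow> nat \<Rightarrow> 'n form" where
  "form_power \<alpha> k = (form_wedge \<alpha> ^^ k) form_one"

definition form_scale :: "real \<Rightarrow> 'n form \<Rightarrow> 'n form" where
  "form_scale c \<alpha> K L x = c * \<alpha> K L x"

definition form_beta :: "'n form" where
  "form_beta K L x = (if \<exists>i. K = {i} \<and> L = {i} then 1 else 0)"

definition sgn_sigma :: "nat \<Rightarrow> real" where
  "sgn_sigma k = (-1) ^ (k * (k - 1) div 2)"

definition form_bidegree :: "(real^'n::finite) set \<Rightarrow> nat \<Rightarrow> nat \<Rightarrow> 'n form \<Rightarrow> bool" where
  "form_bidegree \<Omega> p q \<alpha> \<longleftrightarrow>
     (\<forall>K L. (card K, card L) \<noteq> (p, q) \<longrightarrow> (\<forall>x\<in>\<Omega>. \<alpha> K L x = 0))"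

definition form_symmetric :: "(real^'n) set \<Rightarrow> 'n form \<Rightarrow> bool" where
  "form_symmetric \<Omega> \<alpha> \<longleftrightarrow> (\<forall>K L. \<forall>x\<in>\<Omega>. \<alpha> K L x = \<alpha> L K x)"

definition form_smooth :: "(real^'n::finite) set \<Rightarrow> 'n form \<Rightarrow> bool" where
  "form_smooth \<Omega> \<alpha> \<longleftrightarrow> (\<forall>K L. smooth_on \<Omega> (\<alpha> K L))"

definition form_test :: "(real^'n::finite) set \<Rightarrow> 'n form \<Rightarrow> bool" where
  "form_test \<Omega> \<alpha> \<longleftrightarrow> (\<forall>K L. test_fun \<Omega> (\<alpha> K L))"

text \<open>\<open>J\<close> is only meaningful on forms of bidegree \<open>(p, 0)\<close>.\<close>

definition form_J :: "'n form \<Rightarrow> 'n form" where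
  "form_J \<alpha> K L x = (if K = {} then \<alpha> L {} x else 0)"

text \<open>
  Coefficient of an \<open>(n, n)\<close>-form with respect to \<open>dx\<^sub>1 \<and> d\<xi>\<^sub>1 \<and> \<dots> \<and> dx\<^sub>n \<and> d\<xi>\<^sub>n\<close>, which equals
  \<open>\<sigma>\<^sub>n dx\<^sub>1 \<and> \<dots> \<and> dx\<^sub>n \<and> d\<xi>\<^sub>1 \<and> \<dots> \<and> d\<xi>\<^sub>n\<close>.
\<close>

definition form_top :: "'n::finite form \<Rightarrow> real^'n \<Rightarrow> real" where
  "form_top \<alpha> x = sgn_sigma CARD('n) * \<alpha> UNIV UNIV x"

definition m_positive_form :: "nat \<Rightarrow> (real^'n::{finite,linorder}) set \<Rightarrow> 'n form \<Rightarrow> bool" where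
  "m_positive_form m \<Omega> \<alpha> \<longleftrightarrow> form_bidegree \<Omega> 1 1 \<alpha> \<and> form_symmetric \<Omega> \<alpha> \<and>
     (\<forall>x\<in>\<Omega>. \<forall>j\<in>{1..m}.
        form_top (form_wedge (form_power \<alpha> j) (form_power form_beta (CARD('n) - j))) x \<ge> 0)"

section \<open>Supercurrents\<close>

text \<open>As for forms, \<open>T K L\<close> is the coefficient of \<open>dx\<^sub>K \<and> d\<xi>\<^sub>L\<close>.\<close>

type_synonym 'n supercurrent = "'n set \<Rightarrow> 'n set \<Rightarrow> 'n functional"

text \<open>Currents of bidimension \<open>(p, p)\<close>, that is, of bidegree \<open>(n - p, n - p)\<close>.\<close>

definition current :: "nat \<Rightarrow> (real^'n::finite) set \<Rightarrow> 'n supercurrent \<Rightarrow> bool" where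
  "current p \<Omega> T \<longleftrightarrow> p \<le> CARD('n) \<and> (\<forall>K L. distribution \<Omega> (T K L)) \<and>
     (\<forall>K L. (card K, card L) \<noteq> (CARD('n) - p, CARD('n) - p) \<longrightarrow>
        (\<forall>\<phi>. test_fun \<Omega> \<phi> \<longrightarrow> T K L \<phi> = 0))"

definition current_symmetric :: "(real^'n::finite) set \<Rightarrow> 'n supercurrent \<Rightarrow> bool" where
  "current_symmetric \<Omega> T \<longleftrightarrow> (\<forall>K L \<phi>. test_fun \<Omega> \<phi> \<longrightarrow> T K L \<phi> = T L K \<phi>)"

text \<open>The product of the distribution \<open>S\<close> with a smooth function \<open>f\<close> is \<open>\<phi> \<mapsto> S (f \<phi>)\<close>.\<close>

definition current_wedge :: "'n::{finite,linorder} supercurrent \<Rightarrow> 'n form \<Rightarrow> 'n supercurrent" where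
  "current_wedge T \<alpha> K L \<phi> =
     (\<Sum>K'\<in>Pow K. \<Sum>L'\<in>Pow L.
        wedge_sign K' L' (K - K') (L - L') * T K' L' (\<lambda>x. \<alpha> (K - K') (L - L') x * \<phi> x))"

text \<open>The \<open>(n, n)\<close>-analogue of \<open>form_top\<close>.\<close>

definition current_top :: "'n::finite supercurrent \<Rightarrow> 'n functional" where
  "current_top T \<phi> = sgn_sigma CARD('n) * T UNIV UNIV \<phi>"

definition current_top_nonneg :: "(real^'n::finite) set \<Rightarrow> 'n supercurrent \<Rightarrow> bool" where
  "current_top_nonneg \<Omega> T \<longleftrightarrow>
     (\<forall>\<phi>. test_fun \<Omega> \<phi> \<longrightarrow> (\<forall>x. \<phi> x \<ge> 0) \<longrightarrow> current_top T \<phi> \<ge> 0)"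

text \<open>
  The integral of \<open>T \<and> \<alpha>\<close>, where a compactly supported
  \<open>f dx\<^sub>1 \<and> d\<xi>\<^sub>1 \<and> \<dots> \<and> dx\<^sub>n \<and> d\<xi>\<^sub>n\<close> is integrated by applying \<open>f\<close> to the constant \<open>1\<close>.
\<close>

definition current_pairing :: "'n::{finite,linorder} supercurrent \<Rightarrow> 'n form \<Rightarrow> real" where
  "current_pairing T \<alpha> = current_top (current_wedge T \<alpha>) (\<lambda>x. 1)"

definition positive_current :: "nat \<Rightarrow> (real^'n::{finite,linorder}) set \<Rightarrow> 'n supercurrent \<Rightarrow> bool" where
  "positive_current p \<Omega> T \<longleftrightarrow> current p \<Omega> T \<and> current_symmetric \<Omega> T \<and>
     (\<forall>\<alpha>. form_test \<Omega> \<alpha> \<longrightarrow> form_bidegree \<Omega> p 0 \<alpha> \<longrightarrow>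
        current_pairing T (form_scale (sgn_sigma p) (form_wedge \<alpha> (form_J \<alpha>))) \<ge> 0)"

definition m_positive_current ::
    "nat \<Rightarrow> nat \<Rightarrow> (real^'n::{finite,linorder}) set \<Rightarrow> 'n supercurrent \<Rightarrow> bool" where
  "m_positive_current m p \<Omega> T \<longleftrightarrow>
     current p \<Omega> T \<and> current_symmetric \<Omega> T \<and> CARD('n) - p \<le> m \<and> m \<le> CARD('n) \<and>
     (\<forall>\<alpha>s. length \<alpha>s = m + p - CARD('n) \<longrightarrow>
        (\<forall>\<alpha>\<in>set \<alpha>s. form_smooth \<Omega> \<alpha> \<and> m_positive_form m \<Omega> \<alpha>) \<longrightarrow>
        current_top_nonneg \<Omega>
          (foldl current_wedge (current_wedge T (form_power form_beta (CARD('n) - m))) \<alpha>s))"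

definition dist_partial :: "'n::finite \<Rightarrow> 'n functional \<Rightarrow> 'n functional" where
  "dist_partial i S \<phi> = - S (partial i \<phi>)"

definition current_d :: "'n::{finite,linorder} supercurrent \<Rightarrow> 'n supercurrent" where
  "current_d T K L \<phi> = (\<Sum>i\<in>K. wedge_sign {i} {} (K - {i}) L * dist_partial i (T (K - {i}) L) \<phi>)"

definition current_d_sharp :: "'n::{finite,linorder} supercurrent \<Rightarrow> 'n supercurrent" where
  "current_d_sharp T K L \<phi> = (\<Sum>j\<in>L. wedge_sign {} {j} K (L - {j}) * dist_partial j (T K (L - {j})) \<phi>)"

definition closed_current :: "(real^'n::{finite,linorder}) set \<Rightarrow> 'n supercurrent \<Rightarrow> bool" where
  "closed_current \<Omega> T \<longleftrightarrow> (\<forall>K L \<phi>. test_fun \<Omega> \<phi> \<longrightarrow> current_d T K L \<phi> = 0)"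

definition current_support :: "(real^'n::finite) set \<Rightarrow> 'n supercurrent \<Rightarrow> (real^'n) set" where
  "current_support \<Omega> T =
     {x \<in> \<Omega>. \<forall>U. open U \<longrightarrow> x \<in> U \<longrightarrow> (\<exists>\<phi> K L. test_fun (\<Omega> \<inter> U) \<phi> \<and> T K L \<phi> \<noteq> 0)}"

section \<open>\<open>m\<close>-convex functions\<close>

text \<open>
  The two integrals are those of the positive and the negative part of \<open>u\<close>, since \<open>e2ennreal\<close>
  truncates negative numbers to \<open>0\<close>; for \<open>u\<close> bounded above on the ball the first one is finite.
\<close>

definition ball_mean :: "('a::euclidean_space \<Rightarrow> ereal) \<Rightarrow> 'a \<Rightarrow> real \<Rightarrow> ereal" where
  "ball_mean u a r =
     (enn2ereal (\<integral>\<^sup>+x\<in>cball a r. e2ennreal (u x) \<partial>lborel) -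
      enn2ereal (\<integral>\<^sup>+x\<in>cball a r. e2ennreal (- u x) \<partial>lborel)) / ereal (measure lborel (cball a r))"

definition subharmonic_on :: "'a::euclidean_space set \<Rightarrow> ('a \<Rightarrow> ereal) \<Rightarrow> bool" where
  "subharmonic_on \<Omega> u \<longleftrightarrow>
     (\<forall>x\<in>\<Omega>. u x \<noteq> \<infinity>) \<and> (\<exists>x\<in>\<Omega>. u x \<noteq> - \<infinity>) \<and>
     (\<forall>c. openin (top_of_set \<Omega>) {x \<in> \<Omega>. u x < c}) \<and>
     (\<forall>a r. 0 < r \<longrightarrow> cball a r \<subseteq> \<Omega> \<longrightarrow> u a \<le> ball_mean u a r)"

text \<open>
  The value \<open>- \<infinity>\<close> is replaced by \<open>0\<close>, which for subharmonic \<open>u\<close> only changes \<open>u\<close> on a Lebesgue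
  null set.
\<close>

definition function_current :: "(real^'n::finite) set \<Rightarrow> (real^'n \<Rightarrow> ereal) \<Rightarrow> 'n supercurrent" where
  "function_current \<Omega> u K L \<phi> =
     (if K = {} \<and> L = {} then (LINT x:\<Omega>|lborel. real_of_ereal (u x) * \<phi> x) else 0)"

definition m_convex_on ::
    "nat \<Rightarrow> (real^'n::{finite,linorder}) set \<Rightarrow> (real^'n::{finite,linorder} \<Rightarrow> ereal) \<Rightarrow> bool" where
  "m_convex_on m \<Omega> u \<longleftrightarrow> subharmonic_on \<Omega> u \<and>
     m_positive_current m (CARD('n) - 1) \<Omega> (current_d (current_d_sharp (function_current \<Omega> u)))"

section \<open>Mass\<close>

text \<open>
  \<open>S\<close> is the signed Radon measure \<open>h \<mu>\<close> on \<open>\<Omega>\<close> with \<open>\<bar>h\<bar> = 1\<close>, that is,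
  \<open>\<mu>\<close> is the total variation measure \<open>\<bar>S\<bar>\<close>.
\<close>

definition polar_decomposition ::
    "(real^'n::finite) set \<Rightarrow> 'n functional \<Rightarrow> (real^'n) measure \<Rightarrow> (real^'n \<Rightarrow> real) \<Rightarrow> bool" where
  "polar_decomposition \<Omega> S \<mu> h \<longleftrightarrow>
     sets \<mu> = sets (restrict_space borel \<Omega>) \<and>
     (\<forall>K. compact K \<longrightarrow> K \<subseteq> \<Omega> \<longrightarrow> emeasure \<mu> K < \<infinity>) \<and>
     h \<in> borel_measurable \<mu> \<and> (\<forall>x\<in>\<Omega>. \<bar>h x\<bar> = 1) \<and>
     (\<forall>\<phi>. test_fun \<Omega> \<phi> \<longrightarrow> S \<phi> = (LINT x|\<mu>. \<phi> x * h x))"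

text \<open>Mass on \<open>K\<close> of a current whose coefficients have the total variation measures \<open>\<mu> I J\<close>.\<close>

definition mass :: "('n::finite set \<Rightarrow> 'n set \<Rightarrow> (real^'n) measure) \<Rightarrow> (real^'n) set \<Rightarrow> ennreal" where
  "mass \<mu> K = (\<Sum>I\<in>UNIV. \<Sum>J\<in>UNIV. emeasure (\<mu> I J) K)"

text \<open>
  \<open>T\<close> has measure coefficients \<open>T\<^sub>I\<^sub>J\<close>, and \<open>u T\<close> has locally finite mass. The coefficient measure
  \<open>u T\<^sub>I\<^sub>J\<close> has total variation \<open>\<bar>u\<bar> \<bar>T\<^sub>I\<^sub>J\<bar>\<close>; its finiteness on compact sets includes that
  \<open>{u = - \<infinity>}\<close> is a null set of \<open>\<bar>T\<^sub>I\<^sub>J\<bar>\<close>.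
\<close>

definition product_locally_finite_mass ::
    "(real^'n::finite) set \<Rightarrow> (real^'n \<Rightarrow> ereal) \<Rightarrow> 'n supercurrent \<Rightarrow> bool" where
  "product_locally_finite_mass \<Omega> u T \<longleftrightarrow>
     (\<exists>\<mu> h. (\<forall>I J. polar_decomposition \<Omega> (T I J) (\<mu> I J) (h I J)) \<and>
        (\<forall>K. compact K \<longrightarrow> K \<subseteq> \<Omega> \<longrightarrow>
           mass (\<lambda>I J. density (\<mu> I J) (\<lambda>x. e2ennreal \<bar>u x\<bar>)) K < \<infinity>))"

section \<open>Domains and boundary behaviour\<close>

definition strictly_convex_domain :: "'a::real_normed_vector set \<Rightarrow> bool" where
  "strictly_convex_domain \<Omega> \<longleftrightarrow> open \<Omega> \<and> connected \<Omega> \<and> \<Omega> \<noteq> {} \<and>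
     (\<forall>x\<in>closure \<Omega>. \<forall>y\<in>closure \<Omega>. x \<noteq> y \<longrightarrow> open_segment x y \<subseteq> \<Omega>)"

definition bounded_near_boundary_support ::
    "(real^'n::finite) set \<Rightarrow> 'n supercurrent \<Rightarrow> (real^'n \<Rightarrow> ereal) \<Rightarrow> bool" where
  "bounded_near_boundary_support \<Omega> T u \<longleftrightarrow>
     (\<exists>V. open V \<and> frontier \<Omega> \<inter> closure (current_support \<Omega> T) \<subseteq> V \<and>
        (\<exists>M::real. \<forall>x\<in>\<Omega> \<inter> V. \<bar>u x\<bar> \<le> ereal M))"

end

theory Submission
  imports Defs
begin

text \<open>
  Put \<open>q = m + p - n\<close> and \<open>S = T \<and> \<beta>\<^sup>n\<^sup>-\<^sup>m\<close>. The coefficients of the positive current \<open>S\<close> are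
  differences of positive functionals bounded by the trace \<open>\<tau> = S \<and> \<beta>\<^sup>q / q!\<close>, so it suffices to
  bound \<open>\<tau>(\<eta> (-v))\<close> uniformly for the regularisations \<open>v = u * \<rho>\<close> and to apply Fatou's lemma, using
  that \<open>limsup u * \<rho> \<le> u\<close> by upper semicontinuity.

  Choose a cutoff function \<open>\<eta>\<close> that equals \<open>1\<close> near the given compact set and near the part of
  \<open>Supp T\<close> on which \<open>u\<close> need not be bounded, and put \<open>w = \<eta> |x|\<^sup>2 / 2\<close>. As \<open>dd\<^sup># v\<close> is \<open>m\<close>-positive and
  \<open>T\<close> is closed and \<open>m\<close>-positive, \<open>0 \<le> \<integral> w dd\<^sup># v \<and> T \<and> \<beta>\<^sup>p\<^sup>-\<^sup>1 = \<integral> v dd\<^sup># w \<and> T \<and> \<beta>\<^sup>p\<^sup>-\<^sup>1\<close>.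
  Here \<open>dd\<^sup># w = \<eta> \<beta>\<close> up to a form that vanishes where \<open>\<eta> = 1\<close>; on the rest of \<open>Supp T\<close> the
  function \<open>v\<close> is bounded. This gives \<open>q! \<tau>(\<eta> v) \<ge> -C\<close>.

  That \<open>dd\<^sup># v\<close> is \<open>m\<close>-positive as a form is a duality statement for the cone of \<open>m\<close>-positive
  forms: for \<open>g\<^sub>j(s) = (\<beta> + s a)\<^sup>j \<and> \<beta>\<^sup>n\<^sup>-\<^sup>j\<close>, the hypothesis says that \<open>g\<^sub>j' \<ge> 0\<close> as long as \<open>\<beta> + s a\<close>
  stays in the cone, so \<open>g\<^sub>j \<ge> g\<^sub>j(0) = n!\<close> and \<open>\<beta> + s a\<close> never leaves it; divide by \<open>s\<close> and let
  \<open>s\<close> tend to infinity.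
\<close>

text \<open>Forms commute under the wedge product only up to sign, but sums of bidegrees
  \<open>(k, k)\<close> do commute, and the products in the positivity conditions on
  \<open>T\<close> and on \<open>u\<close> are of this kind. Such forms with constant coefficients
  therefore become a commutative ring type. Freezing a test function \<open>\<phi>\<close> turns a
  current \<open>R\<close> into an element \<open>current_at R \<phi>\<close> of this ring and the
  wedge with a constant form into ring multiplication. Duality is applied to this element for
  \<open>R = dd\<^sup># u\<close> and \<open>\<phi> y = \<rho> (x - y)\<close>, where it is the
  Hessian of \<open>u * \<rho>\<close> at \<open>x\<close>: weak positivity of a current becomes
  pointwise positivity of a smooth form, and smooth forms are what the \<open>m\<close>-positivity
  of \<open>T\<close> can be tested on.

  The quadratic function is chosen because its Hessian is the identity, which makes the trace
  appear. Control of \<open>v\<close> is available only near the boundary part of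
  \<open>Supp T\<close>, while the derivatives of \<open>\<eta>\<close> may also live away from
  \<open>Supp T\<close>. A second cutoff function removes that region, where the coefficients of
  \<open>T \<and> \<beta>\<^sup>p\<^sup>-\<^sup>1\<close> vanish, so that the error bound does not
  depend on the mollifier.\<close>

section \<open>Splittings of index sets and the signs of wedge products\<close>

text \<open>Both sides run over the ordered partitions of \<open>K\<close> into three blocks; the
  left side first fixes the union of the first two. Associativity of the wedge product uses this
  once for the \<open>dx\<close> and once for the \<open>d\<xi>\<close> indices.\<close>

lemma sum_Pow_split:
  fixes f :: "'a set \<Rightarrow> 'a set \<Rightarrow> 'a set \<Rightarrow> 'b::comm_monoid_add"
  assumes "finite K"
  shows "(\<Sum>A\<in>Pow K. \<Sum>B\<in>Pow A. f B (A - B) (K - A)) =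
         (\<Sum>B\<in>Pow K. \<Sum>C\<in>Pow (K - B). f B C (K - B - C))"
proof -
  have "(\<Sum>A\<in>Pow K. \<Sum>B\<in>Pow A. f B (A - B) (K - A)) =
        (\<Sum>(A, B)\<in>(SIGMA A:Pow K. Pow A). f B (A - B) (K - A))"
    using assms by (subst sum.Sigma) (auto dest: finite_subset)
  also have "\<dots> = (\<Sum>(B, C)\<in>(SIGMA B:Pow K. Pow (K - B)). f B C (K - B - C))"
    by (rule sum.reindex_bij_witness
          [where i = "\<lambda>(B, C). (B \<union> C, B)" and j = "\<lambda>(A, B). (B, A - B)"])
       (auto intro!: arg_cong[where f = "f _ _"])
  also have "\<dots> = (\<Sum>B\<in>Pow K. \<Sum>C\<in>Pow (K - B). f B C (K - B - C))"
    using assms by (subst sum.Sigma) auto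
  finally show ?thesis .
qed

lemma shuffle_sign_Un_left:
  assumes "A \<inter> B = {}"
  shows "shuffle_sign (A \<union> B) C = shuffle_sign A C * shuffle_sign B C"
proof -
  have "{(a, b) \<in> (A \<union> B) \<times> C. b < a} = {(a, b) \<in> A \<times> C. b < a} \<union> {(a, b) \<in> B \<times> C. b < a}"
    by auto
  moreover have "{(a, b) \<in> A \<times> C. b < a} \<inter> {(a, b) \<in> B \<times> C. b < a} = {}"
    using assms by auto
  ultimately show ?thesis
    by (simp add: shuffle_sign_def card_Un_disjoint power_add)
qed

lemma shuffle_sign_Un_right:
  assumes "A \<inter> B = {}"
  shows "shuffle_sign C (A \<union> B) = shuffle_sign C A * shuffle_sign C B"
proof -
  have "{(a, b) \<in> C \<times> (A \<union> B). b < a} = {(a, b) \<in> C \<times> A. b < a} \<union> {(a, b) \<in> C \<times> B. b < a}"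
    by auto
  moreover have "{(a, b) \<in> C \<times> A. b < a} \<inter> {(a, b) \<in> C \<times> B. b < a} = {}"
    using assms by auto
  ultimately show ?thesis
    by (simp add: shuffle_sign_def card_Un_disjoint power_add)
qed

lemma shuffle_sign_empty [simp]: "shuffle_sign {} A = 1" "shuffle_sign A {} = 1"
  by (auto simp: shuffle_sign_def)

lemma shuffle_sign_square [simp]: "shuffle_sign A B * shuffle_sign A B = 1"
  by (simp add: shuffle_sign_def flip: power_mult_distrib)

text \<open>As \<open>A\<close> and \<open>B\<close> are disjoint, every pair in
  \<open>A \<times> B\<close> is an inversion for exactly one of the two orders, so the two
  exponents add up to \<open>card A * card B\<close>.\<close>

lemma shuffle_sign_commute:
  assumes "A \<inter> B = {}"
  shows "shuffle_sign B A = (-1) ^ (card A * card B) * shuffle_sign A B"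
proof -
  let ?X = "{(a, b) \<in> A \<times> B. b < a}" and ?Y = "{(a, b) \<in> A \<times> B. a < b}"
  have "A \<times> B = ?X \<union> ?Y"
    using assms by (auto simp: neq_iff)
  moreover have "card (?X \<union> ?Y) = card ?X + card ?Y"
    by (rule card_Un_disjoint) auto
  ultimately have *: "card (A \<times> B) = card ?X + card ?Y"
    by (simp only:)
  moreover have "card {(a, b) \<in> B \<times> A. b < a} = card ?Y"
    by (rule bij_betw_same_card[of prod.swap]) (auto simp: bij_betw_def inj_on_def image_iff)
  moreover have "(-1::real) ^ c = (-1) ^ (c' + c) * (-1) ^ c'" for c c' :: nat
    by (simp add: power_add mult.assoc flip: power_mult_distrib)
  ultimately show ?thesis
    unfolding shuffle_sign_def card_cartesian_product[symmetric] by (simp only:)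
qed

text \<open>All exponents are additive over disjoint unions, so both sides expand into the same
  product of pairwise signs. This is the cocycle identity behind associativity.\<close>

lemma wedge_sign_assoc:
  assumes "B \<inter> C = {}" "B \<inter> D = {}" "C \<inter> D = {}" "B' \<inter> C' = {}" "B' \<inter> D' = {}" "C' \<inter> D' = {}"
  shows "wedge_sign B B' C C' * wedge_sign (B \<union> C) (B' \<union> C') D D' =
         wedge_sign C C' D D' * wedge_sign B B' (C \<union> D) (C' \<union> D')"
  using assms
  by (simp add: wedge_sign_def shuffle_sign_Un_left shuffle_sign_Un_right card_Un_disjoint
      power_add distrib_left distrib_right)

text \<open>Exchanging the \<open>dx\<close> blocks and exchanging the \<open>d\<xi>\<close> blocks
  cost the same sign when the cardinalities agree, so the two cancel. This is where bidegrees
  \<open>(k, k)\<close> matter.\<close>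

lemma wedge_sign_commute:
  assumes "A \<inter> B = {}" "A' \<inter> B' = {}" "card A = card A'" "card B = card B'"
  shows "wedge_sign B B' A A' = wedge_sign A A' B B'"
proof -
  have "(-1::real) ^ (card B' * card A') * (-1) ^ (card A' * card B') = 1"
    by (simp add: mult.commute flip: power_mult_distrib)
  then show ?thesis
    unfolding wedge_sign_def shuffle_sign_commute[OF assms(1)] shuffle_sign_commute[OF assms(2)]
      assms(3,4)
    by (simp add: mult_ac)
qed

lemma wedge_sign_swap:
  assumes "card K = card L" "card K' = card L'"
  shows "wedge_sign L K L' K' = wedge_sign K L K' L'"
  using assms by (simp add: wedge_sign_def)

lemma wedge_sign_diagonal: "wedge_sign K K L L = (-1) ^ (card K * card L)"
  by (simp add: wedge_sign_def mult.assoc)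

lemma sgn_sigma_Suc: "sgn_sigma (Suc k) = (-1) ^ k * sgn_sigma k"
proof -
  have "Suc k * (Suc k - 1) div 2 = k + k * (k - 1) div 2"
    by (cases k) (auto simp: algebra_simps)
  then show ?thesis by (simp add: sgn_sigma_def power_add)
qed

lemma sgn_sigma_square [simp]: "sgn_sigma k * sgn_sigma k = 1"
  by (simp add: sgn_sigma_def flip: power_mult_distrib)

text \<open>In the exponents this is the identity
  \<open>(j + k choose 2) = (j choose 2) + (k choose 2) + j * k\<close>.\<close>

lemma sgn_sigma_add: "sgn_sigma (j + k) = (-1) ^ (j * k) * sgn_sigma j * sgn_sigma k"
  by (induction k) (auto simp: sgn_sigma_Suc power_add algebra_simps sgn_sigma_def[of 0])

section \<open>The ring of constant forms of bidegrees (k, k)\<close>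

text \<open>The formula of \<open>form_wedge\<close> with numbers in place of coefficient functions.
  It applies to the values of a form at a point and equally to the values of a current at a fixed
  test function.\<close>

definition cwedge :: "('n::{finite,linorder} set \<Rightarrow> 'n set \<Rightarrow> real) \<Rightarrow> ('n set \<Rightarrow> 'n set \<Rightarrow> real) \<Rightarrow> 'n set \<Rightarrow> 'n set \<Rightarrow> real"
  where "cwedge a b K L =
     (\<Sum>K'\<in>Pow K. \<Sum>L'\<in>Pow L. wedge_sign K' L' (K - K') (L - L') * a K' L' * b (K - K') (L - L'))"

lemma cwedge_assoc:
  fixes a b c :: "'n::{finite,linorder} set \<Rightarrow> 'n set \<Rightarrow> real"
  shows "cwedge (cwedge a b) c = cwedge a (cwedge b c)"
proof (intro ext)
  fix K L :: "'n set"
  let ?f = "\<lambda>B C D B' C' D'. wedge_sign B B' C C' * wedge_sign (B \<union> C) (B' \<union> C') D D' * a B B' * b C C' * c D D'"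
  have "cwedge (cwedge a b) c K L =
      (\<Sum>A\<in>Pow K. \<Sum>A'\<in>Pow L. \<Sum>B\<in>Pow A. \<Sum>B'\<in>Pow A'. ?f B (A - B) (K - A) B' (A' - B') (L - A'))"
    unfolding cwedge_def sum_distrib_left sum_distrib_right
    by (intro sum.cong refl) (auto simp: Un_absorb1 Un_Diff_cancel algebra_simps)
  also have "\<dots> = (\<Sum>A\<in>Pow K. \<Sum>B\<in>Pow A. \<Sum>A'\<in>Pow L. \<Sum>B'\<in>Pow A'. ?f B (A - B) (K - A) B' (A' - B') (L - A'))"
    by (intro sum.cong refl sum.swap)
  also have "\<dots> = (\<Sum>B\<in>Pow K. \<Sum>C\<in>Pow (K - B). \<Sum>A'\<in>Pow L. \<Sum>B'\<in>Pow A'. ?f B C (K - B - C) B' (A' - B') (L - A'))"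
    by (rule sum_Pow_split) simp
  also have "\<dots> = (\<Sum>B\<in>Pow K. \<Sum>C\<in>Pow (K - B). \<Sum>B'\<in>Pow L. \<Sum>C'\<in>Pow (L - B'). ?f B C (K - B - C) B' C' (L - B' - C'))"
    by (intro sum.cong refl sum_Pow_split) simp
  also have "\<dots> = (\<Sum>B\<in>Pow K. \<Sum>B'\<in>Pow L. \<Sum>C\<in>Pow (K - B). \<Sum>C'\<in>Pow (L - B'). ?f B C (K - B - C) B' C' (L - B' - C'))"
    by (intro sum.cong refl sum.swap)
  also have "\<dots> = cwedge a (cwedge b c) K L"
    unfolding cwedge_def sum_distrib_left sum_distrib_right
  proof (intro sum.cong refl)
    fix B B' C C' assume *: "B \<in> Pow K" "B' \<in> Pow L" "C \<in> Pow (K - B)" "C' \<in> Pow (L - B')"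
    then have "wedge_sign B B' C C' * wedge_sign (B \<union> C) (B' \<union> C') (K - B - C) (L - B' - C') =
        wedge_sign C C' (K - B - C) (L - B' - C') *
        wedge_sign B B' (C \<union> (K - B - C)) (C' \<union> (L - B' - C'))"
      by (intro wedge_sign_assoc) auto
    moreover have "C \<union> (K - B - C) = K - B" "C' \<union> (L - B' - C') = L - B'"
      using * by auto
    ultimately show "?f B C (K - B - C) B' C' (L - B' - C') =
        wedge_sign B B' (K - B) (L - B') * a B B' *
        (wedge_sign C C' (K - B - C) (L - B' - C') * b C C' * c (K - B - C) (L - B' - C'))"
      by simp
  qed
  finally show "cwedge (cwedge a b) c K L = cwedge a (cwedge b c) K L" .
qed

definition even_form :: "('n::finite set \<Rightarrow> 'n set \<Rightarrow> real) \<Rightarrow> bool" where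
  "even_form a \<longleftrightarrow> (\<forall>K L. card K \<noteq> card L \<longrightarrow> a K L = 0)"

lemma cwedge_commute:
  fixes a b :: "'n::{finite,linorder} set \<Rightarrow> 'n set \<Rightarrow> real"
  assumes "even_form a" "even_form b"
  shows "cwedge a b = cwedge b a"
proof (intro ext)
  fix K L :: "'n set"
  \<comment> \<open>Complementation inside \<open>K\<close> and inside \<open>L\<close> exchanges
    the roles of the two factors.\<close>
  have bij: "(\<Sum>B\<in>Pow K. f B) = (\<Sum>B\<in>Pow K. f (K - B))" for f :: "'n set \<Rightarrow> real" and K
    by (rule sum.reindex_bij_witness[where i = "\<lambda>B. K - B" and j = "\<lambda>B. K - B"])
       (auto simp: double_diff)
  have "cwedge a b K L = (\<Sum>K'\<in>Pow K. \<Sum>L'\<in>Pow L.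
      wedge_sign (K - K') (L - L') (K - (K - K')) (L - (L - L')) * a (K - K') (L - L') *
      b (K - (K - K')) (L - (L - L')))"
    unfolding cwedge_def by (rule trans[OF bij sum.cong[OF refl bij]])
  also have "\<dots> = cwedge b a K L"
    unfolding cwedge_def
  proof (intro sum.cong refl)
    fix K' L' assume *: "K' \<in> Pow K" "L' \<in> Pow L"
    then have eq: "K - (K - K') = K'" "L - (L - L') = L'" by auto
    show "wedge_sign (K - K') (L - L') (K - (K - K')) (L - (L - L')) * a (K - K') (L - L') *
        b (K - (K - K')) (L - (L - L')) = wedge_sign K' L' (K - K') (L - L') * b K' L' * a (K - K') (L - L')"
    proof (cases "card K' = card L' \<and> card (K - K') = card (L - L')")
      case True
      then have "wedge_sign (K - K') (L - L') K' L' = wedge_sign K' L' (K - K') (L - L')"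
        by (intro wedge_sign_commute) auto
      then show ?thesis by (simp add: eq)
    next
      case False
      then show ?thesis using assms by (auto simp: eq even_form_def)
    qed
  qed
  finally show "cwedge a b K L = cwedge b a K L" .
qed

lemma even_form_cwedge:
  fixes a b :: "'n::{finite,linorder} set \<Rightarrow> 'n set \<Rightarrow> real"
  assumes "even_form a" "even_form b"
  shows "even_form (cwedge a b)"
  unfolding even_form_def cwedge_def
proof (intro allI impI sum.neutral ballI)
  fix K L K' L' :: "'n set"
  assume "card K \<noteq> card L" "K' \<in> Pow K" "L' \<in> Pow L"
  then have "card K' \<noteq> card L' \<or> card (K - K') \<noteq> card (L - L')"
    using card_Diff_subset[of K' K] card_mono[of K K'] card_Diff_subset[of L' L] card_mono[of L L']
    by auto
  then show "wedge_sign K' L' (K - K') (L - L') * a K' L' * b (K - K') (L - L') = 0"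
    using assms by (auto simp: even_form_def)
qed

definition unit_form :: "'n set \<Rightarrow> 'n set \<Rightarrow> real" where
  "unit_form K L = (if K = {} \<and> L = {} then 1 else 0)"

lemma cwedge_one:
  fixes a :: "'n::{finite,linorder} set \<Rightarrow> 'n set \<Rightarrow> real"
  shows "cwedge unit_form a = a"
proof (intro ext)
  fix K L :: "'n set"
  have "cwedge unit_form a K L = (\<Sum>K'\<in>Pow K. \<Sum>L'\<in>Pow L. if L' = {} then if K' = {} then a K L else 0 else 0)"
    unfolding cwedge_def by (intro sum.cong refl) (auto simp: unit_form_def wedge_sign_def)
  then show "cwedge unit_form a K L = a K L"
    by (simp add: sum.delta)
qed

text \<open>As a ring type, these forms inherit powers, \<open>prod_list\<close> and the
  rearrangement of products from the general algebra of \<open>comm_ring_1\<close>.\<close>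

typedef (overloaded) ('n::"{finite,linorder}") even_form = "Collect (even_form :: ('n set \<Rightarrow> 'n set \<Rightarrow> real) \<Rightarrow> bool)"
  morphisms coeff_of Even_Form
  by (rule exI[of _ "\<lambda>_ _. 0"]) (simp add: even_form_def)

setup_lifting type_definition_even_form

instantiation even_form :: ("{finite,linorder}") comm_ring_1
begin
lift_definition zero_even_form :: "'a even_form" is "\<lambda>_ _. 0" by (simp add: even_form_def)
lift_definition one_even_form :: "'a even_form" is unit_form by (auto simp: even_form_def unit_form_def)
lift_definition plus_even_form :: "'a even_form \<Rightarrow> 'a even_form \<Rightarrow> 'a even_form" is "\<lambda>a b K L. a K L + b K L"
  by (simp add: even_form_def)
lift_definition minus_even_form :: "'a even_form \<Rightarrow> 'a even_form \<Rightarrow> 'a even_form" is "\<lambda>a b K L. a K L - b K L"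
  by (simp add: even_form_def)
lift_definition uminus_even_form :: "'a even_form \<Rightarrow> 'a even_form" is "\<lambda>a K L. - a K L"
  by (simp add: even_form_def)
lift_definition times_even_form :: "'a even_form \<Rightarrow> 'a even_form \<Rightarrow> 'a even_form" is cwedge
  by (simp add: even_form_cwedge)
instance
proof
  fix a b c :: "'a even_form"
  show "a * b * c = a * (b * c)" by transfer (rule cwedge_assoc)
  show "a * b = b * a" by transfer (simp add: cwedge_commute)
  show "1 * a = a" by transfer (rule cwedge_one)
  show "(a + b) * c = a * c + b * c"
    by transfer (auto simp: cwedge_def fun_eq_iff algebra_simps simp flip: sum.distrib)
  show "a + b + c = a + (b + c)" by transfer (simp add: add.assoc)
  show "a + b = b + a" by transfer (simp add: add.commute)
  show "0 + a = a" by transfer simp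
  show "- a + a = 0" by transfer simp
  show "a - b = a + - b" by transfer simp
  show "(0::'a even_form) \<noteq> 1" by transfer (auto simp: unit_form_def fun_eq_iff)
qed
end

lift_definition scale :: "real \<Rightarrow> 'n::{finite,linorder} even_form \<Rightarrow> 'n even_form" is "\<lambda>r a K L. r * a K L"
  by (simp add: even_form_def)

lemma scale_mult_left [simp]: "scale r a * b = scale r (a * b)"
  by transfer (simp add: cwedge_def fun_eq_iff sum_distrib_left mult_ac)

lemma scale_mult_right [simp]: "a * scale r b = scale r (a * b)"
  by (metis mult.commute scale_mult_left)

lemma scale_scale [simp]: "scale r (scale s a) = scale (r * s) a"
  by transfer (simp add: mult.assoc)

lemma scale_add: "scale r (a + b) = scale r a + scale r b"
  by transfer (simp add: distrib_left)

lemma scale_1 [simp]: "scale 1 a = a"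
  by transfer simp

lemma scale_0 [simp]: "scale 0 a = 0"
  by transfer simp

lemma scale_power: "scale r a ^ k = scale (r ^ k) (a ^ k)"
  by (induction k) (simp_all add: mult_ac)

section \<open>Top coefficients and powers of beta\<close>

definition top_coeff :: "'n::{finite,linorder} even_form \<Rightarrow> real" where
  "top_coeff a = sgn_sigma CARD('n) * coeff_of a UNIV UNIV"

lemma top_coeff_add [simp]: "top_coeff (a + b) = top_coeff a + top_coeff b"
  by (simp add: top_coeff_def plus_even_form.rep_eq distrib_left)

lemma top_coeff_scale [simp]: "top_coeff (scale r a) = r * top_coeff a"
  by (simp add: top_coeff_def scale.rep_eq)

lift_definition beta :: "'n::{finite,linorder} even_form" is
  "\<lambda>K L. if \<exists>i. K = {i} \<and> L = {i} then 1 else 0"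
  by (auto simp: even_form_def)

lemma coeff_of_beta_mult:
  "coeff_of (beta * a) K L =
     (\<Sum>i\<in>K \<inter> L. wedge_sign {i} {i} (K - {i}) (L - {i}) * coeff_of a (K - {i}) (L - {i}))"
proof -
  let ?f = "\<lambda>K' L'. wedge_sign K' L' (K - K') (L - L') * (if \<exists>i. K' = {i} \<and> L' = {i} then 1 else 0)
        * coeff_of a (K - K') (L - L')"
  have "coeff_of (beta * a) K L = (\<Sum>(K', L')\<in>Pow K \<times> Pow L. ?f K' L')"
    by (simp add: times_even_form.rep_eq cwedge_def beta.rep_eq sum.cartesian_product)
  also have "\<dots> = (\<Sum>(K', L')\<in>(\<lambda>i. ({i}, {i})) ` (K \<inter> L). ?f K' L')"
    by (rule sum.mono_neutral_right) auto
  also have "\<dots> = (\<Sum>i\<in>K \<inter> L. ?f {i} {i})"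
    by (subst sum.reindex) (auto simp: inj_on_def)
  finally show ?thesis by simp
qed

text \<open>Each index set of size \<open>k + 1\<close> arises by adding any one of its
  \<open>k + 1\<close> elements last, which produces the factorial; moving the new pair past
  \<open>k\<close> others costs \<open>(-1) ^ k\<close>, the step from \<open>sgn_sigma k\<close> to
  \<open>sgn_sigma (Suc k)\<close>.\<close>

lemma coeff_of_beta_power:
  "coeff_of (beta ^ k :: 'n::{finite,linorder} even_form) K L =
     (if K = L \<and> card K = k then fact k * sgn_sigma k else 0)"
proof (induction k arbitrary: K L)
  case 0
  then show ?case by (auto simp: one_even_form.rep_eq unit_form_def sgn_sigma_def)
next
  case (Suc k)
  show ?case
  proof (cases "K = L \<and> card K = Suc k")
    case True
    have "coeff_of (beta ^ Suc k) K L = (\<Sum>i\<in>K. (-1) ^ k * (fact k * sgn_sigma k))"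
      unfolding power_Suc coeff_of_beta_mult Suc.IH
      using True by (intro sum.cong) (auto simp: wedge_sign_diagonal)
    moreover have "L = K" "card K = Suc k" using True by auto
    ultimately show ?thesis by (simp add: sgn_sigma_Suc del: power_Suc)
  next
    case False
    have "coeff_of (beta ^ Suc k) K L = 0"
      unfolding power_Suc coeff_of_beta_mult Suc.IH
    proof (intro sum.neutral ballI)
      fix i assume i: "i \<in> K \<inter> L"
      have "\<not> (K - {i} = L - {i} \<and> card (K - {i}) = k)"
      proof
        assume "K - {i} = L - {i} \<and> card (K - {i}) = k"
        then have *: "K - {i} = L - {i}" and k: "card (K - {i}) = k" by blast+
        have "K = insert i (K - {i})" "L = insert i (L - {i})" using i by blast+
        then have "K = L" unfolding * by (rule trans[OF _ sym])
        moreover have "card K = Suc k" using card_Suc_Diff1[of K i] i k by simp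
        ultimately show False using False by blast
      qed
      then show "wedge_sign {i} {i} (K - {i}) (L - {i}) *
          (if K - {i} = L - {i} \<and> card (K - {i}) = k then fact k * sgn_sigma k else 0) = 0"
        by (simp only: if_False mult_zero_right)
    qed
    then show ?thesis by (simp only: False if_False)
  qed
qed

lemma top_coeff_beta_power:
  "top_coeff (beta ^ CARD('n) :: 'n::{finite,linorder} even_form) = fact CARD('n)"
  by (simp add: top_coeff_def coeff_of_beta_power algebra_simps)

text \<open>Since \<open>beta ^ q\<close> is diagonal, only the diagonal coefficients of
  \<open>a\<close> survive, and the signs combine by \<open>sgn_sigma_add\<close>. This identifies
  \<open>S \<and> \<beta>\<^sup>q\<close> with a multiple of the trace.\<close>

lemma top_coeff_mult_beta_power:
  fixes a :: "'n::{finite,linorder} even_form"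
  assumes "\<And>K L. card K \<noteq> CARD('n) - q \<Longrightarrow> coeff_of a K L = 0" "q \<le> CARD('n)"
  shows "top_coeff (a * beta ^ q) =
    fact q * (\<Sum>K | card K = CARD('n) - q. sgn_sigma (CARD('n) - q) * coeff_of a K K)"
proof -
  let ?n = "CARD('n)"
  have n: "sgn_sigma ?n = (-1) ^ ((?n - q) * q) * sgn_sigma (?n - q) * sgn_sigma q"
    using sgn_sigma_add[of "?n - q" q] assms(2) by simp
  have "coeff_of (a * beta ^ q) UNIV UNIV =
     (\<Sum>K\<in>UNIV. \<Sum>L\<in>UNIV. if L = K then wedge_sign K K (-K) (-K) * coeff_of a K K * (if card (-K) = q then fact q * sgn_sigma q else 0) else 0)"
    unfolding times_even_form.rep_eq cwedge_def
    by (intro sum.cong) (auto simp: coeff_of_beta_power Compl_eq_Diff_UNIV[symmetric])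
  also have "\<dots> = (\<Sum>K\<in>UNIV. wedge_sign K K (-K) (-K) * coeff_of a K K * (if card (-K) = q then fact q * sgn_sigma q else 0))"
    by simp
  also have "\<dots> = (\<Sum>K | card K = ?n - q. (-1) ^ ((?n - q) * q) * coeff_of a K K * (fact q * sgn_sigma q))"
  proof (rule sum.mono_neutral_cong_right)
    fix K :: "'n set" assume "K \<in> {K. card K = ?n - q}"
    then show "wedge_sign K K (-K) (-K) * coeff_of a K K * (if card (-K) = q then fact q * sgn_sigma q else 0) =
       (-1) ^ ((?n - q) * q) * coeff_of a K K * (fact q * sgn_sigma q)"
      using assms(2) by (simp add: wedge_sign_diagonal Compl_eq_Diff_UNIV card_Diff_subset)
  qed (use assms in auto)
  finally have *: "coeff_of (a * beta ^ q) UNIV UNIV =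
     (\<Sum>K | card K = ?n - q. (-1) ^ ((?n - q) * q) * coeff_of a K K * (fact q * sgn_sigma q))" .
  have s: "(-1::real) ^ c * (-1) ^ c = 1" for c by (simp flip: power_mult_distrib)
  have "sgn_sigma ?n * ((-1) ^ ((?n - q) * q) * x * (fact q * sgn_sigma q)) =
     ((-1) ^ ((?n - q) * q) * (-1) ^ ((?n - q) * q)) * (sgn_sigma q * sgn_sigma q) * (fact q * (sgn_sigma (?n - q) * x))" for x
    unfolding n by (simp only: mult_ac)
  then show ?thesis
    unfolding top_coeff_def * sum_distrib_left s sgn_sigma_square mult_1_left
    by (intro sum.cong refl) blast
qed

section \<open>The cone of m-positive forms\<close>

definition m_positive :: "nat \<Rightarrow> 'n::{finite,linorder} even_form \<Rightarrow> bool" where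
  "m_positive m a \<longleftrightarrow> (\<forall>j\<in>{1..m}. top_coeff (a ^ j * beta ^ (CARD('n) - j)) \<ge> 0)"

lemma has_derivative_top_coeff_power:
  "((\<lambda>s. top_coeff ((b + scale s a) ^ j * c)) has_real_derivative
     real j * top_coeff (a * (b + scale s a) ^ (j - 1) * c)) (at s)"
proof (induction j arbitrary: c)
  case 0
  then show ?case by simp
next
  case (Suc j)
  \<comment> \<open>One factor \<open>b + s a\<close> is absorbed into the constant factor, which
    becomes \<open>b * c\<close> or \<open>a * c\<close>; hence the induction over all
    \<open>c\<close>.\<close>
  have eq: "top_coeff ((b + scale s a) ^ Suc j * c) =
      top_coeff ((b + scale s a) ^ j * (b * c)) + s * top_coeff ((b + scale s a) ^ j * (a * c))" for s
  proof -
    have "(b + scale s a) ^ Suc j * c = (b + scale s a) ^ j * (b * c) + scale s ((b + scale s a) ^ j * (a * c))"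
      by (simp add: distrib_left distrib_right mult_ac)
    then show ?thesis by simp
  qed
  have "((\<lambda>s. top_coeff ((b + scale s a) ^ j * (b * c)) + s * top_coeff ((b + scale s a) ^ j * (a * c)))
     has_real_derivative (real j * top_coeff (a * (b + scale s a) ^ (j - 1) * (b * c)) +
       (top_coeff ((b + scale s a) ^ j * (a * c)) + s * (real j * top_coeff (a * (b + scale s a) ^ (j - 1) * (a * c)))))) (at s)"
    by (auto intro!: derivative_eq_intros Suc.IH)
  moreover have "real j * top_coeff (a * (b + scale s a) ^ (j - 1) * (b * c)) +
       (top_coeff ((b + scale s a) ^ j * (a * c)) + s * (real j * top_coeff (a * (b + scale s a) ^ (j - 1) * (a * c)))) =
     real (Suc j) * top_coeff (a * (b + scale s a) ^ j * c)"
  proof (cases j)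
    case (Suc i)
    have "a * (b + scale s a) ^ i * (b * c) + scale s (a * (b + scale s a) ^ i * (a * c)) =
        a * (b + scale s a) ^ j * c"
      unfolding Suc by (simp add: distrib_left distrib_right mult_ac)
    from arg_cong[OF this, of top_coeff]
    have "top_coeff (a * (b + scale s a) ^ i * (b * c)) + s * top_coeff (a * (b + scale s a) ^ i * (a * c)) =
        top_coeff (a * (b + scale s a) ^ j * c)" by simp
    moreover have "top_coeff ((b + scale s a) ^ j * (a * c)) = top_coeff (a * (b + scale s a) ^ j * c)"
      by (simp add: mult_ac)
    ultimately show ?thesis unfolding Suc by (simp add: algebra_simps)
  qed (simp add: mult_ac)
  ultimately show ?case unfolding eq by simp
qed


lemma isCont_top_coeff_power: "isCont (\<lambda>s. top_coeff ((b + scale s a) ^ j * c)) s"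
  by (rule DERIV_isCont[OF has_derivative_top_coeff_power])

lemma m_positive_beta: "m \<le> CARD('n) \<Longrightarrow> m_positive m (beta :: 'n::{finite,linorder} even_form)"
  by (auto simp: m_positive_def top_coeff_beta_power simp flip: power_add)

lemma m_positive_scale: "m_positive m a \<Longrightarrow> 0 \<le> r \<Longrightarrow> m_positive m (scale r a)"
  by (auto simp: m_positive_def scale_power)

theorem m_positive_dual:
  fixes a :: "'n::{finite,linorder} even_form"
  assumes m: "m \<le> CARD('n)"
    and dual: "\<And>s j. 0 \<le> s \<Longrightarrow> m_positive m (beta + scale s a) \<Longrightarrow> 1 \<le> j \<Longrightarrow> j \<le> m \<Longrightarrow>
      top_coeff (a * (beta + scale s a) ^ (j - 1) * beta ^ (CARD('n) - j)) \<ge> 0"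
  shows "m_positive m a"
proof -
  define g where "g j s = top_coeff ((beta + scale s a) ^ j * beta ^ (CARD('n) - j))" for j s
  have cont: "continuous_on X (g j)" for j X
    unfolding g_def by (intro continuous_at_imp_continuous_on ballI isCont_top_coeff_power)
  have g0: "g j 0 = fact CARD('n)" if "j \<in> {1..m}" for j
    using that m by (simp add: g_def top_coeff_beta_power flip: power_add)
  have pos: "g j s > 0" if "j \<in> {1..m}" "0 \<le> s" for j s
  proof (rule ccontr)
    \<comment> \<open>The times up to \<open>s\<close> at which some \<open>g j\<close> fails to be
      positive. Compactness provides a first such time \<open>s0\<close>.\<close>
    define B where "B = (\<Union>j\<in>{1..m}. {0..s} \<inter> g j -` {..0})"
    assume "\<not> g j s > 0"
    then have "s \<in> B" using that by (auto simp: B_def not_less intro!: bexI[of _ j])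
    moreover have "compact ({0..s} \<inter> g j -` {..0})" for j
      using compact_Int_closed[OF compact_Icc continuous_closed_preimage[OF cont closed_atLeastAtMost closed_atMost]]
      by (metis Int_left_absorb)
    then have "compact B" unfolding B_def by (intro compact_UN) auto
    ultimately obtain s0 where s0: "s0 \<in> B" "\<And>t. t \<in> B \<Longrightarrow> s0 \<le> t"
      using compact_attains_inf[of B] by auto
    have before: "g i t > 0" if "0 \<le> t" "t < s0" "i \<in> {1..m}" for i t
      using s0 that by (force simp: B_def not_le)
    obtain i where i: "i \<in> {1..m}" "g i s0 \<le> 0" "0 \<le> s0"
      using s0(1) by (auto simp: B_def)
    \<comment> \<open>Before \<open>s0\<close> all the functions are positive, so the form lies in
      the cone and \<open>dual\<close> makes the derivative of \<open>g i\<close> nonnegative. Then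
      \<open>g i\<close> cannot have dropped from \<open>fact CARD('n)\<close> to a value below or
      equal to 0.\<close>
    have "g i 0 \<le> g i s0"
    proof (rule DERIV_nonneg_imp_increasing_open[OF \<open>0 \<le> s0\<close> _ cont])
      fix t assume t: "0 < t" "t < s0"
      then have "m_positive m (beta + scale t a)"
        using before[of t] by (auto simp: m_positive_def g_def intro: less_imp_le)
      then have "top_coeff (a * (beta + scale t a) ^ (i - 1) * beta ^ (CARD('n) - i)) \<ge> 0"
        using i t by (intro dual) auto
      then show "\<exists>y. (g i has_real_derivative y) (at t) \<and> 0 \<le> y"
        unfolding g_def
        by (intro exI[where x = "real i * top_coeff (a * (beta + scale t a) ^ (i - 1) * beta ^ (CARD('n) - i))"]
            conjI has_derivative_top_coeff_power mult_nonneg_nonneg of_nat_0_le_iff)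
    qed
    with i g0[OF i(1)] show False
      by (smt (verit) fact_gt_zero)
  qed
  show ?thesis
    unfolding m_positive_def
  proof
    fix j assume j: "j \<in> {1..m}"
    \<comment> \<open>With \<open>r = 1 / s\<close> the form \<open>a + r \<beta>\<close> is
      \<open>r (\<beta> + s a)\<close>, so the limit for \<open>s\<close> tending to infinity
      becomes right-continuity in \<open>r\<close> at 0.\<close>
    let ?h = "\<lambda>r. top_coeff ((a + scale r beta) ^ j * beta ^ (CARD('n) - j))"
    have "(?h \<longlongrightarrow> ?h 0) (at_right 0)"
      using isCont_top_coeff_power[where b = a and a = beta and s = 0]
      by (auto simp: isCont_def intro: filterlim_at_split[THEN iffD1, THEN conjunct2])
    moreover have "?h r \<ge> 0" if "r > 0" for r
    proof -
      have "a + scale r beta = scale r (beta + scale (1 / r) a)"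
        using that by (simp add: scale_add add.commute)
      then have "?h r = r ^ j * g j (1 / r)"
        by (simp add: scale_power g_def)
      then show ?thesis using pos[OF j, of "1 / r"] that by (simp add: less_imp_le)
    qed
    then have "eventually (\<lambda>r. ?h r \<ge> 0) (at_right 0)"
      by (simp add: eventually_at_right_less eventually_at_filter)
    ultimately have "?h 0 \<ge> 0"
      by (intro tendsto_lowerbound[of ?h _ "at_right 0"]) auto
    then show "0 \<le> top_coeff (a ^ j * beta ^ (CARD('n) - j))" by simp
  qed
qed

section \<open>Forms and currents at a point\<close>

definition form_at :: "'n::{finite,linorder} form \<Rightarrow> real^'n::{finite,linorder} \<Rightarrow> 'n even_form" where
  "form_at \<alpha> x = Even_Form (\<lambda>K L. \<alpha> K L x)"

lemma coeff_of_form_at: "even_form (\<lambda>K L. \<alpha> K L x) \<Longrightarrow> coeff_of (form_at \<alpha> x) K L = \<alpha> K L x"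
  by (simp add: form_at_def Even_Form_inverse)

lemma form_wedge_eq_cwedge:
  "(\<lambda>K L. form_wedge \<alpha> \<gamma> K L x) = cwedge (\<lambda>K L. \<alpha> K L x) (\<lambda>K L. \<gamma> K L x)"
  by (simp add: form_wedge_def cwedge_def fun_eq_iff)

lemma form_at_wedge:
  assumes "even_form (\<lambda>K L. \<alpha> K L x)" "even_form (\<lambda>K L. \<gamma> K L x)"
  shows "form_at (form_wedge \<alpha> \<gamma>) x = form_at \<alpha> x * form_at \<gamma> x"
    and "even_form (\<lambda>K L. form_wedge \<alpha> \<gamma> K L x)"
  using assms
  by (simp_all add: form_wedge_eq_cwedge even_form_cwedge form_at_def times_even_form.abs_eq eq_onp_def)

lemma form_at_power:
  assumes "even_form (\<lambda>K L. \<alpha> K L x)"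
  shows "form_at (form_power \<alpha> k) x = form_at \<alpha> x ^ k \<and> even_form (\<lambda>K L. form_power \<alpha> k K L x)"
proof (induction k)
  case 0
  have "(\<lambda>K L. form_one K L x) = unit_form" by (simp add: form_one_def unit_form_def fun_eq_iff)
  then show ?case
    by (simp add: form_power_def form_at_def one_even_form_def) (auto simp: even_form_def unit_form_def)
next
  case (Suc k)
  then show ?case using form_at_wedge[of \<alpha> x "form_power \<alpha> k"] assms by (simp add: form_power_def)
qed

lemma even_form_beta: "even_form (\<lambda>K L. form_beta K L x)"
  by (auto simp: even_form_def form_beta_def)

lemma form_at_beta: "form_at form_beta x = beta"
  by (simp add: form_at_def beta_def form_beta_def)

definition const_form :: "'n::{finite,linorder} even_form \<Rightarrow> 'n form" where
  "const_form a K L x = coeff_of a K L"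

lemma even_form_coeff_of: "even_form (coeff_of a)"
  using coeff_of[of a] by simp

lemma form_at_const_form [simp]: "form_at (const_form a) x = a"
  by (simp add: form_at_def const_form_def coeff_of_inverse)

lemma form_power_beta: "form_power form_beta k = const_form (beta ^ k)"
proof (intro ext)
  fix K L x
  show "form_power form_beta k K L x = const_form (beta ^ k) K L x"
    using form_at_power[of form_beta x k, OF even_form_beta] coeff_of_form_at[of "form_power form_beta k" x K L]
    by (simp add: const_form_def form_at_beta)
qed

lemma even_form_bidegree_11:
  assumes "form_bidegree \<Omega> 1 1 \<alpha>" "x \<in> \<Omega>"
  shows "even_form (\<lambda>K L. \<alpha> K L x)"
  using assms by (auto simp: even_form_def form_bidegree_def)

lemma m_positive_form_iff:
  "m_positive_form m \<Omega> \<alpha> \<longleftrightarrow> form_bidegree \<Omega> 1 1 \<alpha> \<and> form_symmetric \<Omega> \<alpha> \<and>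
     (\<forall>x\<in>\<Omega>. m_positive m (form_at \<alpha> x))"
proof -
  have "form_top (form_wedge (form_power \<alpha> j) (form_power form_beta k)) x =
      top_coeff (form_at \<alpha> x ^ j * beta ^ k)" if "form_bidegree \<Omega> 1 1 \<alpha>" "x \<in> \<Omega>" for x j k
  proof -
    note e = form_at_power[where \<alpha> = \<alpha> and x = x, OF even_form_bidegree_11[OF that]]
      form_at_power[where \<alpha> = form_beta and x = x, OF even_form_beta]
    have "even_form (\<lambda>K L. form_wedge (form_power \<alpha> j) (form_power form_beta k) K L x)"
      using e by (intro form_at_wedge(2)) auto
    then have "form_top (form_wedge (form_power \<alpha> j) (form_power form_beta k)) x =
        top_coeff (form_at (form_wedge (form_power \<alpha> j) (form_power form_beta k)) x)"
      by (simp add: form_top_def top_coeff_def coeff_of_form_at)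
    also have "\<dots> = top_coeff (form_at \<alpha> x ^ j * beta ^ k)"
      using e by (simp add: form_at_wedge form_at_beta)
    finally show ?thesis .
  qed
  then show ?thesis unfolding m_positive_form_def m_positive_def by auto
qed

text \<open>The only linearity that a wedge with a constant form uses. Fixing \<open>\<phi>\<close>
  keeps it meaningful for total functionals and lets it pass to iterated products.\<close>

definition homogeneous :: "'n::{finite,linorder} supercurrent \<Rightarrow> (real^'n::{finite,linorder} \<Rightarrow> real) \<Rightarrow> bool" where
  "homogeneous R \<phi> \<longleftrightarrow> (\<forall>K L c. R K L (\<lambda>x. c * \<phi> x) = c * R K L \<phi>)"

lemma current_wedge_const_form:
  assumes "homogeneous R \<phi>"
  shows "(\<lambda>K L. current_wedge R (const_form a) K L \<phi>) = cwedge (\<lambda>K L. R K L \<phi>) (coeff_of a)"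
    and "homogeneous (current_wedge R (const_form a)) \<phi>"
proof -
  have *: "R K L (\<lambda>x. c * \<phi> x) = c * R K L \<phi>" for K L c
    using assms by (simp add: homogeneous_def)
  have **: "R K L (\<lambda>x. c * (d * \<phi> x)) = c * d * R K L \<phi>" for K L c d
    using *[of K L "c * d"] by (simp add: mult.assoc)
  show "(\<lambda>K L. current_wedge R (const_form a) K L \<phi>) = cwedge (\<lambda>K L. R K L \<phi>) (coeff_of a)"
    unfolding fun_eq_iff current_wedge_def const_form_def cwedge_def *
    by (intro allI sum.cong refl) (simp only: mult_ac)
  show "homogeneous (current_wedge R (const_form a)) \<phi>"
    unfolding homogeneous_def current_wedge_def const_form_def * ** sum_distrib_left
    by (intro allI sum.cong refl) (simp only: mult_ac)
qed

text \<open>A current frozen at a test function is a constant form. By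
  \<open>current_at_wedge\<close> the wedge with constant forms then is ring multiplication.\<close>

definition current_at :: "'n::{finite,linorder} supercurrent \<Rightarrow> (real^'n::{finite,linorder} \<Rightarrow> real) \<Rightarrow> 'n even_form" where
  "current_at R \<phi> = Even_Form (\<lambda>K L. R K L \<phi>)"

lemma coeff_of_current_at: "even_form (\<lambda>K L. R K L \<phi>) \<Longrightarrow> coeff_of (current_at R \<phi>) K L = R K L \<phi>"
  by (simp add: current_at_def Even_Form_inverse)

lemma current_at_wedge:
  assumes "homogeneous R \<phi>" "even_form (\<lambda>K L. R K L \<phi>)"
  shows "current_at (current_wedge R (const_form a)) \<phi> = current_at R \<phi> * a"
    and "even_form (\<lambda>K L. current_wedge R (const_form a) K L \<phi>)"
proof -
  have "current_at R \<phi> * Even_Form (coeff_of a) = Even_Form (cwedge (\<lambda>K L. R K L \<phi>) (coeff_of a))"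
    using assms even_form_coeff_of unfolding current_at_def
    by (subst times_even_form.abs_eq) (auto simp: eq_onp_def)
  then show "current_at (current_wedge R (const_form a)) \<phi> = current_at R \<phi> * a"
    unfolding current_at_def current_wedge_const_form(1)[OF assms(1)] by (simp add: coeff_of_inverse)
  show "even_form (\<lambda>K L. current_wedge R (const_form a) K L \<phi>)"
    unfolding current_wedge_const_form(1)[OF assms(1)]
    by (intro even_form_cwedge assms(2) even_form_coeff_of)
qed

lemma current_at_foldl:
  assumes "homogeneous R \<phi>" "even_form (\<lambda>K L. R K L \<phi>)"
  shows "current_at (foldl current_wedge R (map const_form as)) \<phi> = current_at R \<phi> * prod_list as \<and>
    even_form (\<lambda>K L. foldl current_wedge R (map const_form as) K L \<phi>) \<and>
    homogeneous (foldl current_wedge R (map const_form as)) \<phi>"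
  using assms
proof (induction as arbitrary: R)
  case (Cons a as)
  show ?case
    using Cons.IH[OF current_wedge_const_form(2)[OF Cons.prems(1)] current_at_wedge(2)[OF Cons.prems]]
    by (simp add: current_at_wedge(1)[OF Cons.prems] mult.assoc)
qed simp

lemma current_top_eq:
  assumes "even_form (\<lambda>K L. R K L \<phi>)"
  shows "current_top R \<phi> = top_coeff (current_at R \<phi>)"
  using assms by (simp add: current_top_def top_coeff_def coeff_of_current_at)

text \<open>The Leibniz rule when the second factor has constant coefficients: the pairs of an index
  \<open>i\<close> and a set \<open>A\<close> without it are reindexed by \<open>insert i A\<close>,
  and the signs agree by associativity. Homogeneity is asked at \<open>partial i \<phi>\<close>
  because distributional derivatives act on the test function.\<close>

lemma current_d_wedge_const_form:
  assumes "\<And>i. homogeneous R (partial i \<phi>)"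
  shows "current_d (current_wedge R (const_form a)) K L \<phi> =
    cwedge (\<lambda>K L. current_d R K L \<phi>) (coeff_of a) K L"
proof -
  let ?g = "\<lambda>i A L'. wedge_sign {i} {} (A - {i}) L' * wedge_sign A L' (K - A) (L - L') *
      coeff_of a (K - A) (L - L') * - R (A - {i}) L' (partial i \<phi>)"
  have "current_d (current_wedge R (const_form a)) K L \<phi> =
      (\<Sum>i\<in>K. wedge_sign {i} {} (K - {i}) L * - cwedge (\<lambda>K L. R K L (partial i \<phi>)) (coeff_of a) (K - {i}) L)"
    unfolding current_d_def dist_partial_def
    using current_wedge_const_form(1)[OF assms] by (simp add: fun_eq_iff)
  also have "\<dots> = (\<Sum>i\<in>K. \<Sum>A\<in>Pow (K - {i}). \<Sum>L'\<in>Pow L. ?g i (insert i A) L')"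
    unfolding cwedge_def sum_distrib_left sum_negf[symmetric]
  proof (intro sum.cong refl)
    fix i A L' assume *: "i \<in> K" "A \<in> Pow (K - {i})" "L' \<in> Pow L"
    then have "wedge_sign {i} {} A L' * wedge_sign ({i} \<union> A) ({} \<union> L') (K - {i} - A) (L - L') =
        wedge_sign A L' (K - {i} - A) (L - L') *
        wedge_sign {i} {} (A \<union> (K - {i} - A)) (L' \<union> (L - L'))"
      by (intro wedge_sign_assoc) auto
    moreover have "A \<union> (K - {i} - A) = K - {i}" "L' \<union> (L - L') = L" "K - insert i A = K - {i} - A"
      "insert i A - {i} = A" using * by auto
    ultimately show "wedge_sign {i} {} (K - {i}) L *
        - (wedge_sign A L' (K - {i} - A) (L - L') * R A L' (partial i \<phi>) *
           coeff_of a (K - {i} - A) (L - L')) = ?g i (insert i A) L'"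
      by simp
  qed
  also have "\<dots> = (\<Sum>(i, A)\<in>(SIGMA i:K. Pow (K - {i})). \<Sum>L'\<in>Pow L. ?g i (insert i A) L')"
    by (subst sum.Sigma) auto
  also have "\<dots> = (\<Sum>(A, i)\<in>(SIGMA A:Pow K. A). \<Sum>L'\<in>Pow L. ?g i A L')"
    by (rule sum.reindex_bij_witness
        [where i = "\<lambda>(A, i). (i, A - {i})" and j = "\<lambda>(i, A). (insert i A, i)"])
       (auto simp: insert_absorb)
  also have "\<dots> = (\<Sum>A\<in>Pow K. \<Sum>i\<in>A. \<Sum>L'\<in>Pow L. ?g i A L')"
    by (subst sum.Sigma) auto
  also have "\<dots> = (\<Sum>A\<in>Pow K. \<Sum>L'\<in>Pow L. \<Sum>i\<in>A. ?g i A L')"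
    by (intro sum.cong refl sum.swap)
  also have "\<dots> = cwedge (\<lambda>K L. current_d R K L \<phi>) (coeff_of a) K L"
    unfolding cwedge_def current_d_def dist_partial_def sum_distrib_left sum_distrib_right
    by (intro sum.cong refl) (simp add: mult_ac)
  finally show ?thesis .
qed

text \<open>Where the coefficient of \<open>\<alpha>\<close> is identically zero the term becomes
  \<open>R K L (\<lambda>x. 0)\<close>, hence the second hypothesis. The remaining index sets of
  \<open>R\<close> are complements of singletons.\<close>

lemma current_wedge_top_11:
  fixes \<alpha> :: "'n::{finite,linorder} form"
  assumes "\<And>K L x. card K \<noteq> 1 \<or> card L \<noteq> 1 \<Longrightarrow> \<alpha> K L x = 0" "\<And>K L. R K L (\<lambda>x. 0) = 0"
  shows "current_wedge R \<alpha> UNIV UNIV \<phi> =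
    (\<Sum>i\<in>UNIV. \<Sum>j\<in>UNIV. wedge_sign (-{i}) (-{j}) {i} {j} * R (-{i}) (-{j}) (\<lambda>x. \<alpha> {i} {j} x * \<phi> x))"
proof -
  let ?f = "\<lambda>K L. wedge_sign K L (UNIV - K) (UNIV - L) * R K L (\<lambda>x. \<alpha> (UNIV - K) (UNIV - L) x * \<phi> x)"
  let ?C = "\<lambda>(i, j). (-{i}, -{j})"
  have "current_wedge R \<alpha> UNIV UNIV \<phi> = (\<Sum>(K, L)\<in>UNIV \<times> UNIV. ?f K L)"
    by (simp add: current_wedge_def sum.cartesian_product)
  also have "\<dots> = (\<Sum>(K, L)\<in>?C ` (UNIV \<times> UNIV). ?f K L)"
  proof (rule sum.mono_neutral_right)
    show "\<forall>x\<in>UNIV \<times> UNIV - ?C ` (UNIV \<times> UNIV). (case x of (K, L) \<Rightarrow> ?f K L) = 0"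
    proof clarify
      fix K L :: "'n set" assume *: "(K, L) \<notin> ?C ` (UNIV \<times> UNIV)"
      have "card (UNIV - K) \<noteq> 1 \<or> card (UNIV - L) \<noteq> 1"
      proof (rule ccontr)
        assume "\<not> ?thesis"
        then obtain i j where "UNIV - K = {i}" "UNIV - L = {j}" by (auto simp: card_1_singleton_iff)
        then have "K = -{i}" "L = -{j}" by auto
        with * show False by auto
      qed
      then show "?f K L = 0" using assms by simp
    qed
  qed auto
  also have "\<dots> = (\<Sum>(i, j)\<in>UNIV \<times> UNIV. ?f (-{i}) (-{j}))"
    by (subst sum.reindex) (auto simp: inj_on_def split_def)
  finally show ?thesis by (simp add: sum.cartesian_product Compl_eq_Diff_UNIV double_diff)
qed

section \<open>Smooth functions\<close>

lemma partials_simps [simp]: "partials [] f = f" "partials (i # is) f = partial i (partials is f)"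
  by (simp_all add: partials_def)

lemma partials_snoc: "partials (is @ [i]) f = partials is (partial i f)"
  by (simp add: partials_def)

lemma smooth_differentiable: "smooth_on UNIV f \<Longrightarrow> f differentiable at x"
  unfolding smooth_on_def by (metis UNIV_I partials_simps(1))

lemma smooth_partial: "smooth_on UNIV f \<Longrightarrow> smooth_on UNIV (partial i f)"
  unfolding smooth_on_def by (metis partials_snoc)

text \<open>Whereas \<open>partials\<close> adds derivatives on the outside, this recursion peels
  off the innermost one. So the product and chain rules can be applied before the induction
  hypothesis.\<close>

fun times_diff :: "nat \<Rightarrow> (real^'n::finite \<Rightarrow> real) \<Rightarrow> bool" where
  "times_diff 0 f \<longleftrightarrow> (\<forall>x. f differentiable at x)"
| "times_diff (Suc k) f \<longleftrightarrow> (\<forall>x. f differentiable at x) \<and> (\<forall>i. times_diff k (partial i f))"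

lemma times_diff_iff:
  "times_diff k f \<longleftrightarrow> (\<forall>is x. length is \<le> k \<longrightarrow> partials is f differentiable at x)"
proof (induction k arbitrary: f)
  case (Suc k)
  have "(\<forall>is x. length is \<le> Suc k \<longrightarrow> partials is f differentiable at x) \<longleftrightarrow>
    (\<forall>x. f differentiable at x) \<and> (\<forall>i is x. length is \<le> k \<longrightarrow> partials (is @ [i]) f differentiable at x)"
    (is "?l \<longleftrightarrow> ?r")
  proof
    assume ?l
    then show ?r
      by (metis bot_nat_0.extremum length_append_singleton list.size(3) not_less_eq_eq partials_simps(1))
  next
    assume r: ?r
    show ?l
    proof (intro allI impI)
      fix "is" :: "'a list" and x assume "length is \<le> Suc k"
      then show "partials is f differentiable at x"
        using r by (cases "is" rule: rev_cases) auto
    qed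
  qed
  then show ?case by (simp add: Suc.IH partials_snoc)
qed simp

lemma smooth_iff: "smooth_on UNIV f \<longleftrightarrow> (\<forall>k. times_diff k f)"
  unfolding smooth_on_def times_diff_iff by auto

lemma times_diff_Suc: "times_diff (Suc k) f \<Longrightarrow> times_diff k f"
  unfolding times_diff_iff by auto

lemma has_derivative_partial:
  assumes "(f has_derivative D) (at x)"
  shows "partial i f x = D (axis i 1)"
  using frechet_derivative_at[OF assms] by (simp add: partial_def)

lemma differentiable_has_derivative_partial:
  fixes f :: "real^'n::finite \<Rightarrow> real"
  assumes "f differentiable at x"
  shows "(f has_derivative (\<lambda>h. \<Sum>i\<in>UNIV. h $ i * partial i f x)) (at x)"
proof -
  let ?D = "frechet_derivative f (at x)"
  have D: "(f has_derivative ?D) (at x)" using assms frechet_derivative_works by blast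
  then interpret bounded_linear ?D by (rule has_derivative_bounded_linear)
  have "?D h = (\<Sum>i\<in>UNIV. h $ i * partial i f x)" for h
  proof -
    have "?D h = ?D (\<Sum>i\<in>UNIV. h $ i *\<^sub>R axis i 1)"
      by (simp add: basis_expansion flip: scalar_mult_eq_scaleR)
    then show ?thesis by (simp add: sum scale partial_def)
  qed
  then have "?D = (\<lambda>h. \<Sum>i\<in>UNIV. h $ i * partial i f x)" by (rule ext)
  with D show ?thesis by simp
qed

lemma partial_add:
  assumes "\<And>x. f differentiable at x" "\<And>x. g differentiable at x"
  shows "partial i (\<lambda>x. f x + g x) = (\<lambda>x. partial i f x + partial i g x)"
proof
  fix x
  have "((\<lambda>x. f x + g x) has_derivative (\<lambda>h. frechet_derivative f (at x) h + frechet_derivative g (at x) h)) (at x)"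
    using assms frechet_derivative_works by (auto intro!: derivative_intros)
  from has_derivative_partial[OF this] show "partial i (\<lambda>x. f x + g x) x = partial i f x + partial i g x"
    by (simp add: partial_def)
qed

lemma partial_mult:
  assumes "\<And>x. f differentiable at x" "\<And>x. g differentiable at x"
  shows "partial i (\<lambda>x. f x * g x) = (\<lambda>x. partial i f x * g x + f x * partial i g x)"
proof
  fix x
  have "((\<lambda>x. f x * g x) has_derivative (\<lambda>h. f x * frechet_derivative g (at x) h + frechet_derivative f (at x) h * g x)) (at x)"
    using assms frechet_derivative_works by (auto intro!: derivative_intros)
  from has_derivative_partial[OF this] show "partial i (\<lambda>x. f x * g x) x = partial i f x * g x + f x * partial i g x"
    by (simp add: partial_def)
qed

lemma partial_const [simp]: "partial i (\<lambda>x. c) = (\<lambda>x. 0)"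
  using has_derivative_partial[OF has_derivative_const] by fastforce

lemma partial_compose:
  assumes "\<And>x. f differentiable at x" "\<And>x. (h has_real_derivative h' (f x)) (at (f x))"
  shows "partial i (\<lambda>x. h (f x)) = (\<lambda>x. h' (f x) * partial i f x)"
    and "(\<lambda>x. h (f x)) differentiable at x"
proof -
  have *: "((\<lambda>x. h (f x)) has_derivative (\<lambda>v. h' (f x) * frechet_derivative f (at x) v)) (at x)" for x
  proof -
    have "(f has_derivative frechet_derivative f (at x)) (at x)"
      using assms(1) frechet_derivative_works by blast
    from has_derivative_compose[OF this assms(2)[unfolded has_field_derivative_def]]
    show ?thesis by simp
  qed
  show "partial i (\<lambda>x. h (f x)) = (\<lambda>x. h' (f x) * partial i f x)"
    using has_derivative_partial[OF *] by (simp add: partial_def fun_eq_iff)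
  show "(\<lambda>x. h (f x)) differentiable at x"
    using * by (auto simp: differentiable_def)
qed

lemma times_diff_const: "times_diff k (\<lambda>x. c)"
  by (induction k arbitrary: c) auto

lemma times_diff_add: "times_diff k f \<Longrightarrow> times_diff k g \<Longrightarrow> times_diff k (\<lambda>x. f x + g x)"
proof (induction k arbitrary: f g)
  case (Suc k)
  then show ?case by (simp add: partial_add)
qed simp

lemma times_diff_mult: "times_diff k f \<Longrightarrow> times_diff k g \<Longrightarrow> times_diff k (\<lambda>x. f x * g x)"
proof (induction k arbitrary: f g)
  case (Suc k)
  have "times_diff k (\<lambda>x. partial i f x * g x + f x * partial i g x)" for i
    using Suc.prems times_diff_Suc by (intro times_diff_add Suc.IH) auto
  then show ?case using Suc.prems by (simp add: partial_mult)
qed simp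

text \<open>The outer function comes as the sequence \<open>h\<close> of all its derivatives,
  because differentiating \<open>h j (f x)\<close> produces \<open>h (Suc j) (f x)\<close>. The set
  \<open>S\<close> allows outer functions that are differentiable only on the range of
  \<open>f\<close>, such as the square root on positive numbers.\<close>

lemma times_diff_compose:
  assumes "\<And>k t. t \<in> S \<Longrightarrow> (h k has_real_derivative h (Suc k) t) (at t)" "\<And>x. f x \<in> S"
  shows "times_diff k f \<Longrightarrow> times_diff k (\<lambda>x. h j (f x))"
proof (induction k arbitrary: j)
  case 0
  then show ?case using partial_compose(2)[of f "h j" "h (Suc j)"] assms by auto
next
  case (Suc k)
  have "times_diff k (\<lambda>x. h (Suc j) (f x) * partial i f x)" for i
    using Suc.prems times_diff_Suc by (intro times_diff_mult Suc.IH) auto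
  then show ?case using Suc.prems partial_compose[of f "h j" "h (Suc j)"] assms by auto
qed

lemma smooth_const [simp]: "smooth_on UNIV (\<lambda>x. c)"
  by (simp add: smooth_iff times_diff_const)

lemma smooth_add: "smooth_on UNIV f \<Longrightarrow> smooth_on UNIV g \<Longrightarrow> smooth_on UNIV (\<lambda>x. f x + g x)"
  by (simp add: smooth_iff times_diff_add)

lemma smooth_mult: "smooth_on UNIV f \<Longrightarrow> smooth_on UNIV g \<Longrightarrow> smooth_on UNIV (\<lambda>x. f x * g x)"
  by (simp add: smooth_iff times_diff_mult)

lemma smooth_diff: "smooth_on UNIV f \<Longrightarrow> smooth_on UNIV g \<Longrightarrow> smooth_on UNIV (\<lambda>x. f x - g x)"
  using smooth_add[OF _ smooth_mult[OF smooth_const[of "-1"]], of f g] by simp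

lemma smooth_sum: "(\<And>i. i \<in> I \<Longrightarrow> smooth_on UNIV (f i)) \<Longrightarrow> smooth_on UNIV (\<lambda>x. \<Sum>i\<in>I. f i x)"
  by (induction I rule: infinite_finite_induct) (auto intro: smooth_add)

lemma smooth_compose:
  assumes "\<And>k t. t \<in> S \<Longrightarrow> (h k has_real_derivative h (Suc k) t) (at t)" "\<And>x. f x \<in> S" "smooth_on UNIV f"
  shows "smooth_on UNIV (\<lambda>x. h j (f x))"
  using assms(3) times_diff_compose[of S h f, OF assms(1,2)] by (auto simp: smooth_iff)

lemma partial_coordinate: "partial i (\<lambda>x::real^'n::finite. x $ j) = (\<lambda>x. if i = j then 1 else 0)"
proof
  fix x :: "real^'n"
  have "((\<lambda>x. x $ j) has_derivative (\<lambda>h. h $ j)) (at x)"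
    by (rule bounded_linear_imp_has_derivative[OF bounded_linear_vec_nth])
  from has_derivative_partial[OF this] show "partial i (\<lambda>x. x $ j) x = (if i = j then 1 else 0)"
    by (simp add: axis_def)
qed

lemma smooth_coordinate: "smooth_on UNIV (\<lambda>x. x $ j)"
proof -
  have "times_diff k (\<lambda>x. x $ j)" for k
    by (cases k) (auto simp: partial_coordinate times_diff_const
        intro: bounded_linear_imp_differentiable[OF bounded_linear_vec_nth])
  then show ?thesis by (simp add: smooth_iff)
qed

lemma smooth_inner_self: "smooth_on UNIV (\<lambda>x. x \<bullet> x)"
  unfolding inner_vec_def inner_real_def by (intro smooth_sum smooth_mult smooth_coordinate)

lemma partial_inner_self: "partial i (\<lambda>x::real^'n::finite. x \<bullet> x) = (\<lambda>x. 2 * x $ i)"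
proof
  fix x :: "real^'n"
  have "((\<lambda>x. x \<bullet> x) has_derivative (\<lambda>h. x \<bullet> h + h \<bullet> x)) (at x)"
    by (auto intro!: derivative_eq_intros)
  from has_derivative_partial[OF this] show "partial i (\<lambda>x. x \<bullet> x) x = 2 * x $ i"
    by (simp add: inner_axis inner_commute)
qed

lemma smooth_continuous_on: "smooth_on UNIV f \<Longrightarrow> continuous_on X f"
  by (meson continuous_at_imp_continuous_on differentiable_imp_continuous_within smooth_differentiable)

lemma smooth_borel_measurable [measurable_dest]: "smooth_on UNIV f \<Longrightarrow> f \<in> borel_measurable borel"
  by (intro borel_measurable_continuous_onI smooth_continuous_on)

lemma partial_eq_on_open:
  assumes "open U" "x \<in> U" "\<And>y. y \<in> U \<Longrightarrow> f y = g y"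
  shows "partial i f x = partial i g x"
proof (cases "f differentiable at x")
  case True
  then show ?thesis
    unfolding partial_def using frechet_derivative_transform_within_open[of f x U g] assms by simp
next
  case False
  have "\<not> g differentiable at x"
  proof
    assume "g differentiable at x"
    then obtain D where "(g has_derivative D) (at x)" by (auto simp: differentiable_def)
    then have "(f has_derivative D) (at x)"
      by (rule has_derivative_transform_within_open[OF _ assms(1,2)]) (simp add: assms(3))
    with False show False by (auto simp: differentiable_def)
  qed
  \<comment> \<open>Derivatives are chosen by \<open>SOME\<close>; at a point where neither function
    is differentiable both choices are made from the same empty predicate and hence
    coincide.\<close>
  with False have "frechet_derivative f (at x) = frechet_derivative g (at x)"
    unfolding frechet_derivative_def differentiable_def by simp
  then show ?thesis by (simp add: partial_def)
qed

lemma partial_reflect: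
  assumes "smooth_on UNIV \<rho>"
  shows "partial i (\<lambda>y. \<rho> (x - y)) = (\<lambda>y. - partial i \<rho> (x - y))"
proof
  fix y
  let ?D = "frechet_derivative \<rho> (at (x - y))"
  have D: "(\<rho> has_derivative ?D) (at (x - y))"
    using smooth_differentiable[OF assms] frechet_derivative_works by blast
  interpret bounded_linear ?D using D by (rule has_derivative_bounded_linear)
  have "((\<lambda>y. x - y) has_derivative uminus) (at y)"
    by (auto intro!: derivative_eq_intros)
  from has_derivative_partial[OF has_derivative_compose[OF this D]]
  show "partial i (\<lambda>y. \<rho> (x - y)) y = - partial i \<rho> (x - y)"
    by (simp add: partial_def neg)
qed

lemma smooth_reflect:
  assumes "smooth_on UNIV \<rho>"
  shows "smooth_on UNIV (\<lambda>y. \<rho> (x - y))"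
proof -
  \<comment> \<open>The constant \<open>c\<close> absorbs the minus sign that each differentiation
    produces.\<close>
  have "times_diff k (\<lambda>y. c * \<rho> (x - y))" if "smooth_on UNIV \<rho>" for k c \<rho>
    using that
  proof (induction k arbitrary: c \<rho>)
    case 0
    have "(\<lambda>y. \<rho> (x - y)) differentiable at y" for y
      using smooth_differentiable[OF 0]
      by (intro differentiable_compose[of \<rho> "\<lambda>y. x - y"]) auto
    then show ?case by (simp add: differentiable_mult)
  next
    case (Suc k)
    have d: "(\<lambda>y. \<rho> (x - y)) differentiable at y" for y
      using smooth_differentiable[OF Suc.prems]
      by (intro differentiable_compose[of \<rho> "\<lambda>y. x - y"]) auto
    have "partial i (\<lambda>y. c * \<rho> (x - y)) = (\<lambda>y. (-c) * partial i \<rho> (x - y))" for i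
      using d by (simp add: partial_mult partial_reflect[OF Suc.prems])
    moreover have "times_diff k (\<lambda>y. (-c) * partial i \<rho> (x - y))" for i
      by (rule Suc.IH[OF smooth_partial[OF Suc.prems]])
    ultimately show ?case using d by (simp add: differentiable_mult)
  qed
  from this[OF assms, of _ 1] show ?thesis by (simp add: smooth_iff)
qed

section \<open>Test functions\<close>

lemma fun_support_subset: "closed C \<Longrightarrow> (\<And>x. f x \<noteq> 0 \<Longrightarrow> x \<in> C) \<Longrightarrow> fun_support f \<subseteq> C"
  unfolding fun_support_def by (rule closure_minimal) auto

lemma not_in_fun_support: "x \<notin> fun_support f \<Longrightarrow> f x = 0"
  unfolding fun_support_def using closure_subset[of "{x. f x \<noteq> 0}"] by auto

lemma in_fun_support: "f x \<noteq> 0 \<Longrightarrow> x \<in> fun_support f"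
  using not_in_fun_support by blast

lemma closed_fun_support [simp]: "closed (fun_support f)"
  by (simp add: fun_support_def)

lemma test_funI:
  assumes "smooth_on UNIV f" "compact C" "C \<subseteq> U" "\<And>x. f x \<noteq> 0 \<Longrightarrow> x \<in> C"
  shows "test_fun U f"
proof -
  have "fun_support f \<subseteq> C" using assms by (intro fun_support_subset compact_imp_closed)
  moreover from this have "compact (fun_support f)"
    using assms(2) closed_fun_support compact_Int_closed inf.absorb_iff2 by metis
  ultimately show ?thesis using assms by (auto simp: test_fun_def)
qed

lemma test_fun_smooth: "test_fun U f \<Longrightarrow> smooth_on UNIV f"
  by (simp add: test_fun_def)

lemma test_fun_mono: "test_fun U f \<Longrightarrow> U \<subseteq> V \<Longrightarrow> test_fun V f"
  by (auto simp: test_fun_def)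

lemma test_fun_zero [simp]: "test_fun U (\<lambda>x. 0)"
  by (rule test_funI[where C = "{}"]) auto

lemma test_fun_add:
  assumes "test_fun U f" "test_fun U g"
  shows "test_fun U (\<lambda>x. f x + g x)"
proof (rule test_funI)
  show "x \<in> fun_support f \<union> fun_support g" if "f x + g x \<noteq> 0" for x
    using that by (metis UnI1 UnI2 add_0 in_fun_support)
qed (use assms in \<open>auto simp: test_fun_def intro: smooth_add compact_Un\<close>)

lemma test_fun_mult_left:
  assumes "test_fun U f" "smooth_on UNIV g"
  shows "test_fun U (\<lambda>x. g x * f x)"
  using assms
  by (intro test_funI[where C = "fun_support f"])
     (auto simp: test_fun_def intro: smooth_mult in_fun_support)

lemma test_fun_mult_right: "test_fun U f \<Longrightarrow> smooth_on UNIV g \<Longrightarrow> test_fun U (\<lambda>x. f x * g x)"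
  using test_fun_mult_left[of U f g] by (simp add: mult.commute)

lemma test_fun_cmult: "test_fun U f \<Longrightarrow> test_fun U (\<lambda>x. c * f x)"
  by (intro test_fun_mult_left) auto

lemma test_fun_diff: "test_fun U f \<Longrightarrow> test_fun U g \<Longrightarrow> test_fun U (\<lambda>x. f x - g x)"
  using test_fun_add[OF _ test_fun_cmult[of U g "-1"], of f] by simp

lemma test_fun_sum: "(\<And>i. i \<in> I \<Longrightarrow> test_fun U (f i)) \<Longrightarrow> test_fun U (\<lambda>x. \<Sum>i\<in>I. f i x)"
  by (induction I rule: infinite_finite_induct) (auto intro: test_fun_add)

lemma fun_support_partial: "fun_support (partial i f) \<subseteq> fun_support f"
proof (rule fun_support_subset)
  show "x \<in> fun_support f" if "partial i f x \<noteq> 0" for x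
  proof (rule ccontr)
    assume "x \<notin> fun_support f"
    then have "partial i f x = partial i (\<lambda>x. 0) x"
      by (intro partial_eq_on_open[of "- fun_support f"]) (auto dest: not_in_fun_support)
    with that show False by simp
  qed
qed simp

lemma test_fun_partial:
  assumes "test_fun U f"
  shows "test_fun U (partial i f)"
  using assms fun_support_partial[of i f]
  by (intro test_funI[of _ "fun_support f"]) (auto simp: test_fun_def smooth_partial dest: in_fun_support)

lemma test_fun_bounded:
  assumes "test_fun U f"
  obtains B where "\<And>x. \<bar>f x\<bar> \<le> B"
proof -
  have "compact (f ` fun_support f)"
    using assms by (intro compact_continuous_image smooth_continuous_on) (auto simp: test_fun_def)
  then obtain B where B: "\<And>x. x \<in> fun_support f \<Longrightarrow> \<bar>f x\<bar> \<le> B"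
    using compact_imp_bounded bounded_real by (metis imageI)
  have "\<bar>f x\<bar> \<le> max B 0" for x
    using B[of x] not_in_fun_support[of x f] by fastforce
  then show ?thesis by (rule that)
qed

lemma test_fun_uniformly_continuous:
  fixes f :: "real^'n::finite \<Rightarrow> real"
  assumes "test_fun U f" "e > 0"
  obtains d where "d > 0" "\<And>x y. dist x y < d \<Longrightarrow> \<bar>f x - f y\<bar> < e"
proof -
  have "bounded (fun_support f)" using assms by (auto simp: test_fun_def compact_imp_bounded)
  then obtain R where R: "fun_support f \<subseteq> cball 0 R" unfolding bounded_iff by (metis mem_cball_0 subsetI)
  \<comment> \<open>The margin 1 around the support handles the rest: if two points at distance
    below 1 are not both in the larger ball, then \<open>f\<close> vanishes at both.\<close>
  have "uniformly_continuous_on (cball 0 (R + 1)) f"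
    using assms by (intro compact_uniformly_continuous smooth_continuous_on) (auto simp: test_fun_def)
  then obtain d where d: "d > 0" "\<And>x y. x \<in> cball 0 (R + 1) \<Longrightarrow> y \<in> cball 0 (R + 1) \<Longrightarrow> dist x y < d \<Longrightarrow> dist (f x) (f y) < e"
    unfolding uniformly_continuous_on_def using assms(2) by metis
  show ?thesis
  proof (rule that)
    show "min d 1 > 0" using d by simp
    fix x y :: "real^'n" assume xy: "dist x y < min d 1"
    show "\<bar>f x - f y\<bar> < e"
    proof (cases "x \<in> cball 0 (R + 1) \<and> y \<in> cball 0 (R + 1)")
      case True
      then show ?thesis using d(2)[of x y] xy by (simp add: dist_real_def)
    next
      case False
      moreover have "norm x \<le> norm y + dist x y" "norm y \<le> norm x + dist x y"
        using norm_triangle_sub[of x y] norm_triangle_sub[of y x] by (simp_all add: dist_norm norm_minus_commute)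
      ultimately have "x \<notin> cball 0 R \<and> y \<notin> cball 0 R"
        using xy by auto
      then show ?thesis using R not_in_fun_support assms(2) by (metis abs_zero diff_self subsetD)
    qed
  qed
qed

lemma smooth_sqrt:
  assumes "smooth_on UNIV f" "\<And>x. f x > 0"
  shows "smooth_on UNIV (\<lambda>x. sqrt (f x))"
proof -
  define c :: "nat \<Rightarrow> real" where "c k = (\<Prod>i<k. (1/2 - real i))" for k
  \<comment> \<open>The successive derivatives of the square root; \<open>c k\<close> collects the
    factors \<open>1/2 - i\<close> from the power rule.\<close>
  define h :: "nat \<Rightarrow> real \<Rightarrow> real" where "h k t = c k * t powr (1/2 - real k)" for k t
  have "smooth_on UNIV (\<lambda>x. h 0 (f x))"
  proof (rule smooth_compose[where h = h and j = 0 and S = "{0<..}"])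
    show "(h k has_real_derivative h (Suc k) t) (at t)" if "t \<in> {0<..}" for k t
      unfolding h_def using that
      by (auto intro!: derivative_eq_intros simp: c_def algebra_simps)
  qed (use assms in auto)
  moreover have "h 0 (f x) = sqrt (f x)" for x
    using assms(2)[of x] by (simp add: h_def c_def powr_half_sqrt)
  ultimately show ?thesis by simp
qed


section \<open>Mollifiers and cutoff functions\<close>

lemma tendsto_poly_exp: "((\<lambda>s. s ^ k * poly p s * exp (- s)) \<longlongrightarrow> (0::real)) at_top"
proof (induction p arbitrary: k)
  case (pCons a p)
  have "((\<lambda>s. a * (s ^ k / exp s) + s ^ Suc k * poly p s * exp (- s)) \<longlongrightarrow> a * 0 + 0) at_top"
    by (intro tendsto_intros tendsto_power_div_exp_0 pCons.IH)
  then show ?case by (simp add: exp_minus field_simps)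
qed simp

text \<open>Allowing a polynomial factor makes this family of functions closed under differentiation.\<close>

definition bump :: "real poly \<Rightarrow> real \<Rightarrow> real" where
  "bump p t = (if t > 0 then poly p (1 / t) * exp (- 1 / t) else 0)"

text \<open>In the variable \<open>s = 1 / t\<close> the derivative of \<open>p(s) exp(-s)\<close>
  with respect to \<open>t\<close> is \<open>s\<^sup>2 (p(s) - p'(s)) exp(-s)\<close>, which gives
  the new polynomial. At \<open>t = 0\<close> the exponential beats every polynomial.\<close>

lemma bump_has_derivative:
  "(bump p has_real_derivative bump ([:0, 0, 1:] * (p - pderiv p)) t) (at t)"
proof (cases t "0::real" rule: linorder_cases)
  case less
  have "((\<lambda>t. 0) has_real_derivative 0) (at t)" by simp
  then have "(bump p has_real_derivative 0) (at t)"
    by (rule has_field_derivative_transform_within_open[of _ _ _ "{..<0}"]) (use less in \<open>auto simp: bump_def\<close>)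
  then show ?thesis using less by (simp add: bump_def)
next
  case greater
  have "((\<lambda>t. poly p (1 / t) * exp (- 1 / t)) has_real_derivative
      bump ([:0, 0, 1:] * (p - pderiv p)) t) (at t)"
    using greater
    by (auto intro!: derivative_eq_intros DERIV_chain2[OF poly_DERIV] simp: bump_def field_simps power2_eq_square)
  then show ?thesis
    by (rule has_field_derivative_transform_within_open[of _ _ _ "{0<..}"]) (use greater in \<open>auto simp: bump_def\<close>)
next
  case equal
  have "((\<lambda>y. bump p y / y) \<longlongrightarrow> 0) (at_right 0)"
  proof -
    \<comment> \<open>This is the difference quotient at 0 from the right, written in
      \<open>s = 1 / y\<close>.\<close>
    have "((\<lambda>s. s ^ 1 * poly p s * exp (- s)) \<longlongrightarrow> 0) at_top" by (rule tendsto_poly_exp)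
    then have "((\<lambda>y. inverse y ^ 1 * poly p (inverse y) * exp (- inverse y)) \<longlongrightarrow> 0) (at_right (0::real))"
      by (rule filterlim_compose[OF _ filterlim_inverse_at_top_right])
    moreover have "\<forall>\<^sub>F y in at_right 0. inverse y ^ 1 * poly p (inverse y) * exp (- inverse y) = bump p y / y"
      unfolding eventually_at_right_field by (intro exI[of _ 1]) (auto simp: bump_def field_simps)
    ultimately show ?thesis by (rule Lim_transform_eventually)
  qed
  moreover have "((\<lambda>y. bump p y / y) \<longlongrightarrow> 0) (at_left 0)"
    by (rule Lim_transform_eventually[OF tendsto_const])
       (auto simp: eventually_at_left_field bump_def intro!: exI[of _ "-1"])
  ultimately have "((\<lambda>y. bump p y / y) \<longlongrightarrow> 0) (at 0)"
    by (simp add: filterlim_at_split)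
  then show ?thesis using equal by (simp add: has_field_derivative_iff bump_def)
qed

lemma smooth_bump:
  assumes "smooth_on UNIV f"
  shows "smooth_on UNIV (\<lambda>x. bump 1 (f x))"
proof -
  define q :: "nat \<Rightarrow> real poly" where "q k = ((\<lambda>p. [:0, 0, 1:] * (p - pderiv p)) ^^ k) 1" for k
  have "smooth_on UNIV (\<lambda>x. bump (q 0) (f x))"
    by (rule smooth_compose[where h = "\<lambda>k. bump (q k)" and S = UNIV])
       (use bump_has_derivative assms in \<open>auto simp: q_def\<close>)
  then show ?thesis by (simp add: q_def)
qed

lemma lborel_reflect: "distr lborel borel (\<lambda>y. x - y) = (lborel :: 'a::euclidean_space measure)"
  using lborel_affine[of "-1" x] by (simp add: density_1)

lemma integral_reflect:
  fixes f :: "'a::euclidean_space \<Rightarrow> real"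
  assumes [measurable]: "f \<in> borel_measurable borel"
  shows "(LINT y|lborel. f (x - y)) = (LINT y|lborel. f y)"
    and "integrable lborel (\<lambda>y. f (x - y)) \<longleftrightarrow> integrable lborel f"
proof -
  show "(LINT y|lborel. f (x - y)) = (LINT y|lborel. f y)"
    by (subst (2) lborel_reflect[of x, symmetric]) (simp add: integral_distr)
  show "integrable lborel (\<lambda>y. f (x - y)) \<longleftrightarrow> integrable lborel f"
    by (subst (2) lborel_reflect[of x, symmetric]) (simp add: integrable_distr_eq)
qed

lemma test_fun_integrable:
  assumes "test_fun U f"
  shows "integrable lborel f"
proof -
  have "integrable lborel (\<lambda>x. indicator (fun_support f) x *\<^sub>R f x)"
    using assms by (intro borel_integrable_compact smooth_continuous_on) (auto simp: test_fun_def)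
  moreover have "(\<lambda>x. indicator (fun_support f) x *\<^sub>R f x) = f"
    using not_in_fun_support[of _ f] by (auto simp: indicator_def fun_eq_iff)
  ultimately show ?thesis by simp
qed

definition mollifier :: "real \<Rightarrow> (real^'n::finite \<Rightarrow> real) \<Rightarrow> bool" where
  "mollifier e \<rho> \<longleftrightarrow> test_fun UNIV \<rho> \<and> (\<forall>x. \<rho> x \<ge> 0) \<and> (\<forall>x. norm x \<ge> e \<longrightarrow> \<rho> x = 0) \<and> (LINT x|lborel. \<rho> x) = 1"

lemma mollifier_exists:
  assumes "e > 0"
  obtains \<rho> :: "real^'n::finite \<Rightarrow> real" where "mollifier e \<rho>"
proof -
  define g :: "real^'n \<Rightarrow> real" where "g x = bump 1 (e\<^sup>2 - x \<bullet> x)" for x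
  have pos: "g x > 0 \<longleftrightarrow> norm x < e" and nn: "g x \<ge> 0" for x
    using assms by (auto simp: g_def bump_def power2_norm_eq_inner[symmetric] abs_less_iff
        intro: power_strict_mono dest: power_less_imp_less_base)
  have zero: "g x = 0" if "norm x \<ge> e" for x
    using pos[of x] nn[of x] that by auto
  have "smooth_on UNIV g"
    unfolding g_def by (intro smooth_bump smooth_diff smooth_const smooth_inner_self)
  then have test: "test_fun UNIV g"
    by (rule test_funI[of _ "cball 0 e"]) (use pos nn in \<open>force simp: less_eq_real_def\<close>)+
  define c where "c = (LINT x|lborel. g x)"
  have "c \<noteq> 0"
  proof
    assume "c = 0"
    then have "AE x in lborel. g x = 0"
      using integral_nonneg_eq_0_iff_AE[OF test_fun_integrable[OF test]] nn by (simp add: c_def)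
    then have "AE x::real^'n in lborel. x \<notin> ball 0 e"
      by (rule eventually_mono) (metis pos less_irrefl mem_ball_0)
    then have "emeasure lborel (ball (0::real^'n) e) = 0"
      by (subst (asm) AE_iff_measurable[OF _ refl]) (auto simp: ball_def)
    then show False
      using content_ball_pos[of e "0::real^'n"] assms by (simp add: measure_def)
  qed
  moreover have "c \<ge> 0" unfolding c_def using nn by simp
  ultimately have "c > 0" by simp
  have "mollifier e (\<lambda>x. 1 / c * g x)"
    using \<open>c > 0\<close> test_fun_cmult[OF test, of "1 / c"] nn zero by (auto simp: mollifier_def simp flip: c_def)
  then show ?thesis by (rule that)
qed

section \<open>Convolution with a test function\<close>

definition conv :: "(real^'n::finite \<Rightarrow> real) \<Rightarrow> (real^'n \<Rightarrow> real) \<Rightarrow> real^'n \<Rightarrow> real" where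
  "conv f \<rho> x = (LINT y|lborel. f y * \<rho> (x - y))"

lemma conv_integrable:
  assumes "integrable lborel f" "test_fun UNIV \<rho>"
  shows "integrable lborel (\<lambda>y. f y * \<rho> (x - y))"
proof -
  obtain B where B: "\<And>x. \<bar>\<rho> x\<bar> \<le> B" using test_fun_bounded assms(2) by blast
  have [measurable]: "\<rho> \<in> borel_measurable borel"
    using assms by (intro smooth_borel_measurable test_fun_smooth)
  show ?thesis
  proof (rule Bochner_Integration.integrable_bound)
    show "integrable lborel (\<lambda>y. B * f y)" using assms by simp
    have "0 \<le> B" using B[of 0] by linarith
    then show "AE y in lborel. norm (f y * \<rho> (x - y)) \<le> norm (B * f y)"
      using B by (auto simp: abs_mult mult.commute[of "\<bar>f _\<bar>"] intro!: mult_right_mono)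
  qed (use assms in measurable)
qed

text \<open>Uniform continuity of the first derivatives of \<open>\<rho>\<close> makes its Taylor
  remainder at most \<open>e * norm h\<close> uniformly in the base point. This bound is integrated
  against \<open>\<bar>f\<bar>\<close>, which suits an arbitrary integrable
  \<open>f\<close>.\<close>

lemma conv_has_derivative:
  fixes f :: "real^'n::finite \<Rightarrow> real"
  assumes f: "integrable lborel f" and \<rho>: "test_fun UNIV \<rho>"
  shows "(conv f \<rho> has_derivative (\<lambda>h. \<Sum>i\<in>UNIV. h $ i * conv f (partial i \<rho>) x)) (at x)"
proof -
  let ?N = "LINT y|lborel. \<bar>f y\<bar>"
  have unif: "\<exists>d>0. \<forall>z h. norm h < d \<longrightarrow> \<bar>\<rho> (z + h) - \<rho> z - (\<Sum>i\<in>UNIV. h $ i * partial i \<rho> z)\<bar> \<le> e * norm h"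
    if "e > 0" for e
  proof -
    define e' where "e' = e / real CARD('n)"
    have "e' > 0" using that by (simp add: e'_def)
    then have "\<exists>d>0. \<forall>x y. dist x y < d \<longrightarrow> \<bar>partial i \<rho> x - partial i \<rho> y\<bar> < e'" for i
      by (metis test_fun_uniformly_continuous test_fun_partial \<rho>)
    then obtain d where d: "\<And>i. d i > 0" "\<And>i x y. dist x y < d i \<Longrightarrow> \<bar>partial i \<rho> x - partial i \<rho> y\<bar> < e'"
      by metis
    have "\<bar>\<rho> (z + h) - \<rho> z - (\<Sum>i\<in>UNIV. h $ i * partial i \<rho> z)\<bar> \<le> e * norm h"
      if "norm h < Min (range d)" for z h
    proof -
      have D: "(\<rho> has_derivative (\<lambda>h. \<Sum>i\<in>UNIV. h $ i * partial i \<rho> y)) (at y within ball z (Min (range d)))" for y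
        using differentiable_has_derivative_partial[OF smooth_differentiable[OF test_fun_smooth[OF \<rho>]]]
        by (rule has_derivative_at_withinI)
      have "norm (\<rho> (z + h) - \<rho> z - (\<Sum>i\<in>UNIV. (z + h - z) $ i * partial i \<rho> z)) \<le> norm (z + h - z) * e"
      proof (rule differentiable_bound_linearization[OF _ D])
        show "z + t *\<^sub>R (z + h - z) \<in> ball z (Min (range d))" if "t \<in> {0..1}" for t
        proof -
          have "\<bar>t\<bar> * norm h \<le> 1 * norm h" using that by (intro mult_right_mono) auto
          then have "\<bar>t\<bar> * norm h < Min (range d)" using \<open>norm h < _\<close> by linarith
          then show ?thesis by (simp add: dist_norm del: Min_gr_iff)
        qed
        show "z \<in> ball z (Min (range d))" using d(1) by (auto simp: Min_gr_iff)
        fix y assume y: "y \<in> ball z (Min (range d))"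
        show "onorm ((\<lambda>h. \<Sum>i\<in>UNIV. h $ i * partial i \<rho> y) - (\<lambda>h. \<Sum>i\<in>UNIV. h $ i * partial i \<rho> z)) \<le> e"
        proof (rule onorm_le)
          fix h :: "real^'n"
          have "\<bar>(\<Sum>i\<in>UNIV. h $ i * (partial i \<rho> y - partial i \<rho> z))\<bar> \<le> (\<Sum>i\<in>(UNIV::'n set). norm h * e')"
          proof (intro order_trans[OF sum_abs] sum_mono)
            fix i
            have "dist y z < d i"
              using y by (simp add: Min_gr_iff dist_commute)
            then show "\<bar>h $ i * (partial i \<rho> y - partial i \<rho> z)\<bar> \<le> norm h * e'"
              using d(2)[of y z i] component_le_norm_cart[of h i] by (auto simp: abs_mult intro!: mult_mono)
          qed
          also have "\<dots> = e * norm h" by (simp add: e'_def)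
          finally show "norm (((\<lambda>h. \<Sum>i\<in>UNIV. h $ i * partial i \<rho> y) - (\<lambda>h. \<Sum>i\<in>UNIV. h $ i * partial i \<rho> z)) h) \<le> e * norm h"
            by (simp add: sum_subtractf right_diff_distrib)
        qed
      qed
      then show ?thesis by (simp add: mult.commute)
    qed
    moreover have "Min (range d) > 0" using d(1) by (auto simp: Min_gr_iff)
    ultimately show ?thesis by blast
  qed
  have int: "integrable lborel (\<lambda>y. f y * \<rho> (x - y))" for x by (rule conv_integrable[OF f \<rho>])
  have int': "integrable lborel (\<lambda>y. f y * partial i \<rho> (x - y))" for i x
    by (rule conv_integrable[OF f test_fun_partial[OF \<rho>]])
  show ?thesis
    unfolding has_derivative_at_alt
  proof (intro conjI allI impI)
    show "bounded_linear (\<lambda>h. \<Sum>i\<in>UNIV. h $ i * conv f (partial i \<rho>) x)"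
      by (intro bounded_linear_sum bounded_linear_mult_left[THEN bounded_linear_compose] bounded_linear_vec_nth)
    fix e :: real assume "e > 0"
    \<comment> \<open>Adding 1 avoids a division by zero when \<open>f\<close> vanishes almost
      everywhere.\<close>
    define e' where "e' = e / (?N + 1)"
    have N: "?N \<ge> 0" by simp
    have "e' > 0" "e' * ?N \<le> e"
      using \<open>e > 0\<close> add_nonneg_pos[OF N zero_less_one] by (auto simp: e'_def field_simps)
    obtain d where d: "d > 0" "\<And>z h. norm h < d \<Longrightarrow> \<bar>\<rho> (z + h) - \<rho> z - (\<Sum>i\<in>UNIV. h $ i * partial i \<rho> z)\<bar> \<le> e' * norm h"
      using unif[OF \<open>e' > 0\<close>] by blast
    have "norm (conv f \<rho> y - conv f \<rho> x - (\<Sum>i\<in>UNIV. (y - x) $ i * conv f (partial i \<rho>) x)) \<le> e * norm (y - x)"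
      if "norm (y - x) < d" for y
    proof -
      let ?R = "\<lambda>w. f w * (\<rho> (x - w + (y - x)) - \<rho> (x - w) - (\<Sum>i\<in>UNIV. (y - x) $ i * partial i \<rho> (x - w)))"
      have eq: "?R = (\<lambda>w. f w * \<rho> (y - w) - f w * \<rho> (x - w) - (\<Sum>i\<in>UNIV. (y - x) $ i * (f w * partial i \<rho> (x - w))))"
        by (auto simp: fun_eq_iff algebra_simps sum_distrib_left)
      have intR: "integrable lborel ?R"
        unfolding eq by (intro Bochner_Integration.integrable_diff Bochner_Integration.integrable_sum int integrable_mult_right int')
      have "conv f \<rho> y - conv f \<rho> x - (\<Sum>i\<in>UNIV. (y - x) $ i * conv f (partial i \<rho>) x) = (LINT w|lborel. ?R w)"
        unfolding eq conv_def using int int'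
        by (simp add: Bochner_Integration.integral_diff Bochner_Integration.integral_sum)
      also have "norm \<dots> \<le> (LINT w|lborel. \<bar>f w\<bar> * (e' * norm (y - x)))"
      proof (rule order_trans[OF integral_norm_bound])
        show "(LINT w|lborel. norm (?R w)) \<le> (LINT w|lborel. \<bar>f w\<bar> * (e' * norm (y - x)))"
        proof (rule integral_mono)
          show "norm (?R w) \<le> \<bar>f w\<bar> * (e' * norm (y - x))" for w
            unfolding real_norm_def abs_mult by (intro mult_left_mono d(2) that) simp
        qed (use intR f in auto)
      qed
      also have "\<dots> = e' * ?N * norm (y - x)" by simp
      also have "\<dots> \<le> e * norm (y - x)"
        using \<open>e' * ?N \<le> e\<close> by (intro mult_right_mono) auto
      finally show ?thesis .
    qed
    with d(1) show "\<exists>d>0. \<forall>y. norm (y - x) < d \<longrightarrow>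
        norm (conv f \<rho> y - conv f \<rho> x - (\<Sum>i\<in>UNIV. (y - x) $ i * conv f (partial i \<rho>) x)) \<le> e * norm (y - x)"
      by blast
  qed
qed

lemma partial_conv:
  fixes f :: "real^'n::finite \<Rightarrow> real"
  assumes "integrable lborel f" "test_fun UNIV \<rho>"
  shows "partial i (conv f \<rho>) = conv f (partial i \<rho>)"
proof
  fix x
  show "partial i (conv f \<rho>) x = conv f (partial i \<rho>) x"
    using has_derivative_partial[OF conv_has_derivative[OF assms], of i x]
    by (simp add: axis_def if_distrib[of "\<lambda>x. x * _"] cong: if_cong)
qed

lemma smooth_conv:
  fixes f :: "real^'n::finite \<Rightarrow> real"
  assumes "integrable lborel f" "test_fun UNIV \<rho>"
  shows "smooth_on UNIV (conv f \<rho>)"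
proof -
  have "times_diff k (conv f \<rho>)" for k
    using assms(2)
  proof (induction k arbitrary: \<rho>)
    case 0
    then show ?case using conv_has_derivative[OF assms(1) 0] by (auto simp: differentiable_def)
  next
    case (Suc k)
    then show ?case using conv_has_derivative[OF assms(1) Suc.prems] Suc.IH[OF test_fun_partial[OF Suc.prems]]
      by (auto simp: differentiable_def partial_conv[OF assms(1) Suc.prems])
  qed
  then show ?thesis by (simp add: smooth_iff)
qed

text \<open>The almost-everywhere form is needed for \<open>u\<close>: where
  \<open>u = -\<infinity>\<close> its real-valued version is 0, which may exceed a negative upper
  bound \<open>c\<close>.\<close>

lemma conv_le_AE:
  assumes "integrable lborel f" "mollifier e \<rho>" "AE y in lborel. dist x y < e \<longrightarrow> f y \<le> c"
  shows "conv f \<rho> x \<le> c"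
proof -
  have \<rho>: "test_fun UNIV \<rho>" and nn: "\<And>x. \<rho> x \<ge> 0" and z: "\<And>x. norm x \<ge> e \<Longrightarrow> \<rho> x = 0"
    and 1: "(LINT x|lborel. \<rho> x) = 1"
    using assms(2) by (auto simp: mollifier_def)
  have m: "\<rho> \<in> borel_measurable borel" using \<rho> by (intro smooth_borel_measurable test_fun_smooth)
  have "conv f \<rho> x \<le> (LINT y|lborel. c * \<rho> (x - y))"
    unfolding conv_def
  proof (rule integral_mono_AE)
    show "AE y in lborel. f y * \<rho> (x - y) \<le> c * \<rho> (x - y)"
      using assms(3)
    proof eventually_elim
      case (elim y)
      then show ?case
        using nn[of "x - y"] z[of "x - y"]
        by (cases "dist x y < e") (auto simp: dist_norm intro: mult_right_mono)
    qed
    show "integrable lborel (\<lambda>y. c * \<rho> (x - y))"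
      using test_fun_integrable[OF \<rho>] integral_reflect(2)[OF m] by simp
  qed (rule conv_integrable[OF assms(1) \<rho>])
  also have "\<dots> = c" using integral_reflect(1)[OF m] 1 by simp
  finally show ?thesis .
qed

lemma conv_le:
  assumes "integrable lborel f" "mollifier e \<rho>" "\<And>y. dist x y < e \<Longrightarrow> f y \<le> c"
  shows "conv f \<rho> x \<le> c"
  using assms by (intro conv_le_AE) auto

lemma conv_ge:
  assumes "integrable lborel f" "mollifier e \<rho>" "\<And>y. dist x y < e \<Longrightarrow> f y \<ge> c"
  shows "conv f \<rho> x \<ge> c"
proof -
  have "conv (\<lambda>y. - f y) \<rho> x \<le> - c" using assms by (intro conv_le) auto
  then show ?thesis by (simp add: conv_def)
qed

lemma compact_UN_cball:
  fixes K :: "'a::euclidean_space set"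
  assumes "compact K"
  shows "compact (\<Union>x\<in>K. cball x r)"
proof -
  have "(\<Union>x\<in>K. cball x r) = (\<Union>x\<in>K. \<Union>y\<in>cball 0 r. {x + y})"
  proof (intro set_eqI iffI)
    fix z assume "z \<in> (\<Union>x\<in>K. cball x r)"
    then obtain x where "x \<in> K" "dist x z \<le> r" by auto
    then show "z \<in> (\<Union>x\<in>K. \<Union>y\<in>cball 0 r. {x + y})"
      by (intro UN_I[of x] UN_I[of "z - x"]) (auto simp: dist_norm norm_minus_commute)
  qed (force simp: dist_norm)
  then show ?thesis using compact_sums'[OF assms compact_cball[of 0 r]] by simp
qed

section \<open>Cutoff functions and partitions of unity\<close>

lemma cutoff_exists:
  fixes K :: "(real^'n::finite) set"
  assumes K: "compact K" and U: "open U" "K \<subseteq> U"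
  obtains \<eta> W where "test_fun U \<eta>" "\<And>x. 0 \<le> \<eta> x" "\<And>x. \<eta> x \<le> 1" "open W" "K \<subseteq> W" "\<And>x. x \<in> W \<Longrightarrow> \<eta> x = 1"
proof -
  obtain e where e: "e > 0" "(\<Union>x\<in>K. cball x e) \<subseteq> U"
    using compact_subset_open_imp_cball_epsilon_subset[OF K U] .
  \<comment> \<open>The indicator of the \<open>2 d\<close>-neighbourhood is mollified with radius
    \<open>d\<close>: the result is 1 within distance \<open>d\<close> of \<open>K\<close> and
    vanishes beyond \<open>3 d = e\<close>.\<close>
  define d where "d = e / 3"
  have "d > 0" using e by (simp add: d_def)
  note comp = compact_UN_cball[OF K]
  obtain \<rho> :: "real^'n \<Rightarrow> real" where \<rho>: "mollifier d \<rho>" using mollifier_exists \<open>d > 0\<close> by blast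
  let ?C = "\<Union>x\<in>K. cball x (2 * d)"
  let ?f = "indicat_real ?C"
  have f: "integrable lborel ?f"
    using borel_compact[OF comp] emeasure_compact_finite[OF comp]
    by (intro integrable_real_indicator) auto
  have smooth: "smooth_on UNIV (conv ?f \<rho>)"
    using f \<rho> by (intro smooth_conv) (auto simp: mollifier_def)
  have "test_fun U (conv ?f \<rho>)"
  proof (rule test_funI[OF smooth comp[of e] e(2)])
    fix x assume "conv ?f \<rho> x \<noteq> 0"
    then have "conv ?f \<rho> x > 0 \<or> conv ?f \<rho> x < 0" by auto
    then obtain y where y: "dist x y < d" "y \<in> ?C"
      using conv_le[OF f \<rho>, of x 0] conv_ge[OF f \<rho>, of x 0]
      by (metis indicator_simps(2) indicator_pos_le not_less order_refl)
    then obtain k where "k \<in> K" "dist k y \<le> 2 * d" by auto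
    then have "dist k x \<le> e"
      using y(1) dist_triangle[of k x y] by (simp add: d_def dist_commute)
    then show "x \<in> (\<Union>x\<in>K. cball x e)" using \<open>k \<in> K\<close> by auto
  qed
  moreover have "0 \<le> conv ?f \<rho> x" "conv ?f \<rho> x \<le> 1" for x
    using conv_le[OF f \<rho>, of x 1] conv_ge[OF f \<rho>, of x 0] by (auto simp: indicator_def)
  moreover have "conv ?f \<rho> x = 1" if x: "x \<in> (\<Union>x\<in>K. ball x d)" for x
  proof -
    have "y \<in> ?C" if "dist x y < d" for y
    proof -
      obtain k where "k \<in> K" "dist k x < d" using x by auto
      then show ?thesis using that dist_triangle[of k y x] by (intro UN_I[of k]) auto
    qed
    then show ?thesis
      using conv_le[OF f \<rho>, of x 1] conv_ge[OF f \<rho>, of x 1] by (auto simp: indicator_def intro: antisym)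
  qed
  moreover have "K \<subseteq> (\<Union>x\<in>K. ball x d)" using \<open>d > 0\<close> by auto
  ultimately show ?thesis by (intro that[of "conv ?f \<rho>" "\<Union>x\<in>K. ball x d"]) auto
qed

text \<open>Take for \<open>g\<close> a cutoff function in \<open>U\<close> that is 1 near the
  compact part of the support lying outside \<open>V\<close>; then \<open>1 - g\<close> kills
  \<open>\<phi>\<close> there, and the other piece has compact support in \<open>V\<close>.\<close>

lemma test_fun_split:
  fixes \<phi> :: "real^'n::finite \<Rightarrow> real"
  assumes "test_fun (U \<union> V) \<phi>" "open U" "open V"
  obtains g where "\<And>x. 0 \<le> g x" "\<And>x. g x \<le> 1" "test_fun U (\<lambda>x. g x * \<phi> x)" "test_fun V (\<lambda>x. (1 - g x) * \<phi> x)"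
proof -
  let ?K = "fun_support \<phi>"
  have K: "compact ?K" "?K \<subseteq> U \<union> V" using assms by (auto simp: test_fun_def)
  have "compact (?K - V)" using K assms by (intro compact_diff) auto
  then obtain g W where g: "test_fun U g" "\<And>x. 0 \<le> g x" "\<And>x. g x \<le> 1" "open W" "?K - V \<subseteq> W" "\<And>x. x \<in> W \<Longrightarrow> g x = 1"
    using cutoff_exists[of "?K - V" U] K assms by (metis Diff_subset_conv Un_commute)
  have "test_fun U (\<lambda>x. g x * \<phi> x)"
    using g assms by (intro test_fun_mult_right test_fun_smooth[OF assms(1)])
  moreover have "test_fun V (\<lambda>x. (1 - g x) * \<phi> x)"
  proof (rule test_funI)
    show "compact (?K - W)" using K g by (intro compact_diff) auto
    show "smooth_on UNIV (\<lambda>x. (1 - g x) * \<phi> x)"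
      using test_fun_smooth[OF assms(1)] test_fun_smooth[OF g(1)] by (intro smooth_mult smooth_diff) auto
    show "x \<in> ?K - W" if "(1 - g x) * \<phi> x \<noteq> 0" for x
      using that g(6)[of x] in_fun_support[of \<phi> x] by auto
  qed (use g in blast)
  ultimately show ?thesis using g by (intro that[of g]) auto
qed

lemma test_fun_partition:
  fixes \<phi> :: "real^'n::finite \<Rightarrow> real"
  assumes "finite I" "\<And>i. i \<in> I \<Longrightarrow> open (U i)" "test_fun (\<Union>i\<in>I. U i) \<phi>"
  shows "\<exists>g. (\<forall>i x. 0 \<le> g i x \<and> g i x \<le> (1::real)) \<and> (\<forall>i\<in>I. test_fun (U i) (\<lambda>x. g i x * \<phi> x)) \<and>
    (\<forall>x. (\<Sum>i\<in>I. g i x * \<phi> x) = \<phi> x)"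
  using assms
proof (induction I arbitrary: \<phi> rule: finite_induct)
  case empty
  then have "\<phi> x = 0" for x by (auto simp: test_fun_def intro: not_in_fun_support)
  then show ?case by (intro exI[of _ "\<lambda>_ _. 0"]) auto
next
  case (insert i I)
  obtain g where g: "\<And>x. 0 \<le> g x" "\<And>x. g x \<le> 1" "test_fun (U i) (\<lambda>x. g x * \<phi> x)"
      "test_fun (\<Union>i\<in>I. U i) (\<lambda>x. (1 - g x) * \<phi> x)"
    using test_fun_split[of "U i" "\<Union>i\<in>I. U i" \<phi>] insert.prems by auto
  from insert.IH[OF _ g(4)] insert.prems(1) obtain h where "(\<forall>i x. 0 \<le> h i x \<and> h i x \<le> (1::real)) \<and>
      (\<forall>i\<in>I. test_fun (U i) (\<lambda>x. h i x * ((1 - g x) * \<phi> x))) \<and>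
      (\<forall>x. (\<Sum>i\<in>I. h i x * ((1 - g x) * \<phi> x)) = (1 - g x) * \<phi> x)"
    by auto
  then have h: "\<And>i x. 0 \<le> h i x \<and> h i x \<le> (1::real)"
      "\<And>i. i \<in> I \<Longrightarrow> test_fun (U i) (\<lambda>x. h i x * ((1 - g x) * \<phi> x))"
      "\<And>x. (\<Sum>i\<in>I. h i x * ((1 - g x) * \<phi> x)) = (1 - g x) * \<phi> x"
    by blast+
  let ?k = "\<lambda>j x. if j = i then g x else h j x * (1 - g x)"
  show ?case
  proof (intro exI[of _ ?k] conjI allI ballI)
    show "0 \<le> ?k j x" "?k j x \<le> 1" for j x
      using g(1,2)[of x] h(1)[of j x] by (auto intro: mult_le_one)
    show "test_fun (U j) (\<lambda>x. ?k j x * \<phi> x)" if "j \<in> insert i I" for j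
    proof (cases "j = i")
      case True
      then show ?thesis using g(3) by simp
    next
      case False
      then show ?thesis using that h(2)[of j] by (simp add: mult.assoc)
    qed
    fix x
    have "(\<Sum>j\<in>insert i I. ?k j x * \<phi> x) = g x * \<phi> x + (\<Sum>j\<in>I. h j x * ((1 - g x) * \<phi> x))"
      using insert.hyps by (subst sum.insert) (auto intro!: sum.cong)
    also have "\<dots> = \<phi> x" unfolding h(3) by (simp add: algebra_simps)
    finally show "(\<Sum>j\<in>insert i I. ?k j x * \<phi> x) = \<phi> x" .
  qed
qed

section \<open>Riesz representation for positive functionals on test functions\<close>

text \<open>Test functions are smooth, so the classical construction of the representing measure is
  carried out with mollified cutoff functions and smooth partitions in the place of continuous
  ones.\<close>

locale positive_functional =
  fixes \<Omega> :: "(real^'n::finite) set" and L :: "'n functional"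
  assumes open_\<Omega>: "open \<Omega>"
    and add: "test_fun \<Omega> \<phi> \<Longrightarrow> test_fun \<Omega> \<psi> \<Longrightarrow> L (\<lambda>x. \<phi> x + \<psi> x) = L \<phi> + L \<psi>"
    and scale: "test_fun \<Omega> \<phi> \<Longrightarrow> L (\<lambda>x. c * \<phi> x) = c * L \<phi>"
    and nonneg: "test_fun \<Omega> \<phi> \<Longrightarrow> (\<And>x. 0 \<le> \<phi> x) \<Longrightarrow> 0 \<le> L \<phi>"
begin

lemma zero: "L (\<lambda>x. 0) = 0"
  using scale[of "\<lambda>x. 0" 0] by simp

lemma diff: "test_fun \<Omega> \<phi> \<Longrightarrow> test_fun \<Omega> \<psi> \<Longrightarrow> L (\<lambda>x. \<phi> x - \<psi> x) = L \<phi> - L \<psi>"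
  using add[of \<phi> "\<lambda>x. -1 * \<psi> x"] scale[of \<psi> "-1"] test_fun_cmult[of \<Omega> \<psi> "-1"] by simp

lemma sum: "(\<And>i. i \<in> I \<Longrightarrow> test_fun \<Omega> (f i)) \<Longrightarrow> L (\<lambda>x. \<Sum>i\<in>I. f i x) = (\<Sum>i\<in>I. L (f i))"
  by (induction I rule: infinite_finite_induct) (auto simp: zero add test_fun_sum)

lemma mono: "test_fun \<Omega> \<phi> \<Longrightarrow> test_fun \<Omega> \<psi> \<Longrightarrow> (\<And>x. \<phi> x \<le> \<psi> x) \<Longrightarrow> L \<phi> \<le> L \<psi>"
  using nonneg[of "\<lambda>x. \<psi> x - \<phi> x"] diff[of \<psi> \<phi>] test_fun_diff[of \<Omega> \<psi> \<phi>] by simp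

definition dominated :: "(real^'n) set \<Rightarrow> (real^'n \<Rightarrow> real) set" where
  "dominated U = {\<phi>. test_fun U \<phi> \<and> (\<forall>x. 0 \<le> \<phi> x \<and> \<phi> x \<le> 1)}"

text \<open>The value that a representing measure has to give to an open set.\<close>

definition content_open :: "(real^'n) set \<Rightarrow> ennreal" where
  "content_open U = (SUP \<phi>\<in>dominated U. ennreal (L \<phi>))"

lemma zero_dominated: "(\<lambda>x. 0) \<in> dominated U"
  by (simp add: dominated_def)

lemma content_open_upper: "test_fun U \<phi> \<Longrightarrow> (\<And>x. 0 \<le> \<phi> x) \<Longrightarrow> (\<And>x. \<phi> x \<le> 1) \<Longrightarrow> ennreal (L \<phi>) \<le> content_open U"
  unfolding content_open_def by (rule SUP_upper) (simp add: dominated_def)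

lemma content_open_mono: "U \<subseteq> V \<Longrightarrow> content_open U \<le> content_open V"
  unfolding content_open_def by (rule SUP_subset_mono) (auto simp: dominated_def intro: test_fun_mono)

lemma content_open_empty: "content_open {} = 0"
proof -
  have "\<phi> = (\<lambda>x. 0)" if "\<phi> \<in> dominated {}" for \<phi>
    using that by (auto simp: dominated_def test_fun_def fun_eq_iff intro: not_in_fun_support)
  then have "content_open {} \<le> 0"
    unfolding content_open_def by (intro SUP_least) (metis zero ennreal_0 order_refl)
  then show ?thesis by simp
qed

text \<open>A compact support meets the cover in finitely many sets already, and a partition of
  unity distributes \<open>\<phi>\<close> over these; each piece competes in the supremum for its
  own set.\<close>

lemma content_open_UN:
  fixes U :: "nat \<Rightarrow> (real^'n) set"
  assumes "\<And>i. open (U i)" "\<And>i. U i \<subseteq> \<Omega>"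
  shows "content_open (\<Union>i. U i) \<le> (\<Sum>i. content_open (U i))"
  unfolding content_open_def[of "\<Union>i. U i"]
proof (rule SUP_least)
  fix \<phi> assume \<phi>: "\<phi> \<in> dominated (\<Union>i. U i)"
  then have "compact (fun_support \<phi>)" "fun_support \<phi> \<subseteq> (\<Union>i\<in>UNIV. U i)"
    by (auto simp: dominated_def test_fun_def)
  then obtain I where I: "finite I" "fun_support \<phi> \<subseteq> (\<Union>i\<in>I. U i)"
    using assms(1) by (metis compactE_image subset_UNIV)
  then have "test_fun (\<Union>i\<in>I. U i) \<phi>"
    using \<phi> by (auto simp: dominated_def test_fun_def)
  from test_fun_partition[OF I(1) _ this] assms(1) obtain g where
    "(\<forall>i x. 0 \<le> g i x \<and> g i x \<le> (1::real)) \<and> (\<forall>i\<in>I. test_fun (U i) (\<lambda>x. g i x * \<phi> x)) \<and>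
      (\<forall>x. (\<Sum>i\<in>I. g i x * \<phi> x) = \<phi> x)" by auto
  then have g: "\<And>i x. 0 \<le> g i x \<and> g i x \<le> 1" "\<And>i. i \<in> I \<Longrightarrow> test_fun (U i) (\<lambda>x. g i x * \<phi> x)"
      "\<And>x. (\<Sum>i\<in>I. g i x * \<phi> x) = \<phi> x" by blast+
  have test: "test_fun \<Omega> (\<lambda>x. g i x * \<phi> x)" if "i \<in> I" for i
    using test_fun_mono[OF g(2)[OF that] assms(2)] .
  have 01: "0 \<le> \<phi> x" "\<phi> x \<le> 1" for x using \<phi> by (auto simp: dominated_def)
  have "L \<phi> = L (\<lambda>x. \<Sum>i\<in>I. g i x * \<phi> x)" unfolding g(3) ..
  also have "\<dots> = (\<Sum>i\<in>I. L (\<lambda>x. g i x * \<phi> x))" by (rule sum) (rule test)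
  finally have "ennreal (L \<phi>) = (\<Sum>i\<in>I. ennreal (L (\<lambda>x. g i x * \<phi> x)))"
    using test 01 g(1) by (simp add: nonneg sum_ennreal)
  also have "\<dots> \<le> (\<Sum>i\<in>I. content_open (U i))"
    using 01 g(1) by (intro sum_mono content_open_upper g(2)) (auto intro: mult_le_one)
  also have "\<dots> \<le> (\<Sum>i. content_open (U i))"
    using I(1) by (intro sum_le_suminf) auto
  finally show "ennreal (L \<phi>) \<le> (\<Sum>i. content_open (U i))" .
qed

definition outer :: "(real^'n) set \<Rightarrow> ennreal" where
  "outer A = (INF U\<in>{U. open U \<and> A \<subseteq> U \<and> U \<subseteq> \<Omega>}. content_open U)"

lemma outer_le: "open U \<Longrightarrow> A \<subseteq> U \<Longrightarrow> U \<subseteq> \<Omega> \<Longrightarrow> outer A \<le> content_open U"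
  unfolding outer_def by (rule INF_lower) auto

lemma outer_open: "open U \<Longrightarrow> U \<subseteq> \<Omega> \<Longrightarrow> outer U = content_open U"
  by (intro antisym outer_le) (auto simp: outer_def intro!: INF_greatest content_open_mono)

lemma outer_mono: "A \<subseteq> B \<Longrightarrow> outer A \<le> outer B"
  unfolding outer_def by (rule INF_superset_mono) auto

lemma outer_approx:
  assumes "A \<subseteq> \<Omega>" "e > 0" "outer A < \<infinity>"
  obtains U where "open U" "A \<subseteq> U" "U \<subseteq> \<Omega>" "content_open U < outer A + ennreal e"
proof -
  have "outer A < outer A + ennreal e"
    using assms by (simp add: ennreal_add_left_cancel_less[of _ 0, simplified] less_top)
  then show ?thesis using that unfolding outer_def INF_less_iff by blast
qed

lemma outer_measure_space: "outer_measure_space (Pow \<Omega>) outer"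
  unfolding outer_measure_space_def
proof (intro conjI)
  show "positive (Pow \<Omega>) outer"
    by (simp add: positive_def outer_open content_open_empty)
  show "increasing (Pow \<Omega>) outer"
    by (simp add: increasing_def outer_mono)
  show "countably_subadditive (Pow \<Omega>) outer"
    unfolding countably_subadditive_def
  proof (intro allI impI)
    fix A :: "nat \<Rightarrow> (real^'n) set" assume A: "range A \<subseteq> Pow \<Omega>"
    show "outer (\<Union>i. A i) \<le> (\<Sum>i. outer (A i))"
    proof (cases "\<exists>i. outer (A i) = \<infinity>")
      case True
      then obtain i where "outer (A i) = \<infinity>" ..
      moreover have "(\<Sum>i\<in>{i}. outer (A i)) \<le> (\<Sum>i. outer (A i))"
        by (rule sum_le_suminf) auto
      ultimately have "(\<Sum>i. outer (A i)) = \<infinity>" by (simp add: top_unique)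
      then show ?thesis by simp
    next
      case False
      show ?thesis
      proof (rule ennreal_le_epsilon)
        fix e :: real assume e: "0 < e"
        have "\<exists>U. open U \<and> A i \<subseteq> U \<and> U \<subseteq> \<Omega> \<and> content_open U \<le> outer (A i) + ennreal (e * (1/2) ^ Suc i)" for i
          using outer_approx[of "A i" "e * (1/2) ^ Suc i"] False A e
          by (metis PowD infinity_ennreal_def less_imp_le less_top mult_pos_pos rangeI subsetD zero_less_divide_1_iff zero_less_numeral zero_less_power)
        then obtain U where U: "\<And>i. open (U i)" "\<And>i. A i \<subseteq> U i" "\<And>i. U i \<subseteq> \<Omega>"
          "\<And>i. content_open (U i) \<le> outer (A i) + ennreal (e * (1/2) ^ Suc i)" by metis
        have "outer (\<Union>i. A i) \<le> content_open (\<Union>i. U i)"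
          using U by (intro outer_le) (auto, blast+)
        also have "\<dots> \<le> (\<Sum>i. content_open (U i))" by (rule content_open_UN[OF U(1,3)])
        also have "\<dots> \<le> (\<Sum>i. outer (A i) + ennreal (e * (1/2) ^ Suc i))"
          by (intro suminf_le U(4)) auto
        also have "\<dots> = (\<Sum>i. outer (A i)) + (\<Sum>i. ennreal (e * (1/2) ^ Suc i))"
          by (rule suminf_add[symmetric]) auto
        also have "(\<Sum>i. ennreal (e * (1/2) ^ Suc i)) = ennreal e"
          using e sums_mult[OF power_half_series, of e] by (intro suminf_ennreal_eq) auto
        finally show "outer (\<Union>i. A i) \<le> (\<Sum>i. outer (A i)) + ennreal e" .
      qed
    qed
  qed
qed

text \<open>Given an open \<open>W\<close> containing \<open>A\<close>, the part of \<open>A\<close>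
  outside \<open>U\<close> lies in the open set \<open>W - fun_support \<phi>\<close> whenever
  \<open>\<phi>\<close> is supported in \<open>W \<inter> U\<close>. A competitor
  \<open>\<psi>\<close> for that set has support disjoint from that of \<open>\<phi>\<close>, so
  \<open>\<phi> + \<psi>\<close> stays below 1 and competes for \<open>W\<close>.\<close>

lemma open_lambda_system:
  assumes "open U" "U \<subseteq> \<Omega>"
  shows "U \<in> lambda_system \<Omega> (Pow \<Omega>) outer"
  unfolding lambda_system_def
proof (intro CollectI conjI ballI)
  fix A assume "A \<in> Pow \<Omega>"
  then have A: "A \<subseteq> \<Omega>" by simp
  show "outer (U \<inter> A) + outer ((\<Omega> - U) \<inter> A) = outer A"
  proof (rule antisym)
    show "outer (U \<inter> A) + outer ((\<Omega> - U) \<inter> A) \<le> outer A"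
      unfolding outer_def[of A]
    proof (rule INF_greatest)
      fix W assume "W \<in> {W. open W \<and> A \<subseteq> W \<and> W \<subseteq> \<Omega>}"
      then have W: "open W" "A \<subseteq> W" "W \<subseteq> \<Omega>" by auto
      have "ennreal (L \<phi>) + outer ((\<Omega> - U) \<inter> A) \<le> content_open W" if \<phi>: "\<phi> \<in> dominated (W \<inter> U)" for \<phi>
      proof -
        let ?V = "W - fun_support \<phi>"
        have \<phi>': "test_fun (W \<inter> U) \<phi>" "\<And>x. 0 \<le> \<phi> x" "\<And>x. \<phi> x \<le> 1"
          using \<phi> by (auto simp: dominated_def)
        have "outer ((\<Omega> - U) \<inter> A) \<le> content_open ?V"
          using W \<phi>'(1) by (intro outer_le) (auto simp: test_fun_def)
        moreover have "ennreal (L \<phi>) + content_open ?V \<le> content_open W"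
          unfolding content_open_def[of ?V]
        proof (subst ennreal_SUP_add_right)
          show "dominated ?V \<noteq> {}" using zero_dominated by blast
          show "(SUP \<psi>\<in>dominated ?V. ennreal (L \<phi>) + ennreal (L \<psi>)) \<le> content_open W"
          proof (rule SUP_least)
            fix \<psi> assume "\<psi> \<in> dominated ?V"
            then have \<psi>: "test_fun ?V \<psi>" "\<And>x. 0 \<le> \<psi> x" "\<And>x. \<psi> x \<le> 1"
              by (auto simp: dominated_def)
            have t: "test_fun W \<phi>" "test_fun W \<psi>"
              using \<phi>'(1) \<psi>(1) by (auto intro: test_fun_mono)
            have t': "test_fun \<Omega> \<phi>" "test_fun \<Omega> \<psi>"
              using t W(3) by (auto intro: test_fun_mono)
            have le1: "\<phi> x + \<psi> x \<le> 1" for x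
            proof (cases "x \<in> fun_support \<phi>")
              case True
              then have "\<psi> x = 0" using \<psi>(1) by (intro not_in_fun_support) (auto simp: test_fun_def)
              then show ?thesis using \<phi>'(3)[of x] by simp
            next
              case False
              then have "\<phi> x = 0" by (rule not_in_fun_support)
              then show ?thesis using \<psi>(3)[of x] by simp
            qed
            have "ennreal (L \<phi>) + ennreal (L \<psi>) = ennreal (L (\<lambda>x. \<phi> x + \<psi> x))"
              using t' \<phi>' \<psi> by (simp add: add nonneg ennreal_plus)
            also have "\<dots> \<le> content_open W"
              using t \<phi>' \<psi> le1 by (intro content_open_upper test_fun_add) auto
            finally show "ennreal (L \<phi>) + ennreal (L \<psi>) \<le> content_open W" .
          qed
        qed
        ultimately show ?thesis by (meson add_left_mono order_trans)
      qed
      then have "(SUP \<phi>\<in>dominated (W \<inter> U). ennreal (L \<phi>) + outer ((\<Omega> - U) \<inter> A)) \<le> content_open W"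
        by (rule SUP_least)
      moreover have "dominated (W \<inter> U) \<noteq> {}" using zero_dominated by blast
      ultimately have "content_open (W \<inter> U) + outer ((\<Omega> - U) \<inter> A) \<le> content_open W"
        unfolding content_open_def[of "W \<inter> U"] by (subst (asm) ennreal_SUP_add_left) auto
      moreover have "outer (U \<inter> A) \<le> content_open (W \<inter> U)"
        using W assms by (intro outer_le) auto
      ultimately show "outer (U \<inter> A) + outer ((\<Omega> - U) \<inter> A) \<le> content_open W"
        by (meson add_right_mono order_trans)
    qed
    have "subadditive (Pow \<Omega>) outer"
      using outer_measure_space ring_of_sets.countably_subadditive_subadditive[of \<Omega> "Pow \<Omega>" outer]
      by (simp add: outer_measure_space_def ring_of_sets_Pow)
    moreover have "(U \<inter> A) \<union> ((\<Omega> - U) \<inter> A) = A" using A by auto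
    ultimately show "outer A \<le> outer (U \<inter> A) + outer ((\<Omega> - U) \<inter> A)"
      using A assms(2) subadditiveD[of "Pow \<Omega>" outer "U \<inter> A" "(\<Omega> - U) \<inter> A"] by auto
  qed
qed (use assms in auto)

lemma borel_lambda_system:
  shows "sets (restrict_space borel \<Omega>) \<subseteq> lambda_system \<Omega> (Pow \<Omega>) outer"
proof
  let ?\<Lambda> = "lambda_system \<Omega> (Pow \<Omega>) outer"
  have "measure_space \<Omega> ?\<Lambda> outer"
    by (rule sigma_algebra.caratheodory_lemma[OF sigma_algebra_Pow outer_measure_space])
  then interpret sigma_algebra \<Omega> ?\<Lambda> by (simp add: measure_space_def)
  fix A assume "A \<in> sets (restrict_space borel \<Omega>)"
  then obtain B where B: "A = \<Omega> \<inter> B" "B \<in> sets borel" by (auto simp: sets_restrict_space)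
  have "B \<in> sigma_sets UNIV {S. open S}"
    using B(2) by (simp add: borel_def)
  then have "\<Omega> \<inter> B \<in> ?\<Lambda>"
  proof induction
    case (Basic U)
    then show ?case using open_\<Omega> by (intro open_lambda_system) auto
  next
    case (Compl U)
    have "\<Omega> - (\<Omega> \<inter> U) \<in> ?\<Lambda>" using Compl.IH by (rule compl_sets)
    then show ?case by (simp add: Diff_Int_distrib Diff_Int)
  next
    case (Union U)
    have "(\<Union>i. \<Omega> \<inter> U i) \<in> ?\<Lambda>" using Union.IH by (intro countable_UN) auto
    then show ?case by simp
  qed simp
  then show "A \<in> ?\<Lambda>" by (simp add: B)
qed

section \<open>The measure representing a positive functional\<close>

definition riesz_measure :: "(real^'n) measure" where
  "riesz_measure = measure_of \<Omega> (sets (restrict_space borel \<Omega>)) outer"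

lemma sigma_algebra_restrict: "sigma_algebra \<Omega> (sets (restrict_space borel \<Omega>))"
  using sets.sigma_algebra_axioms[of "restrict_space borel \<Omega>"] by (simp add: space_restrict_space)

lemma sets_riesz: "sets riesz_measure = sets (restrict_space borel \<Omega>)"
  unfolding riesz_measure_def using sigma_algebra.sets_measure_of_eq[OF sigma_algebra_restrict] by simp

lemma space_riesz: "space riesz_measure = \<Omega>"
  using sets_eq_imp_space_eq[OF sets_riesz] by (simp add: space_restrict_space)

lemma emeasure_riesz: "A \<in> sets riesz_measure \<Longrightarrow> emeasure riesz_measure A = outer A"
proof -
  have "measure_space \<Omega> (sets (restrict_space borel \<Omega>)) outer"
    by (rule measure_down[OF sigma_algebra.caratheodory_lemma[OF sigma_algebra_Pow outer_measure_space]
          sigma_algebra_restrict borel_lambda_system])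
  then show "A \<in> sets riesz_measure \<Longrightarrow> emeasure riesz_measure A = outer A"
    unfolding sets_riesz unfolding riesz_measure_def
    by (intro emeasure_measure_of_sigma) (auto simp: measure_space_def)
qed

lemma sets_rieszI: "A \<in> sets borel \<Longrightarrow> A \<subseteq> \<Omega> \<Longrightarrow> A \<in> sets riesz_measure"
  using open_\<Omega> by (simp add: sets_riesz sets_restrict_space_iff)

lemma measurable_riesz: "f \<in> borel_measurable borel \<Longrightarrow> f \<in> borel_measurable riesz_measure"
  by (subst measurable_cong_sets[OF sets_riesz refl]) (rule measurable_restrict_space1)

lemma emeasure_riesz_le:
  assumes "A \<in> sets borel" "A \<subseteq> W" "open W" "test_fun \<Omega> \<phi>" "\<And>x. 0 \<le> \<phi> x" "\<And>x. x \<in> W \<Longrightarrow> \<phi> x = 1" "W \<subseteq> \<Omega>"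
  shows "emeasure riesz_measure A \<le> ennreal (L \<phi>)"
proof -
  have "A \<in> sets riesz_measure" using assms by (intro sets_rieszI) auto
  then have "emeasure riesz_measure A \<le> content_open W"
    using assms by (simp add: emeasure_riesz outer_le)
  also have "\<dots> \<le> ennreal (L \<phi>)"
    unfolding content_open_def
  proof (rule SUP_least)
    fix \<psi> assume "\<psi> \<in> dominated W"
    then have \<psi>: "test_fun W \<psi>" "\<And>x. 0 \<le> \<psi> x" "\<And>x. \<psi> x \<le> 1" by (auto simp: dominated_def)
    have "\<psi> x \<le> \<phi> x" for x
    proof (cases "x \<in> W")
      case True
      then show ?thesis using assms(6)[of x] \<psi>(3)[of x] by simp
    next
      case False
      then have "\<psi> x = 0" using \<psi>(1) by (intro not_in_fun_support) (auto simp: test_fun_def)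
      then show ?thesis using assms(5)[of x] by simp
    qed
    then show "ennreal (L \<psi>) \<le> ennreal (L \<phi>)"
      using assms(4,7) \<psi>(1) by (intro ennreal_leI mono) (auto intro: test_fun_mono)
  qed
  finally show ?thesis .
qed

lemma riesz_compact_finite:
  assumes "compact K" "K \<subseteq> \<Omega>"
  shows "emeasure riesz_measure K < \<infinity>"
proof -
  obtain \<eta> W where \<eta>: "test_fun \<Omega> \<eta>" "\<And>x. 0 \<le> \<eta> x" "\<And>x. \<eta> x \<le> 1" "open W" "K \<subseteq> W" "\<And>x. x \<in> W \<Longrightarrow> \<eta> x = 1"
    using cutoff_exists[OF assms(1) open_\<Omega> assms(2)] by metis
  have "emeasure riesz_measure K \<le> ennreal (L \<eta>)"
  proof (rule emeasure_riesz_le[of _ "W \<inter> \<Omega>"])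
    show "open (W \<inter> \<Omega>)" using \<eta>(4) open_\<Omega> by auto
  qed (use \<eta> assms in \<open>auto intro: borel_compact\<close>)
  also have "\<dots> < \<infinity>" by simp
  finally show ?thesis .
qed

lemma test_fun_integrable_riesz:
  assumes "test_fun \<Omega> \<phi>"
  shows "integrable riesz_measure \<phi>"
proof -
  obtain B where B: "\<And>x. \<bar>\<phi> x\<bar> \<le> B" using test_fun_bounded assms by blast
  have K: "compact (fun_support \<phi>)" "fun_support \<phi> \<subseteq> \<Omega>" using assms by (auto simp: test_fun_def)
  show ?thesis
  proof (rule Bochner_Integration.integrable_bound)
    show "integrable riesz_measure (\<lambda>x. B * indicat_real (fun_support \<phi>) x)"
      using K riesz_compact_finite[OF K]
      by (intro integrable_mult_right integrable_real_indicator) (auto intro!: sets_rieszI borel_compact)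
    show "\<phi> \<in> borel_measurable riesz_measure"
      using assms by (intro measurable_riesz smooth_borel_measurable test_fun_smooth)
    have "norm (\<phi> x) \<le> norm (B * indicat_real (fun_support \<phi>) x)" for x
      using B[of x] not_in_fun_support[of x \<phi>] by (cases "x \<in> fun_support \<phi>") auto
    then show "AE x in riesz_measure. norm (\<phi> x) \<le> norm (B * indicat_real (fun_support \<phi>) x)" by simp
  qed
qed

text \<open>\<open>\<phi>\<close> is cut into slices of height \<open>1 / N\<close>. Each slice has
  an open neighbourhood of nearly the same measure on which \<open>\<phi>\<close> is hardly larger,
  and a partition of unity subordinate to these bounds \<open>L \<phi>\<close> by an upper Riemann
  sum.\<close>

lemma le_riesz_integral:
  assumes \<phi>: "test_fun \<Omega> \<phi>" "\<And>x. 0 \<le> \<phi> x" "\<And>x. \<phi> x \<le> 1"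
  shows "L \<phi> \<le> (LINT x|riesz_measure. \<phi> x)"
proof -
  let ?K = "fun_support \<phi>" and ?\<nu> = riesz_measure
  have K: "compact ?K" "?K \<subseteq> \<Omega>" using \<phi> by (auto simp: test_fun_def)
  have Kfin: "emeasure ?\<nu> A < \<infinity>" if "A \<subseteq> ?K" for A
    using emeasure_mono[OF that, of ?\<nu>] riesz_compact_finite[OF K] K
    by (meson le_less_trans borel_compact sets_rieszI)
  have meas: "\<phi> \<in> borel_measurable borel"
    using \<phi> by (intro smooth_borel_measurable test_fun_smooth)
  have cont: "continuous_on UNIV \<phi>" using \<phi> by (intro smooth_continuous_on test_fun_smooth)
  have bound: "L \<phi> \<le> (LINT x|?\<nu>. \<phi> x) + (2 * measure ?\<nu> ?K + 2) / N" if N: "N \<ge> 1" for N :: nat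
  proof -
    \<comment> \<open>Slice 0 catches the points of the support at which \<open>\<phi>\<close> is 0,
      so \<open>N + 1\<close> slices cover the support.\<close>
    define E where "E i = {x \<in> ?K. (real i - 1) / N < \<phi> x \<and> \<phi> x \<le> real i / N}" for i :: nat
    \<comment> \<open>On \<open>E i\<close> the function may reach \<open>i / N\<close>; the next
      level makes \<open>{x. \<phi> x < c i}\<close> an open neighbourhood of
      \<open>E i\<close>.\<close>
    define c where "c i = (real i + 1) / N" for i :: nat
    \<comment> \<open>Each of the \<open>N + 1\<close> slices pays at most
      \<open>(N + 1) / N * d\<close> for its neighbourhood, so together they pay
      \<open>1 / N\<close>.\<close>
    define d where "d = 1 / (real N + 1)\<^sup>2"
    have "d > 0" by (simp add: d_def)
    have E_meas: "E i \<in> sets borel" for i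
      unfolding E_def using meas borel_compact[OF K(1)] by measurable
    have E_sub: "E i \<subseteq> ?K" "E i \<subseteq> \<Omega>" for i using K by (auto simp: E_def)
    have E_sets: "E i \<in> sets ?\<nu>" for i by (rule sets_rieszI[OF E_meas E_sub(2)])
    have "\<exists>V. open V \<and> E i \<subseteq> V \<and> V \<subseteq> \<Omega> \<inter> {x. \<phi> x < c i} \<and> content_open V \<le> ennreal (measure ?\<nu> (E i) + d)" for i
    proof -
      have fin: "outer (E i) < \<infinity>" using Kfin[OF E_sub(1)] by (simp add: emeasure_riesz[OF E_sets])
      obtain U where U: "open U" "E i \<subseteq> U" "U \<subseteq> \<Omega>" "content_open U < outer (E i) + ennreal d"
        using outer_approx[OF E_sub(2) \<open>d > 0\<close> fin] .
      have "open {x. \<phi> x < c i}"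
        using cont by (intro open_Collect_less) auto
      moreover have "E i \<subseteq> {x. \<phi> x < c i}"
        using N by (auto simp: E_def c_def divide_simps)
      moreover have "content_open (U \<inter> {x. \<phi> x < c i}) \<le> outer (E i) + ennreal d"
        using content_open_mono[of "U \<inter> {x. \<phi> x < c i}" U] U(4) by (auto intro: order_trans less_imp_le)
      moreover have "outer (E i) = ennreal (measure ?\<nu> (E i))"
        using fin by (simp add: measure_def emeasure_riesz[OF E_sets])
      ultimately show ?thesis using U \<open>d > 0\<close> by (intro exI[of _ "U \<inter> {x. \<phi> x < c i}"]) (auto simp: ennreal_plus)
    qed
    then obtain V where V: "\<And>i. open (V i)" "\<And>i. E i \<subseteq> V i" "\<And>i. V i \<subseteq> \<Omega> \<inter> {x. \<phi> x < c i}"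
        "\<And>i. content_open (V i) \<le> ennreal (measure ?\<nu> (E i) + d)" by metis
    have E_cover: "x \<in> E (nat \<lceil>N * \<phi> x\<rceil>) \<and> nat \<lceil>N * \<phi> x\<rceil> \<le> N" if "x \<in> ?K" for x
    proof -
      have "0 \<le> N * \<phi> x" using \<phi>(2)[of x] by simp
      then have "real (nat \<lceil>N * \<phi> x\<rceil>) - 1 < N * \<phi> x" "N * \<phi> x \<le> real (nat \<lceil>N * \<phi> x\<rceil>)"
        by linarith+
      moreover have "N * \<phi> x \<le> N" using \<phi>(3)[of x] by (simp add: mult_left_le)
      then have "nat \<lceil>N * \<phi> x\<rceil> \<le> N" by linarith
      ultimately show ?thesis using that N by (auto simp: E_def field_simps)
    qed
    have "test_fun (\<Union>i\<in>{..N}. V i) \<phi>"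
      using \<phi> V(2) E_cover by (fastforce simp: test_fun_def)
    from test_fun_partition[OF _ _ this] V(1) obtain g where
      "(\<forall>i x. 0 \<le> g i x \<and> g i x \<le> (1::real)) \<and> (\<forall>i\<in>{..N}. test_fun (V i) (\<lambda>x. g i x * \<phi> x)) \<and>
        (\<forall>x. (\<Sum>i\<in>{..N}. g i x * \<phi> x) = \<phi> x)" by auto
    then have g: "\<And>i x. 0 \<le> g i x \<and> g i x \<le> 1" "\<And>i. i \<in> {..N} \<Longrightarrow> test_fun (V i) (\<lambda>x. g i x * \<phi> x)"
        "\<And>x. (\<Sum>i\<in>{..N}. g i x * \<phi> x) = \<phi> x" by blast+
    have test: "test_fun \<Omega> (\<lambda>x. g i x * \<phi> x)" if "i \<in> {..N}" for i
      using V(3) by (intro test_fun_mono[OF g(2)[OF that]]) auto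
    have part: "L (\<lambda>x. g i x * \<phi> x) \<le> c i * (measure ?\<nu> (E i) + d)" if i: "i \<in> {..N}" for i
    proof -
      have "c i > 0" using N by (simp add: c_def)
      have "g i x * \<phi> x \<le> c i" for x
      proof (cases "x \<in> V i")
        case True
        then have "\<phi> x < c i" using V(3) by auto
        moreover have "g i x * \<phi> x \<le> \<phi> x"
          using g(1)[of i x] \<phi>(2)[of x] by (simp add: mult_right_le_one_le mult_left_le_one_le)
        ultimately show ?thesis by simp
      next
        case False
        then have "g i x * \<phi> x = 0"
          using g(2)[OF i] by (intro not_in_fun_support[of x "\<lambda>x. g i x * \<phi> x"]) (auto simp: test_fun_def)
        then show ?thesis using \<open>c i > 0\<close> by linarith
      qed
      \<comment> \<open>Division by \<open>c i\<close> brings the piece below 1, so that it competes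
        in the supremum defining \<open>content_open (V i)\<close>.\<close>
      then have "ennreal (L (\<lambda>x. 1 / c i * (g i x * \<phi> x))) \<le> content_open (V i)"
        using g(1) \<phi> \<open>c i > 0\<close>
        by (intro content_open_upper test_fun_cmult g(2) i) (auto simp: divide_simps)
      also have "\<dots> \<le> ennreal (measure ?\<nu> (E i) + d)" by (rule V(4))
      finally have "L (\<lambda>x. 1 / c i * (g i x * \<phi> x)) \<le> measure ?\<nu> (E i) + d"
        using \<open>d > 0\<close> by (subst (asm) ennreal_le_iff) auto
      then show ?thesis
        using \<open>c i > 0\<close> by (subst (asm) scale[OF test[OF i]]) (simp add: field_simps)
    qed
    have int: "integrable ?\<nu> (\<lambda>x. c i * indicat_real (E i) x)" for i
      using Kfin[OF E_sub(1)] E_sets by (intro integrable_mult_right integrable_real_indicator) auto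
    have intK: "integrable ?\<nu> (indicat_real ?K)"
      using Kfin[OF order_refl] K by (auto intro!: sets_rieszI borel_compact integrable_real_indicator)
    then have int': "integrable ?\<nu> (\<lambda>x. \<phi> x + 2 / N * indicat_real ?K x)"
      using test_fun_integrable_riesz[OF \<phi>(1)]
      by (intro Bochner_Integration.integrable_add integrable_mult_right)
    have "L \<phi> = L (\<lambda>x. \<Sum>i\<in>{..N}. g i x * \<phi> x)" unfolding g(3) ..
    also have "\<dots> = (\<Sum>i\<in>{..N}. L (\<lambda>x. g i x * \<phi> x))" by (rule sum) (rule test)
    also have "\<dots> \<le> (\<Sum>i\<in>{..N}. c i * (measure ?\<nu> (E i) + d))"
      by (intro sum_mono part)
    also have "\<dots> = (\<Sum>i\<in>{..N}. c i * measure ?\<nu> (E i)) + (\<Sum>i\<in>{..N}. c i * d)"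
      by (simp add: distrib_left sum.distrib)
    also have "(\<Sum>i\<in>{..N}. c i * measure ?\<nu> (E i)) = (LINT x|?\<nu>. (\<Sum>i\<in>{..N}. c i * indicat_real (E i) x))"
      by (subst Bochner_Integration.integral_sum, rule int) (simp add: space_riesz Int_absorb2 E_sub(2))
    also have "\<dots> \<le> (LINT x|?\<nu>. \<phi> x + 2 / N * indicat_real ?K x)"
    proof (rule integral_mono)
      fix x
      show "(\<Sum>i\<in>{..N}. c i * indicat_real (E i) x) \<le> \<phi> x + 2 / N * indicat_real ?K x"
      proof (cases "x \<in> ?K")
        case True
        let ?j = "nat \<lceil>N * \<phi> x\<rceil>"
        have uniq: "i = ?j" if "x \<in> E i" for i
        proof -
          have "real i - 1 < N * \<phi> x" "N * \<phi> x \<le> real i"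
            using that N by (auto simp: E_def field_simps)
          then show ?thesis by linarith
        qed
        have "(\<Sum>i\<in>{..N}. c i * indicat_real (E i) x) = (\<Sum>i\<in>{..N}. if i = ?j then c ?j else 0)"
          using uniq E_cover[OF True] by (intro sum.cong) (auto simp: indicator_def)
        also have "\<dots> = c ?j" using E_cover[OF True] by simp
        also have "\<dots> \<le> (N * \<phi> x + 2) / N"
        proof -
          have "real ?j - 1 < N * \<phi> x"
            using E_cover[OF True] N by (auto simp: E_def pos_divide_less_eq mult.commute)
          then show ?thesis unfolding c_def by (intro divide_right_mono) auto
        qed
        also have "\<dots> = \<phi> x + 2 / N" using N by (simp add: field_simps)
        finally show ?thesis using True by simp
      next
        case False
        then have "x \<notin> E i" for i by (simp add: E_def)
        then show ?thesis using False \<phi>(2) by simp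
      qed
    qed (rule int' Bochner_Integration.integrable_sum int)+
    also have "\<dots> = (LINT x|?\<nu>. \<phi> x) + 2 / N * measure ?\<nu> ?K"
      using intK K test_fun_integrable_riesz[OF \<phi>(1)]
      by (subst Bochner_Integration.integral_add) (auto simp: space_riesz Int_absorb2)
    also have "(\<Sum>i\<in>{..N}. c i * d) \<le> 2 / N"
    proof -
      have "(\<Sum>i\<in>{..N}. c i * d) \<le> (\<Sum>i\<in>{..N}. (real N + 1) / N * d)"
        using \<open>d > 0\<close> N by (intro sum_mono mult_right_mono) (auto simp: c_def divide_right_mono)
      also have "\<dots> = (real N + 1)\<^sup>2 * d / N" by (simp add: power2_eq_square algebra_simps add_divide_distrib)
      also have "\<dots> = 1 / N" by (simp add: d_def add_nonneg_eq_0_iff)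
      also have "\<dots> \<le> 2 / N" by (simp add: divide_right_mono)
      finally show ?thesis .
    qed
    finally show ?thesis by (simp add: add_divide_distrib)
  qed
  have "(\<lambda>N::nat. (LINT x|?\<nu>. \<phi> x) + (2 * measure ?\<nu> ?K + 2) / N) \<longlonglongrightarrow> (LINT x|?\<nu>. \<phi> x) + 0"
    by (intro tendsto_intros lim_const_over_n)
  from LIMSEQ_le_const[OF this, of "L \<phi>"] show ?thesis using bound by auto
qed

text \<open>The reverse inequality comes from \<open>le_riesz_integral\<close> for
  \<open>\<eta> - \<phi>\<close>, where \<open>\<eta>\<close> is a cutoff function above
  \<open>\<phi>\<close> supported in an open \<open>U\<close> whose measure barely exceeds that of
  the support of \<open>\<phi>\<close>; for this \<open>\<eta>\<close> the integral is at most
  \<open>L \<eta> + e\<close>.\<close>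

theorem riesz_representation:
  assumes "test_fun \<Omega> \<phi>"
  shows "L \<phi> = (LINT x|riesz_measure. \<phi> x)"
proof -
  let ?\<nu> = riesz_measure
  note int = test_fun_integrable_riesz
  have unit: "L \<phi> = (LINT x|?\<nu>. \<phi> x)" if \<phi>: "test_fun \<Omega> \<phi>" "\<And>x. 0 \<le> \<phi> x" "\<And>x. \<phi> x \<le> 1" for \<phi>
  proof (rule antisym)
    show "L \<phi> \<le> (LINT x|?\<nu>. \<phi> x)" by (rule le_riesz_integral[OF \<phi>])
    let ?K = "fun_support \<phi>"
    have K: "compact ?K" "?K \<subseteq> \<Omega>" "?K \<in> sets borel" using \<phi> by (auto simp: test_fun_def)
    have KE: "emeasure ?\<nu> ?K = outer ?K" using K by (intro emeasure_riesz sets_rieszI)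
    show "(LINT x|?\<nu>. \<phi> x) \<le> L \<phi>"
    proof (rule field_le_epsilon)
      fix e :: real assume "e > 0"
      obtain U where U: "open U" "?K \<subseteq> U" "U \<subseteq> \<Omega>" "content_open U < outer ?K + ennreal e"
        using outer_approx[OF K(2) \<open>e > 0\<close>] riesz_compact_finite[OF K(1,2)] KE by metis
      obtain \<eta> W where \<eta>: "test_fun U \<eta>" "\<And>x. 0 \<le> \<eta> x" "\<And>x. \<eta> x \<le> 1" "open W" "?K \<subseteq> W" "\<And>x. x \<in> W \<Longrightarrow> \<eta> x = 1"
        using cutoff_exists[OF K(1) U(1,2)] by metis
      have \<eta>\<Omega>: "test_fun \<Omega> \<eta>" using test_fun_mono[OF \<eta>(1) U(3)] .
      have le: "\<phi> x \<le> \<eta> x" for x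
        using \<eta>(2,6)[of x] \<eta>(5) \<phi>(3)[of x] in_fun_support[of \<phi> x] by (cases "\<phi> x = 0") auto
      have "emeasure ?\<nu> ?K \<le> ennreal (L \<eta>)"
      proof (rule emeasure_riesz_le[of _ "W \<inter> \<Omega>"])
        show "open (W \<inter> \<Omega>)" using \<eta>(4) open_\<Omega> by auto
      qed (use \<eta> \<eta>\<Omega> K in auto)
      have "ennreal (LINT x|?\<nu>. \<eta> x) = (\<integral>\<^sup>+x. ennreal (\<eta> x) \<partial>?\<nu>)"
        using int[OF \<eta>\<Omega>] \<eta>(2) by (intro nn_integral_eq_integral[symmetric]) auto
      also have "\<dots> \<le> (\<integral>\<^sup>+x. indicator U x \<partial>?\<nu>)"
      proof (rule nn_integral_mono)
        fix x show "ennreal (\<eta> x) \<le> indicator U x"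
        proof (cases "x \<in> U")
          case False
          then have "\<eta> x = 0" using \<eta>(1) by (intro not_in_fun_support) (auto simp: test_fun_def)
          then show ?thesis by simp
        qed (use \<eta>(3)[of x] in simp)
      qed
      also have "\<dots> = content_open U"
        using U by (simp add: sets_rieszI emeasure_riesz outer_open)
      also have "\<dots> \<le> emeasure ?\<nu> ?K + ennreal e" using U(4) KE by simp
      also have "\<dots> \<le> ennreal (L \<eta>) + ennreal e"
        using \<open>emeasure ?\<nu> ?K \<le> ennreal (L \<eta>)\<close> by (rule add_right_mono)
      also have "\<dots> = ennreal (L \<eta> + e)"
        using nonneg[OF \<eta>\<Omega> \<eta>(2)] \<open>e > 0\<close> by simp
      finally have "(LINT x|?\<nu>. \<eta> x) \<le> L \<eta> + e"
        using nonneg[OF \<eta>\<Omega> \<eta>(2)] \<open>e > 0\<close> by (subst (asm) ennreal_le_iff) auto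
      moreover have "L (\<lambda>x. \<eta> x - \<phi> x) \<le> (LINT x|?\<nu>. \<eta> x - \<phi> x)"
      proof (rule le_riesz_integral[OF test_fun_diff[OF \<eta>\<Omega> \<phi>(1)]])
        fix x
        show "0 \<le> \<eta> x - \<phi> x" "\<eta> x - \<phi> x \<le> 1" using le[of x] \<eta>(3)[of x] \<phi>(2)[of x] by auto
      qed
      ultimately show "(LINT x|?\<nu>. \<phi> x) \<le> L \<phi> + e"
        using int[OF \<eta>\<Omega>] int[OF \<phi>(1)] diff[OF \<eta>\<Omega> \<phi>(1)] by (simp add: Bochner_Integration.integral_diff)
    qed
  qed
  obtain B where B: "\<And>x. \<bar>\<phi> x\<bar> \<le> B" using test_fun_bounded assms by blast
  obtain \<eta> W where \<eta>: "test_fun \<Omega> \<eta>" "\<And>x. 0 \<le> \<eta> x" "\<And>x. \<eta> x \<le> 1" "fun_support \<phi> \<subseteq> W" "\<And>x. x \<in> W \<Longrightarrow> \<eta> x = 1"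
    using cutoff_exists[of "fun_support \<phi>" \<Omega>] assms open_\<Omega> by (auto simp: test_fun_def) metis
  define b where "b = B + 1"
  have "B \<ge> 0" using B[of 0] by linarith
  then have "b > 0" by (simp add: b_def)
  \<comment> \<open>An affine change brings \<open>\<phi>\<close> into the range from 0 to 1: it is
    recovered as \<open>2 b \<psi> - b \<eta>\<close>, and both functions on the right fall under
    \<open>unit\<close>.\<close>
  define \<psi> where "\<psi> x = 1 / (2 * b) * (\<phi> x + b * \<eta> x)" for x
  have \<psi>: "test_fun \<Omega> \<psi>" unfolding \<psi>_def by (intro test_fun_cmult test_fun_add assms \<eta>(1))
  have range: "0 \<le> \<psi> x \<and> \<psi> x \<le> 1" for x
  proof (cases "\<phi> x = 0")
    case True
    then show ?thesis using \<eta>(2,3)[of x] \<open>b > 0\<close> by (simp add: \<psi>_def)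
  next
    case False
    then have "\<eta> x = 1" using in_fun_support[of \<phi> x] \<eta>(4,5) by blast
    then show ?thesis using B[of x] \<open>b > 0\<close> by (auto simp: \<psi>_def b_def field_simps abs_le_iff)
  qed
  have eq: "\<phi> = (\<lambda>x. 2 * b * \<psi> x - b * \<eta> x)"
    using \<open>b > 0\<close> by (auto simp: \<psi>_def fun_eq_iff field_simps)
  have "L \<phi> = 2 * b * L \<psi> - b * L \<eta>"
    by (subst eq, subst diff) (simp_all add: \<psi> \<eta>(1) scale test_fun_cmult)
  also have "\<dots> = 2 * b * (LINT x|?\<nu>. \<psi> x) - b * (LINT x|?\<nu>. \<eta> x)"
    using unit[OF \<psi>] range unit[OF \<eta>(1-3)] by simp
  also have "\<dots> = (LINT x|?\<nu>. \<phi> x)"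
    by (subst eq, subst Bochner_Integration.integral_diff) (simp_all add: int[OF \<psi>] int[OF \<eta>(1)])
  finally show ?thesis .
qed

end

section \<open>Polar decomposition of a difference of positive functionals\<close>

lemma (in positive_functional) sigma_finite_riesz: "sigma_finite_measure riesz_measure"
proof
  obtain C :: "nat \<Rightarrow> (real^'n) set" where C: "\<And>n. compact (C n)" "\<And>n. C n \<subseteq> \<Omega>" "\<Union>(range C) = \<Omega>"
    using open_Union_compact_subsets[OF open_\<Omega>] by metis
  show "\<exists>A. countable A \<and> A \<subseteq> sets riesz_measure \<and> \<Union>A = space riesz_measure \<and>
      (\<forall>a\<in>A. emeasure riesz_measure a \<noteq> \<infinity>)"
  proof (intro exI[of _ "range C"] conjI ballI)
    show "\<Union>(range C) = space riesz_measure" using C(3) by (simp add: space_riesz)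
    show "range C \<subseteq> sets riesz_measure" using sets_rieszI[OF borel_compact[OF C(1)] C(2)] by blast
    show "emeasure riesz_measure a \<noteq> \<infinity>" if "a \<in> range C" for a
      using that riesz_compact_finite[OF C(1,2)] by (auto simp: less_top[symmetric])
  qed simp
qed

text \<open>Both Riesz measures have densities with respect to their sum, so \<open>S\<close> has a
  signed density \<open>g\<close> whose sign and absolute value give \<open>h\<close> and
  \<open>\<mu>\<close>. As \<open>\<bar>g\<bar>\<close> is at most the sum of the two densities,
  finiteness of integrals for \<open>P\<close> and \<open>N\<close> passes to the total variation of
  \<open>S\<close>.\<close>

lemma polar_decomposition_difference:
  fixes P N :: "'n::finite functional"
  assumes P: "positive_functional \<Omega> P" and N: "positive_functional \<Omega> N"
    and S: "\<And>\<phi>. test_fun \<Omega> \<phi> \<Longrightarrow> S \<phi> = P \<phi> - N \<phi>"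
  obtains \<mu> h where "polar_decomposition \<Omega> S \<mu> h"
    "\<And>F. F \<in> borel_measurable (restrict_space borel \<Omega>) \<Longrightarrow>
       (\<integral>\<^sup>+x. F x \<partial>\<mu>) \<le> (\<integral>\<^sup>+x. F x \<partial>positive_functional.riesz_measure \<Omega> P) +
         (\<integral>\<^sup>+x. F x \<partial>positive_functional.riesz_measure \<Omega> N)"
proof -
  interpret P: positive_functional \<Omega> P by fact
  interpret N: positive_functional \<Omega> N by fact
  let ?R = "restrict_space borel \<Omega>"
  let ?p = P.riesz_measure and ?n = N.riesz_measure
  define \<sigma> where "\<sigma> = measure_of \<Omega> (sets ?R) (\<lambda>A. emeasure ?p A + emeasure ?n A)"
  have sets: "sets \<sigma> = sets ?R"
    unfolding \<sigma>_def using sigma_algebra.sets_measure_of_eq[OF P.sigma_algebra_restrict] by simp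
  have em: "emeasure \<sigma> A = emeasure ?p A + emeasure ?n A" if "A \<in> sets ?R" for A
    unfolding \<sigma>_def
  proof (rule emeasure_measure_of_sigma[OF P.sigma_algebra_restrict _ _ that])
    show "positive (sets ?R) (\<lambda>A. emeasure ?p A + emeasure ?n A)"
      by (simp add: positive_def)
    show "countably_additive (sets ?R) (\<lambda>A. emeasure ?p A + emeasure ?n A)"
      unfolding countably_additive_def
      using P.sets_riesz N.sets_riesz
      by (auto simp: suminf_add[symmetric] suminf_emeasure)
  qed
  have space: "space \<sigma> = \<Omega>"
    using sets_eq_imp_space_eq[OF sets] by (simp add: space_restrict_space)
  have meas: "f \<in> borel_measurable \<sigma>" if "f \<in> borel_measurable ?R" for f :: "real^'n \<Rightarrow> 'b::topological_space"
    using that measurable_cong_sets[OF sets refl] by blast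
  obtain C :: "nat \<Rightarrow> (real^'n) set" where C: "\<And>n. compact (C n)" "\<And>n. C n \<subseteq> \<Omega>" "\<Union>(range C) = \<Omega>"
    using open_Union_compact_subsets[OF P.open_\<Omega>] by metis
  have setsI: "A \<in> sets ?R" if "compact A" "A \<subseteq> \<Omega>" for A
    using P.sets_rieszI[OF borel_compact[OF that(1)] that(2)] by (simp add: P.sets_riesz)
  have fin: "emeasure \<sigma> A < \<infinity>" if "compact A" "A \<subseteq> \<Omega>" for A
    using em[OF setsI[OF that]] P.riesz_compact_finite[OF that] N.riesz_compact_finite[OF that] by simp
  interpret \<sigma>: sigma_finite_measure \<sigma>
  proof
    show "\<exists>A. countable A \<and> A \<subseteq> sets \<sigma> \<and> \<Union>A = space \<sigma> \<and> (\<forall>a\<in>A. emeasure \<sigma> a \<noteq> \<infinity>)"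
    proof (intro exI[of _ "range C"] conjI ballI)
      show "\<Union>(range C) = space \<sigma>" using C(3) by (simp add: space)
      show "range C \<subseteq> sets \<sigma>" using setsI[OF C(1,2)] by (auto simp: sets)
      show "emeasure \<sigma> a \<noteq> \<infinity>" if "a \<in> range C" for a
        using that fin[OF C(1,2)] by (auto simp: less_top[symmetric])
    qed simp
  qed
  have ac: "absolutely_continuous \<sigma> ?p" "absolutely_continuous \<sigma> ?n"
    using em by (auto simp: absolutely_continuous_def null_sets_def sets P.sets_riesz N.sets_riesz)
  have dens: "\<exists>g. g \<in> borel_measurable \<sigma> \<and> (\<forall>x. 0 \<le> g x) \<and> density \<sigma> (\<lambda>x. ennreal (g x)) = M"
    if "absolutely_continuous \<sigma> M" "sets M = sets \<sigma>" "sigma_finite_measure M" for M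
  proof (intro exI conjI allI)
    let ?g = "\<lambda>x. enn2real (RN_deriv \<sigma> M x)"
    show "?g \<in> borel_measurable \<sigma>" by measurable
    show "0 \<le> ?g x" for x by simp
    have "density \<sigma> (\<lambda>x. ennreal (?g x)) = density \<sigma> (RN_deriv \<sigma> M)"
      using \<sigma>.RN_deriv_finite[OF that(3,1,2)]
      by (intro density_cong) (auto elim!: eventually_mono simp: less_top)
    also have "\<dots> = M" by (rule \<sigma>.density_RN_deriv[OF that(1,2)])
    finally show "density \<sigma> (\<lambda>x. ennreal (?g x)) = M" .
  qed
  obtain g1 where g1: "g1 \<in> borel_measurable \<sigma>" "\<And>x. 0 \<le> g1 x" "density \<sigma> (\<lambda>x. ennreal (g1 x)) = ?p"
    using dens[OF ac(1) _ P.sigma_finite_riesz] by (auto simp: sets P.sets_riesz)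
  obtain g2 where g2: "g2 \<in> borel_measurable \<sigma>" "\<And>x. 0 \<le> g2 x" "density \<sigma> (\<lambda>x. ennreal (g2 x)) = ?n"
    using dens[OF ac(2) _ N.sigma_finite_riesz] by (auto simp: sets N.sets_riesz)
  define g where "g x = g1 x - g2 x" for x
  define \<mu> where "\<mu> = density \<sigma> (\<lambda>x. ennreal \<bar>g x\<bar>)"
  \<comment> \<open>The value 1 where \<open>g\<close> vanishes makes
    \<open>\<bar>h\<bar> = 1\<close> hold everywhere, as the definition demands;
    \<open>\<mu>\<close> does not charge that set.\<close>
  define h :: "real^'n \<Rightarrow> real" where "h x = (if g x < 0 then -1 else 1)" for x
  have [measurable]: "g1 \<in> borel_measurable \<sigma>" "g2 \<in> borel_measurable \<sigma>" by fact+
  have g_meas [measurable]: "g \<in> borel_measurable \<sigma>" unfolding g_def by measurable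
  have le: "(\<integral>\<^sup>+x. F x \<partial>\<mu>) \<le> (\<integral>\<^sup>+x. F x \<partial>?p) + (\<integral>\<^sup>+x. F x \<partial>?n)"
    if F: "F \<in> borel_measurable ?R" for F
  proof -
    have [measurable]: "F \<in> borel_measurable \<sigma>" using meas[OF F] .
    have "(\<integral>\<^sup>+x. F x \<partial>\<mu>) = (\<integral>\<^sup>+x. ennreal \<bar>g x\<bar> * F x \<partial>\<sigma>)"
      unfolding \<mu>_def by (rule nn_integral_density) measurable
    also have "\<dots> \<le> (\<integral>\<^sup>+x. ennreal (g1 x) * F x + ennreal (g2 x) * F x \<partial>\<sigma>)"
    proof (rule nn_integral_mono)
      fix x
      have "ennreal \<bar>g x\<bar> \<le> ennreal (g1 x) + ennreal (g2 x)"
        using g1(2)[of x] g2(2)[of x] by (auto simp: g_def simp flip: ennreal_plus intro!: ennreal_leI)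
      then show "ennreal \<bar>g x\<bar> * F x \<le> ennreal (g1 x) * F x + ennreal (g2 x) * F x"
        by (metis distrib_right mult_right_mono zero_le)
    qed
    also have "\<dots> = (\<integral>\<^sup>+x. ennreal (g1 x) * F x \<partial>\<sigma>) + (\<integral>\<^sup>+x. ennreal (g2 x) * F x \<partial>\<sigma>)"
      by (rule nn_integral_add) measurable
    also have "\<dots> = (\<integral>\<^sup>+x. F x \<partial>?p) + (\<integral>\<^sup>+x. F x \<partial>?n)"
      unfolding g1(3)[symmetric] g2(3)[symmetric] by (subst (1 2) nn_integral_density) measurable
    finally show ?thesis .
  qed
  have "polar_decomposition \<Omega> S \<mu> h"
    unfolding polar_decomposition_def
  proof (intro conjI allI impI ballI)
    show "sets \<mu> = sets ?R" by (simp add: \<mu>_def sets)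
    show "emeasure \<mu> K < \<infinity>" if "compact K" "K \<subseteq> \<Omega>" for K
    proof -
      have K: "K \<in> sets ?R" using setsI that by blast
      have "emeasure \<mu> K = (\<integral>\<^sup>+x. indicator K x \<partial>\<mu>)"
        using K by (simp add: \<mu>_def sets)
      also have "\<dots> \<le> (\<integral>\<^sup>+x. indicator K x \<partial>?p) + (\<integral>\<^sup>+x. indicator K x \<partial>?n)"
        using K by (intro le) simp
      also have "\<dots> = emeasure ?p K + emeasure ?n K"
        using K by (simp add: P.sets_riesz N.sets_riesz)
      also have "\<dots> < \<infinity>" using P.riesz_compact_finite[OF that] N.riesz_compact_finite[OF that] by simp
      finally show ?thesis .
    qed
    show "h \<in> borel_measurable \<mu>" unfolding h_def \<mu>_def by measurable
    show "\<bar>h x\<bar> = 1" for x by (simp add: h_def)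
    fix \<phi> assume \<phi>: "test_fun \<Omega> \<phi>"
    have [measurable]: "\<phi> \<in> borel_measurable \<sigma>"
      using \<phi> by (intro meas measurable_restrict_space1 smooth_borel_measurable test_fun_smooth)
    have i1: "integrable \<sigma> (\<lambda>x. g1 x * \<phi> x)"
      using P.test_fun_integrable_riesz[OF \<phi>] g1 integrable_density[of \<phi> \<sigma> g1] by simp
    have i2: "integrable \<sigma> (\<lambda>x. g2 x * \<phi> x)"
      using N.test_fun_integrable_riesz[OF \<phi>] g2 integrable_density[of \<phi> \<sigma> g2] by simp
    have "S \<phi> = (LINT x|?p. \<phi> x) - (LINT x|?n. \<phi> x)"
      using S[OF \<phi>] P.riesz_representation[OF \<phi>] N.riesz_representation[OF \<phi>] by simp
    also have "(LINT x|?p. \<phi> x) = (LINT x|\<sigma>. g1 x * \<phi> x)"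
      unfolding g1(3)[symmetric] using g1(2) by (subst integral_density) auto
    also have "(LINT x|?n. \<phi> x) = (LINT x|\<sigma>. g2 x * \<phi> x)"
      unfolding g2(3)[symmetric] using g2(2) by (subst integral_density) auto
    also have "(LINT x|\<sigma>. g1 x * \<phi> x) - (LINT x|\<sigma>. g2 x * \<phi> x) = (LINT x|\<sigma>. \<bar>g x\<bar> *\<^sub>R (\<phi> x * h x))"
      unfolding Bochner_Integration.integral_diff[OF i1 i2, symmetric]
      by (intro Bochner_Integration.integral_cong) (auto simp: g_def h_def algebra_simps)
    also have "\<dots> = (LINT x|\<mu>. \<phi> x * h x)"
      unfolding \<mu>_def by (rule integral_density[symmetric]) (auto simp: h_def)
    finally show "S \<phi> = (LINT x|\<mu>. \<phi> x * h x)" .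
  qed
  from that[OF this le] show ?thesis .
qed

section \<open>Local integrability of subharmonic functions\<close>

lemma subharmonic_open_less:
  assumes "open \<Omega>" "subharmonic_on \<Omega> u"
  shows "open {x \<in> \<Omega>. u x < c}"
  using assms unfolding subharmonic_on_def by (metis openin_open_trans)

lemma subharmonic_measurable:
  assumes "open \<Omega>" "subharmonic_on \<Omega> u"
  shows "u \<in> borel_measurable (restrict_space borel \<Omega>)"
proof (rule borel_measurableI_less)
  fix c
  have "{x \<in> \<Omega>. u x < c} \<in> sets borel" by (rule borel_open[OF subharmonic_open_less[OF assms]])
  then show "{x \<in> space (restrict_space borel \<Omega>). u x < c} \<in> sets (restrict_space borel \<Omega>)"
    using assms(1) by (subst sets_restrict_space_iff) (auto simp: space_restrict_space)
qed

lemma subharmonic_bounded_above: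
  fixes \<Omega> :: "'a::euclidean_space set"
  assumes "open \<Omega>" "subharmonic_on \<Omega> u" "compact K" "K \<subseteq> \<Omega>"
  obtains M :: real where "M \<ge> 0" "\<And>x. x \<in> K \<Longrightarrow> u x \<le> ereal M"
proof -
  have "K \<subseteq> (\<Union>n::nat. {x \<in> \<Omega>. u x < ereal n})"
  proof
    fix x assume "x \<in> K"
    then have "x \<in> \<Omega>" "u x \<noteq> \<infinity>" using assms by (auto simp: subharmonic_on_def)
    then obtain n :: nat where "u x < ereal n"
      by (cases "u x") (use reals_Archimedean2 in auto)
    with \<open>x \<in> \<Omega>\<close> show "x \<in> (\<Union>n::nat. {x \<in> \<Omega>. u x < ereal n})" by auto
  qed
  then obtain I where I: "finite I" "K \<subseteq> (\<Union>n\<in>I. {x \<in> \<Omega>. u x < ereal (real n)})"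
    using compactE_image[OF assms(3), of UNIV "\<lambda>n. {x \<in> \<Omega>. u x < ereal (real n)}"]
      subharmonic_open_less[OF assms(1,2)] by auto
  show ?thesis
  proof (rule that[of "real (Max (insert 0 I))"])
    fix x assume "x \<in> K"
    then obtain n where "n \<in> I" "u x < ereal (real n)" using I by auto
    moreover have "real n \<le> real (Max (insert 0 I))" using \<open>n \<in> I\<close> I(1) by simp
    ultimately show "u x \<le> ereal (real (Max (insert 0 I)))"
      by (meson ereal_less_eq(3) less_imp_le order_trans)
  qed simp
qed

lemma subharmonic_measurable_on:
  fixes \<Omega> :: "'a::euclidean_space set" and f :: "ereal \<Rightarrow> ennreal"
  assumes "open \<Omega>" "subharmonic_on \<Omega> u" "K \<in> sets borel" "K \<subseteq> \<Omega>" "f \<in> borel_measurable borel"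
  shows "(\<lambda>x. f (u x) * indicator K x) \<in> borel_measurable borel"
proof -
  have "(\<lambda>x. f (u x)) \<in> borel_measurable (restrict_space borel \<Omega>)"
    by (rule measurable_compose[OF subharmonic_measurable[OF assms(1,2)] assms(5)])
  then have "(\<lambda>x. f (u x) * indicator \<Omega> x) \<in> borel_measurable borel"
    using assms(1) by (simp add: borel_measurable_restrict_space_iff_ennreal)
  then have "(\<lambda>x. f (u x) * indicator \<Omega> x * indicator K x) \<in> borel_measurable borel"
    using assms(3) by measurable
  moreover have "(\<lambda>x. f (u x) * indicator \<Omega> x * indicator K x) = (\<lambda>x. f (u x) * indicator K x)"
    using assms(4) by (auto simp: indicator_def fun_eq_iff)
  ultimately show ?thesis by simp
qed

lemma subharmonic_nn_integral_pos:
  fixes \<Omega> :: "'a::euclidean_space set"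
  assumes "open \<Omega>" "subharmonic_on \<Omega> u" "compact K" "K \<subseteq> \<Omega>"
  shows "(\<integral>\<^sup>+x\<in>K. e2ennreal (u x) \<partial>lborel) < \<infinity>"
proof -
  obtain M :: real where M: "M \<ge> 0" "\<And>x. x \<in> K \<Longrightarrow> u x \<le> ereal M"
    using subharmonic_bounded_above[OF assms] by blast
  have "(\<integral>\<^sup>+x\<in>K. e2ennreal (u x) \<partial>lborel) \<le> (\<integral>\<^sup>+x. ennreal M * indicator K x \<partial>lborel)"
  proof (rule nn_integral_mono)
    fix x show "e2ennreal (u x) * indicator K x \<le> ennreal M * indicator K x"
      using e2ennreal_mono[OF M(2), of x] by (auto simp: indicator_def)
  qed
  also have "\<dots> = ennreal M * emeasure lborel K"
    using assms(3) by (intro nn_integral_cmult_indicator) (auto intro: borel_compact)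
  also have "\<dots> < \<infinity>"
    using emeasure_compact_finite[OF assms(3)] by (simp add: ennreal_mult_less_top)
  finally show ?thesis .
qed

text \<open>The positive part has a finite integral, so an infinite negative part would make the
  mean \<open>-\<infinity>\<close>, against the mean value inequality at the centre.\<close>

lemma subharmonic_nn_integral_neg_cball:
  fixes \<Omega> :: "'a::euclidean_space set"
  assumes "open \<Omega>" "subharmonic_on \<Omega> u" "u a \<noteq> -\<infinity>" "r > 0" "cball a r \<subseteq> \<Omega>"
  shows "(\<integral>\<^sup>+x\<in>cball a r. e2ennreal (- u x) \<partial>lborel) < \<infinity>"
proof (rule ccontr)
  assume "\<not> ?thesis"
  then have inf: "(\<integral>\<^sup>+x\<in>cball a r. e2ennreal (- u x) \<partial>lborel) = \<infinity>" by (simp add: less_top[symmetric])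
  have "(\<integral>\<^sup>+x\<in>cball a r. e2ennreal (u x) \<partial>lborel) < \<infinity>"
    by (rule subharmonic_nn_integral_pos[OF assms(1,2) compact_cball assms(5)])
  then obtain p where p: "p \<ge> 0" "(\<integral>\<^sup>+x\<in>cball a r. e2ennreal (u x) \<partial>lborel) = ennreal p"
    by (cases "\<integral>\<^sup>+x\<in>cball a r. e2ennreal (u x) \<partial>lborel") auto
  have "measure lborel (cball a r) > 0" using content_cball_pos[OF assms(4)] by simp
  then have "ball_mean u a r = -\<infinity>"
    unfolding ball_mean_def inf p(2) using p(1) by (simp add: divide_ereal_def)
  moreover have "u a \<le> ball_mean u a r" using assms by (auto simp: subharmonic_on_def)
  ultimately show False using assms(3) by simp
qed

lemma subharmonic_finite_point:
  fixes \<Omega> :: "'a::euclidean_space set"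
  assumes "r > 0" "(\<integral>\<^sup>+x\<in>cball a r. e2ennreal (- u x) \<partial>lborel) < \<infinity>"
  obtains z where "z \<in> cball a r" "u z \<noteq> -\<infinity>"
proof (rule ccontr)
  assume "\<not> thesis"
  with that have "u z = -\<infinity>" if "z \<in> cball a r" for z using that by blast
  then have "(\<integral>\<^sup>+x\<in>cball a r. e2ennreal (- u x) \<partial>lborel) = (\<integral>\<^sup>+x. \<infinity> * indicator (cball a r) x \<partial>lborel)"
    by (intro nn_integral_cong) (auto simp: indicator_def)
  also have "\<dots> = \<infinity> * emeasure lborel (cball a r)"
    by (rule nn_integral_cmult_indicator) auto
  also have "\<dots> = \<infinity>"
    using content_cball_pos[OF assms(1), of a] by (auto simp: measure_def ennreal_top_mult)
  finally show False using assms(2) by simp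
qed

text \<open>The points having a ball over which the negative part is integrable form a set
  \<open>G\<close> that is open, nonempty and relatively closed; connectedness makes it all of
  \<open>\<Omega>\<close>, and finitely many balls cover \<open>K\<close>.\<close>

lemma subharmonic_nn_integral_neg:
  fixes \<Omega> :: "'a::euclidean_space set"
  assumes \<Omega>: "open \<Omega>" "connected \<Omega>" and u: "subharmonic_on \<Omega> u" and K: "compact K" "K \<subseteq> \<Omega>"
  shows "(\<integral>\<^sup>+x\<in>K. e2ennreal (- u x) \<partial>lborel) < \<infinity>"
proof -
  define N where "N A = (\<integral>\<^sup>+x\<in>A. e2ennreal (- u x) \<partial>lborel)" for A
  define G where "G = {x \<in> \<Omega>. \<exists>r>0. cball x r \<subseteq> \<Omega> \<and> N (cball x r) < \<infinity>}"
  have N_mono: "N A \<le> N B" if "A \<subseteq> B" for A B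
    unfolding N_def using that by (intro nn_integral_mono) (auto simp: indicator_def)
  \<comment> \<open>Integrability near \<open>y\<close> yields a point \<open>z\<close> with
    \<open>u z \<noteq> -\<infinity>\<close> at distance at most \<open>r\<close> from
    \<open>x\<close>. The ball of radius \<open>2 * r\<close> about \<open>z\<close> lies in
    \<open>\<Omega>\<close> and contains \<open>cball x r\<close>, so the mean value inequality at
    \<open>z\<close> carries integrability over to \<open>x\<close>.\<close>
  have nearby: "x \<in> G" if "r > 0" "cball x (3 * r) \<subseteq> \<Omega>" "y \<in> G" "dist x y < r" for x y r
  proof -
    obtain s where s: "s > 0" "N (cball y s) < \<infinity>" using \<open>y \<in> G\<close> by (auto simp: G_def)
    define t where "t = min s (r - dist x y)"
    have "t > 0" using s that by (simp add: t_def)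
    moreover have "N (cball y t) < \<infinity>"
      by (rule le_less_trans[OF N_mono s(2)]) (auto simp: t_def)
    ultimately obtain z where z: "z \<in> cball y t" "u z \<noteq> -\<infinity>"
      unfolding N_def by (rule subharmonic_finite_point)
    have xz: "dist x z \<le> r" using dist_triangle[of x z y] z(1) by (auto simp: t_def)
    have sub: "cball z (2 * r) \<subseteq> cball x (3 * r)"
    proof
      fix w assume "w \<in> cball z (2 * r)"
      then show "w \<in> cball x (3 * r)" using xz dist_triangle[of x w z] by auto
    qed
    have sub': "cball x r \<subseteq> cball z (2 * r)"
    proof
      fix w assume "w \<in> cball x r"
      then show "w \<in> cball z (2 * r)" using xz dist_triangle[of z w x] by (auto simp: dist_commute)
    qed
    have "N (cball z (2 * r)) < \<infinity>"
      unfolding N_def using sub that z(2) by (intro subharmonic_nn_integral_neg_cball[OF \<Omega>(1) u]) auto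
    then have "N (cball x r) < \<infinity>" using N_mono[OF sub'] by (rule le_less_trans[rotated])
    moreover have "cball x r \<subseteq> cball x (3 * r)" using \<open>r > 0\<close> by (intro subset_cball) auto
    moreover have "x \<in> cball x (3 * r)" using \<open>r > 0\<close> by simp
    ultimately show "x \<in> G" using that by (auto simp: G_def)
  qed
  have radius: "\<exists>r>0. cball x (3 * r) \<subseteq> \<Omega>" if "x \<in> \<Omega>" for x
  proof -
    obtain e where "e > 0" "cball x e \<subseteq> \<Omega>"
      using \<open>x \<in> \<Omega>\<close> \<Omega>(1) unfolding open_contains_cball by metis
    then show ?thesis by (intro exI[of _ "e / 3"]) auto
  qed
  have "open G"
    unfolding open_contains_ball
  proof
    fix x assume "x \<in> G"
    then obtain r where r: "r > 0" "cball x r \<subseteq> \<Omega>" "N (cball x r) < \<infinity>" by (auto simp: G_def)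
    show "\<exists>e>0. ball x e \<subseteq> G"
    proof (intro exI conjI subsetI)
      show "r / 2 > 0" using r by simp
      fix y assume y: "y \<in> ball x (r / 2)"
      have "cball y (r / 2) \<subseteq> cball x r"
      proof
        fix w assume "w \<in> cball y (r / 2)"
        then show "w \<in> cball x r" using y dist_triangle[of x w y] by auto
      qed
      moreover from this have "N (cball y (r / 2)) < \<infinity>" using N_mono r(3) by (meson le_less_trans)
      moreover have "y \<in> \<Omega>" using y r by auto
      ultimately show "y \<in> G" using r by (auto simp: G_def intro!: exI[of _ "r / 2"])
    qed
  qed
  moreover have "open (\<Omega> - G)"
    unfolding open_contains_ball
  proof
    fix x assume x: "x \<in> \<Omega> - G"
    then obtain r where r: "r > 0" "cball x (3 * r) \<subseteq> \<Omega>" using radius by auto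
    show "\<exists>e>0. ball x e \<subseteq> \<Omega> - G"
    proof (intro exI conjI subsetI)
      fix y assume y: "y \<in> ball x r"
      then have "y \<in> cball x (3 * r)" using r(1) by auto
      moreover have "y \<notin> G" using nearby[OF r, of y] x y by auto
      ultimately show "y \<in> \<Omega> - G" using r(2) by blast
    qed (use r in auto)
  qed
  moreover have "G \<noteq> {}"
  proof -
    obtain a where a: "a \<in> \<Omega>" "u a \<noteq> -\<infinity>" using u by (auto simp: subharmonic_on_def)
    obtain r where r: "r > 0" "cball a r \<subseteq> \<Omega>"
      using a(1) \<Omega>(1) unfolding open_contains_cball by metis
    then have "N (cball a r) < \<infinity>"
      unfolding N_def using a by (intro subharmonic_nn_integral_neg_cball[OF \<Omega>(1) u])
    then show ?thesis using a r by (auto simp: G_def)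
  qed
  moreover have "G \<subseteq> \<Omega>" by (auto simp: G_def)
  ultimately have "G = \<Omega>"
    using connectedD[OF \<Omega>(2), of G "\<Omega> - G"] by blast
  then have "\<forall>x\<in>K. \<exists>r. r > 0 \<and> cball x r \<subseteq> \<Omega> \<and> N (cball x r) < \<infinity>" using K(2) by (auto simp: G_def)
  then obtain r where r: "\<And>x. x \<in> K \<Longrightarrow> r x > 0 \<and> cball x (r x) \<subseteq> \<Omega> \<and> N (cball x (r x)) < \<infinity>" by metis
  have "K \<subseteq> (\<Union>x\<in>K. ball x (r x))"
    using r by (intro subsetI UN_I) (auto dest: conjunct1)
  then obtain I where I: "I \<subseteq> K" "finite I" "K \<subseteq> (\<Union>x\<in>I. ball x (r x))"
    by (rule compactE_image[OF K(1) open_ball])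
  have m: "(\<lambda>x. e2ennreal (- u x) * indicator (cball a (r a)) x) \<in> borel_measurable borel" if "a \<in> I" for a
    using r I(1) that by (intro subharmonic_measurable_on[OF \<Omega>(1) u, where f = "\<lambda>y. e2ennreal (- y)"]) auto
  have "N K \<le> (\<integral>\<^sup>+x. (\<Sum>a\<in>I. e2ennreal (- u x) * indicator (cball a (r a)) x) \<partial>lborel)"
    unfolding N_def
  proof (rule nn_integral_mono)
    fix x
    show "e2ennreal (- u x) * indicator K x \<le> (\<Sum>a\<in>I. e2ennreal (- u x) * indicator (cball a (r a)) x)"
    proof (cases "x \<in> K")
      case True
      then obtain a where "a \<in> I" "x \<in> cball a (r a)" using I(3) by (auto intro: less_imp_le)
      then have "e2ennreal (- u x) * indicator K x \<le> (\<Sum>a\<in>{a}. e2ennreal (- u x) * indicator (cball a (r a)) x)"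
        using True by simp
      also have "\<dots> \<le> (\<Sum>a\<in>I. e2ennreal (- u x) * indicator (cball a (r a)) x)"
        using I(2) \<open>a \<in> I\<close> by (intro sum_mono2) auto
      finally show ?thesis .
    qed simp
  qed
  also have "\<dots> = (\<Sum>a\<in>I. N (cball a (r a)))"
    unfolding N_def using m by (intro nn_integral_sum) auto
  also have "\<dots> < \<infinity>" using I r by (auto simp: less_top)
  finally show ?thesis unfolding N_def .
qed

lemma subharmonic_finite_AE:
  fixes \<Omega> :: "'a::euclidean_space set"
  assumes \<Omega>: "open \<Omega>" "connected \<Omega>" and u: "subharmonic_on \<Omega> u" and K: "compact K" "K \<subseteq> \<Omega>"
  shows "AE x in lborel. x \<in> K \<longrightarrow> u x \<noteq> -\<infinity>"
proof -
  have "(\<lambda>x. e2ennreal (- u x) * indicator K x) \<in> borel_measurable lborel"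
    using subharmonic_measurable_on[OF \<Omega>(1) u borel_compact[OF K(1)] K(2), of "\<lambda>y. e2ennreal (- y)"] by simp
  then have "AE x in lborel. e2ennreal (- u x) * indicator K x \<noteq> \<infinity>"
    using subharmonic_nn_integral_neg[OF assms] by (intro nn_integral_noteq_infinite) auto
  then show ?thesis by eventually_elim auto
qed

lemma subharmonic_locally_integrable:
  fixes \<Omega> :: "'a::euclidean_space set"
  assumes \<Omega>: "open \<Omega>" "connected \<Omega>" and u: "subharmonic_on \<Omega> u" and K: "compact K" "K \<subseteq> \<Omega>"
  shows "integrable lborel (\<lambda>x. indicator K x * real_of_ereal (u x))"
proof -
  have NK: "(\<integral>\<^sup>+x\<in>K. e2ennreal (- u x) \<partial>lborel) < \<infinity>"
    by (rule subharmonic_nn_integral_neg[OF assms])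
  have PK: "(\<integral>\<^sup>+x\<in>K. e2ennreal (u x) \<partial>lborel) < \<infinity>"
    by (rule subharmonic_nn_integral_pos[OF \<Omega>(1) u K])
  show ?thesis
  proof (rule integrableI_bounded)
    have "(\<lambda>x. real_of_ereal (u x)) \<in> borel_measurable (restrict_space borel \<Omega>)"
      using subharmonic_measurable[OF \<Omega>(1) u] by measurable
    then have "(\<lambda>x. indicator \<Omega> x *\<^sub>R real_of_ereal (u x)) \<in> borel_measurable borel"
      using \<Omega>(1) by (simp add: borel_measurable_restrict_space_iff)
    then have "(\<lambda>x. indicator K x * (indicator \<Omega> x *\<^sub>R real_of_ereal (u x))) \<in> borel_measurable borel"
      using borel_compact[OF K(1)] by measurable
    moreover have "(\<lambda>x. indicator K x * (indicator \<Omega> x *\<^sub>R real_of_ereal (u x))) = (\<lambda>x. indicator K x * real_of_ereal (u x))"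
      using K(2) by (auto simp: indicator_def fun_eq_iff)
    ultimately show "(\<lambda>x. indicator K x * real_of_ereal (u x)) \<in> borel_measurable lborel" by simp
    have "(\<integral>\<^sup>+x. ennreal (norm (indicator K x * real_of_ereal (u x))) \<partial>lborel) \<le>
        (\<integral>\<^sup>+x. e2ennreal (u x) * indicator K x + e2ennreal (- u x) * indicator K x \<partial>lborel)"
    proof (rule nn_integral_mono)
      fix x
      have "ennreal \<bar>real_of_ereal (u x)\<bar> \<le> e2ennreal (u x) + e2ennreal (- u x)"
        by (cases "u x") (auto simp: abs_if ennreal_neg)
      then show "ennreal (norm (indicator K x * real_of_ereal (u x))) \<le>
          e2ennreal (u x) * indicator K x + e2ennreal (- u x) * indicator K x"
        by (auto simp: indicator_def)
    qed
    also have "\<dots> = (\<integral>\<^sup>+x\<in>K. e2ennreal (u x) \<partial>lborel) + (\<integral>\<^sup>+x\<in>K. e2ennreal (- u x) \<partial>lborel)"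
      using subharmonic_measurable_on[OF \<Omega>(1) u borel_compact[OF K(1)] K(2), of e2ennreal]
        subharmonic_measurable_on[OF \<Omega>(1) u borel_compact[OF K(1)] K(2), of "\<lambda>y. e2ennreal (- y)"]
      by (intro nn_integral_add) auto
    also have "\<dots> < \<infinity>" using NK PK by simp
    finally show "(\<integral>\<^sup>+x. ennreal (norm (indicator K x * real_of_ereal (u x))) \<partial>lborel) < \<infinity>" .
  qed
qed

section \<open>Currents evaluated on test functions\<close>

lemma current_even_form:
  assumes "current p \<Omega> R" "test_fun \<Omega> \<phi>"
  shows "even_form (\<lambda>K L. R K L \<phi>)"
  using assms unfolding even_form_def current_def by (metis prod.inject)

lemma current_homogeneous: "current p \<Omega> R \<Longrightarrow> test_fun \<Omega> \<phi> \<Longrightarrow> homogeneous R \<phi>"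
  unfolding homogeneous_def current_def distribution_def by blast

lemma current_add:
  "current p \<Omega> R \<Longrightarrow> test_fun \<Omega> \<phi> \<Longrightarrow> test_fun \<Omega> \<psi> \<Longrightarrow> R K L (\<lambda>x. \<phi> x + \<psi> x) = R K L \<phi> + R K L \<psi>"
  unfolding current_def distribution_def by blast

lemma current_eq_0:
  "current p \<Omega> R \<Longrightarrow> test_fun \<Omega> \<phi> \<Longrightarrow> card K \<noteq> CARD('n) - p \<or> card L \<noteq> CARD('n) - p \<Longrightarrow>
    (R :: 'n::finite supercurrent) K L \<phi> = 0"
  unfolding current_def by auto

lemma current_at_add:
  assumes "current p \<Omega> R" "test_fun \<Omega> \<phi>" "test_fun \<Omega> \<psi>"
  shows "current_at R (\<lambda>x. \<phi> x + \<psi> x) = current_at R \<phi> + current_at R \<psi>"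
  using current_even_form[OF assms(1,2)] current_even_form[OF assms(1,3)]
    current_add[OF assms]
  by (simp add: current_at_def plus_even_form.abs_eq eq_onp_def)

lemma current_at_cmult:
  assumes "current p \<Omega> R" "test_fun \<Omega> \<phi>"
  shows "current_at R (\<lambda>x. c * \<phi> x) = scale c (current_at R \<phi>)"
  using current_even_form[OF assms] current_homogeneous[OF assms]
  by (simp add: current_at_def homogeneous_def scale.abs_eq eq_onp_def)

section \<open>Symmetric constant forms\<close>

definition symmetric_form :: "'n::{finite,linorder} even_form \<Rightarrow> bool" where
  "symmetric_form a \<longleftrightarrow> (\<forall>K L. coeff_of a K L = coeff_of a L K)"

text \<open>On bidegrees \<open>(k, k)\<close> the wedge sign is unchanged when \<open>dx\<close>
  and \<open>d\<xi>\<close> are exchanged. This symmetry later turns closedness under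
  \<open>d\<close> into closedness under \<open>d\<^sup>#\<close>.\<close>

lemma symmetric_form_mult:
  assumes "symmetric_form a" "symmetric_form b"
  shows "symmetric_form (a * b)"
  unfolding symmetric_form_def
proof (intro allI)
  fix K L
  have *: "wedge_sign K' L' K'' L'' * coeff_of a K' L' * coeff_of b K'' L'' =
      wedge_sign L' K' L'' K'' * coeff_of a L' K' * coeff_of b L'' K''" for K' L' K'' L''
  proof (cases "card K' = card L' \<and> card K'' = card L''")
    case True
    then show ?thesis
      using assms wedge_sign_swap[of K' L' K'' L''] by (simp add: symmetric_form_def)
  next
    case False
    then show ?thesis using even_form_coeff_of[of a] even_form_coeff_of[of b] unfolding even_form_def by auto
  qed
  have "coeff_of (a * b) K L = (\<Sum>K'\<in>Pow K. \<Sum>L'\<in>Pow L.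
      wedge_sign L' K' (L - L') (K - K') * coeff_of a L' K' * coeff_of b (L - L') (K - K'))"
    unfolding times_even_form.rep_eq cwedge_def by (intro sum.cong refl *)
  also have "\<dots> = coeff_of (a * b) L K"
    unfolding times_even_form.rep_eq cwedge_def by (rule sum.swap)
  finally show "coeff_of (a * b) K L = coeff_of (a * b) L K" .
qed

lemma symmetric_form_beta: "symmetric_form beta"
  by (auto simp: symmetric_form_def beta.rep_eq)

lemma symmetric_form_power: "symmetric_form a \<Longrightarrow> symmetric_form (a ^ k)"
proof (induction k)
  case 0
  then show ?case by (auto simp: symmetric_form_def one_even_form.rep_eq unit_form_def)
qed (simp add: symmetric_form_mult)

section \<open>Coefficients of a positive current\<close>

text \<open>
  Positivity of \<open>S\<close> on \<open>\<alpha> \<and> J \<alpha>\<close>, where \<open>\<alpha> = g \<Sum>\<^sub>K \<plusminus>d\<^sub>K dx\<^sub>-\<^sub>K\<close> with shuffle signs, is nonnegativity of this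
  functional on \<open>g\<^sup>2\<close>.
\<close>

definition quadratic_functional ::
    "nat \<Rightarrow> 'n::{finite,linorder} supercurrent \<Rightarrow> ('n set \<Rightarrow> real) \<Rightarrow> 'n functional" where
  "quadratic_functional q S d \<phi> = sgn_sigma (CARD('n) - q) * (\<Sum>K\<in>UNIV. \<Sum>L\<in>UNIV. d K * d L * S K L \<phi>)"

lemma form_wedge_J:
  assumes "\<And>K L x. L \<noteq> {} \<Longrightarrow> \<alpha> K L x = 0"
  shows "form_wedge \<alpha> (form_J \<alpha>) K L x = \<alpha> K {} x * \<alpha> L {} x"
proof -
  have "form_wedge \<alpha> (form_J \<alpha>) K L x =
      (\<Sum>K'\<in>Pow K. \<Sum>L'\<in>Pow L. if L' = {} then if K' = K then \<alpha> K {} x * \<alpha> L {} x else 0 else 0)"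
    unfolding form_wedge_def form_J_def
    by (intro sum.cong refl) (use assms in \<open>auto simp: wedge_sign_def\<close>)
  then show ?thesis by simp
qed

lemma quadratic_functional_square:
  fixes S :: "'n::{finite,linorder} supercurrent"
  assumes S: "positive_current q \<Omega> S" and d: "\<And>K. card K \<noteq> CARD('n) - q \<Longrightarrow> d K = 0"
    and g: "test_fun \<Omega> g"
  shows "quadratic_functional q S d (\<lambda>x. g x * g x) \<ge> 0"
proof -
  let ?n = "CARD('n)"
  have cur: "current q \<Omega> S" and q: "q \<le> ?n" using S by (auto simp: positive_current_def current_def)
  define \<alpha> :: "'n form" where
    "\<alpha> A B x = (if B = {} then d (-A) * shuffle_sign (-A) A * g x else 0)" for A B x
  have card_Compl: "card (-A) = ?n - card A" for A :: "'n set"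
    by (simp add: Compl_eq_Diff_UNIV card_Diff_subset)
  have card_le: "card A \<le> ?n" for A :: "'n set" by (intro card_mono) auto
  have "form_test \<Omega> \<alpha>"
    unfolding form_test_def
  proof (intro allI)
    fix K L
    show "test_fun \<Omega> (\<alpha> K L)"
      by (cases "L = {}") (auto simp: \<alpha>_def[abs_def] intro: test_fun_cmult g)
  qed
  moreover have "form_bidegree \<Omega> q 0 \<alpha>"
    unfolding form_bidegree_def
  proof (intro allI impI ballI)
    fix K L :: "'n set" and x assume *: "(card K, card L) \<noteq> (q, 0)"
    show "\<alpha> K L x = 0"
    proof (cases "L = {}")
      case True
      with * have "card K \<noteq> q" by simp
      then have "card (-K) \<noteq> ?n - q" using card_Compl[of K] card_le[of K] q by simp
      then show ?thesis using d by (simp add: \<alpha>_def)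
    qed (simp add: \<alpha>_def)
  qed
  ultimately have pos: "current_pairing S (form_scale (sgn_sigma q) (form_wedge \<alpha> (form_J \<alpha>))) \<ge> 0"
    using S by (auto simp: positive_current_def)
  have hom: "S K L (\<lambda>x. c * (g x * g x)) = c * S K L (\<lambda>x. g x * g x)" for K L c
    using current_homogeneous[OF cur test_fun_mult_left[OF g test_fun_smooth[OF g]]] by (simp add: homogeneous_def)
  have W: "form_wedge \<alpha> (form_J \<alpha>) K L x = \<alpha> K {} x * \<alpha> L {} x" for K L x
    by (rule form_wedge_J) (simp add: \<alpha>_def)
  have sq: "(-1::real) ^ k * (-1) ^ k = 1" for k by (simp flip: power_mult_distrib)
  have "current_pairing S (form_scale (sgn_sigma q) (form_wedge \<alpha> (form_J \<alpha>))) =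
      sgn_sigma ?n * (\<Sum>K\<in>UNIV. \<Sum>L\<in>UNIV. wedge_sign K L (-K) (-L) *
        S K L (\<lambda>x. (sgn_sigma q * (d K * shuffle_sign K (-K)) * (d L * shuffle_sign L (-L))) * (g x * g x)))"
    unfolding current_pairing_def current_top_def current_wedge_def form_scale_def W
    by (simp add: \<alpha>_def Compl_eq_Diff_UNIV[symmetric] mult_ac)
  also have "\<dots> = sgn_sigma ?n * (\<Sum>K\<in>UNIV. \<Sum>L\<in>UNIV.
      sgn_sigma ?n * sgn_sigma (?n - q) * (d K * d L * S K L (\<lambda>x. g x * g x)))"
  proof (intro arg_cong[where f = "\<lambda>s. sgn_sigma ?n * s"] sum.cong refl)
    fix K L :: "'n set"
    show "wedge_sign K L (-K) (-L) *
        S K L (\<lambda>x. (sgn_sigma q * (d K * shuffle_sign K (-K)) * (d L * shuffle_sign L (-L))) * (g x * g x)) =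
        sgn_sigma ?n * sgn_sigma (?n - q) * (d K * d L * S K L (\<lambda>x. g x * g x))"
    proof (cases "card K = ?n - q \<and> card L = ?n - q")
      case True
      let ?s = "(-1::real) ^ ((?n - q) * q)"
      have w: "wedge_sign K L (-K) (-L) = ?s * shuffle_sign K (-K) * shuffle_sign L (-L)"
        using True q by (simp add: wedge_sign_def card_Compl)
      have n: "sgn_sigma ?n = ?s * sgn_sigma (?n - q) * sgn_sigma q"
        using sgn_sigma_add[of "?n - q" q] q by simp
      \<comment> \<open>The shuffle signs built into \<open>\<alpha>\<close> cancel those of the
        wedge product, and the leftover sign is
        \<open>\<sigma>\<^sub>n \<sigma>\<^sub>n\<^sub>-\<^sub>q\<close>.\<close>
      have "wedge_sign K L (-K) (-L) * (sgn_sigma q * (d K * shuffle_sign K (-K)) * (d L * shuffle_sign L (-L))) =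
          (shuffle_sign K (-K) * shuffle_sign K (-K)) * (shuffle_sign L (-L) * shuffle_sign L (-L)) *
          (?s * sgn_sigma q) * (d K * d L)"
        unfolding w by (simp only: mult_ac)
      also have "\<dots> = ?s * sgn_sigma q * (d K * d L)" by simp
      also have "?s * sgn_sigma q = sgn_sigma ?n * sgn_sigma (?n - q)"
        unfolding n using sgn_sigma_square[of "?n - q"] by (simp add: mult_ac)
      finally show ?thesis unfolding hom by (simp add: mult.assoc[symmetric])
    next
      case False
      then have "d K = 0 \<or> d L = 0" using d by auto
      then show ?thesis unfolding hom by auto
    qed
  qed
  also have "\<dots> = (sgn_sigma ?n * sgn_sigma ?n) * quadratic_functional q S d (\<lambda>x. g x * g x)"
    unfolding quadratic_functional_def sum_distrib_left by (intro sum.cong refl) (simp only: mult_ac)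
  finally show ?thesis using pos by simp
qed

lemma quadratic_functional_add:
  assumes "current q \<Omega> S" "test_fun \<Omega> \<phi>" "test_fun \<Omega> \<psi>"
  shows "quadratic_functional q S d (\<lambda>x. \<phi> x + \<psi> x) = quadratic_functional q S d \<phi> + quadratic_functional q S d \<psi>"
  by (simp add: quadratic_functional_def current_add[OF assms] distrib_left sum.distrib)

lemma quadratic_functional_cmult:
  assumes "current q \<Omega> S" "test_fun \<Omega> \<phi>"
  shows "quadratic_functional q S d (\<lambda>x. c * \<phi> x) = c * quadratic_functional q S d \<phi>"
  using current_homogeneous[OF assms]
  by (simp add: quadratic_functional_def homogeneous_def sum_distrib_left mult_ac)

text \<open>A nonnegative test function need not be the square of a smooth function, but
  \<open>\<phi> + e\<close> has a smooth root. Squaring \<open>\<eta> sqrt(\<phi> + e)\<close> gives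
  \<open>\<phi> + e \<eta>\<^sup>2\<close> when \<open>\<eta> = 1\<close> on the support of
  \<open>\<phi>\<close>, and \<open>e\<close> tends to 0.\<close>

lemma quadratic_functional_positive:
  fixes S :: "'n::{finite,linorder} supercurrent"
  assumes S: "positive_current q \<Omega> S" and d: "\<And>K. card K \<noteq> CARD('n) - q \<Longrightarrow> d K = 0" and \<Omega>: "open \<Omega>"
  shows "positive_functional \<Omega> (quadratic_functional q S d)"
proof
  have cur: "current q \<Omega> S" using S by (auto simp: positive_current_def)
  let ?Q = "quadratic_functional q S d"
  show "open \<Omega>" by fact
  show "?Q (\<lambda>x. \<phi> x + \<psi> x) = ?Q \<phi> + ?Q \<psi>" if "test_fun \<Omega> \<phi>" "test_fun \<Omega> \<psi>" for \<phi> \<psi>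
    by (rule quadratic_functional_add[OF cur that])
  show cm: "?Q (\<lambda>x. c * \<phi> x) = c * ?Q \<phi>" if "test_fun \<Omega> \<phi>" for c \<phi>
    by (rule quadratic_functional_cmult[OF cur that])
  fix \<phi> assume \<phi>: "test_fun \<Omega> \<phi>" and nn: "\<And>x. 0 \<le> \<phi> x"
  have "compact (fun_support \<phi>)" "fun_support \<phi> \<subseteq> \<Omega>" using \<phi> by (auto simp: test_fun_def)
  then obtain \<eta> W where \<eta>: "test_fun \<Omega> \<eta>" "fun_support \<phi> \<subseteq> W" "\<And>x. x \<in> W \<Longrightarrow> \<eta> x = 1"
    using cutoff_exists[of "fun_support \<phi>" \<Omega>] \<Omega> by metis
  have \<eta>2: "test_fun \<Omega> (\<lambda>x. \<eta> x * \<eta> x)" using \<eta>(1) test_fun_smooth by (intro test_fun_mult_left)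
  have "- ?Q \<phi> \<le> e * ?Q (\<lambda>x. \<eta> x * \<eta> x)" if "e > 0" for e
  proof -
    have "smooth_on UNIV (\<lambda>x. sqrt (\<phi> x + e))"
      using nn that by (intro smooth_sqrt smooth_add test_fun_smooth[OF \<phi>] smooth_const add_nonneg_pos)
    then have "test_fun \<Omega> (\<lambda>x. \<eta> x * sqrt (\<phi> x + e))" by (rule test_fun_mult_right[OF \<eta>(1)])
    from quadratic_functional_square[OF S d this]
    have "0 \<le> ?Q (\<lambda>x. \<eta> x * sqrt (\<phi> x + e) * (\<eta> x * sqrt (\<phi> x + e)))" .
    also have "(\<lambda>x. \<eta> x * sqrt (\<phi> x + e) * (\<eta> x * sqrt (\<phi> x + e))) = (\<lambda>x. \<phi> x + e * (\<eta> x * \<eta> x))"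
    proof
      fix x
      have "sqrt (\<phi> x + e) * sqrt (\<phi> x + e) = \<phi> x + e" using nn[of x] that by simp
      then have "\<eta> x * sqrt (\<phi> x + e) * (\<eta> x * sqrt (\<phi> x + e)) = \<eta> x * \<eta> x * (\<phi> x + e)"
        by (metis mult.assoc mult.commute)
      moreover have "\<eta> x * \<eta> x * \<phi> x = \<phi> x"
        using \<eta>(2,3) in_fun_support[of \<phi> x] by (cases "\<phi> x = 0") auto
      ultimately show "\<eta> x * sqrt (\<phi> x + e) * (\<eta> x * sqrt (\<phi> x + e)) = \<phi> x + e * (\<eta> x * \<eta> x)"
        by (simp add: algebra_simps)
    qed
    also have "?Q \<dots> = ?Q \<phi> + e * ?Q (\<lambda>x. \<eta> x * \<eta> x)"
      by (simp add: quadratic_functional_add[OF cur \<phi> test_fun_cmult[OF \<eta>2]] cm[OF \<eta>2])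
    finally show ?thesis by simp
  qed
  then have *: "- ?Q \<phi> \<le> e * ?Q (\<lambda>x. \<eta> x * \<eta> x)" if "e > 0" for e using that by blast
  have "((\<lambda>e. e * ?Q (\<lambda>x. \<eta> x * \<eta> x)) \<longlongrightarrow> 0 * ?Q (\<lambda>x. \<eta> x * \<eta> x)) (at_right 0)"
    by (intro tendsto_intros)
  moreover have "\<forall>\<^sub>F e in at_right 0. - ?Q \<phi> \<le> e * ?Q (\<lambda>x. \<eta> x * \<eta> x)"
    using * by (auto simp: eventually_at_right_field intro!: exI[of _ 1])
  ultimately have "- ?Q \<phi> \<le> 0 * ?Q (\<lambda>x. \<eta> x * \<eta> x)"
    by (intro tendsto_lowerbound) auto
  then show "0 \<le> ?Q \<phi>" by simp
qed

section \<open>The trace dominates all coefficients\<close>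

definition trace_functional :: "nat \<Rightarrow> 'n::{finite,linorder} supercurrent \<Rightarrow> 'n functional" where
  "trace_functional q S \<phi> = (\<Sum>K | card K = CARD('n) - q. sgn_sigma (CARD('n) - q) * S K K \<phi>)"

lemma quadratic_functional_single:
  "quadratic_functional q S (\<lambda>K. if K = I then 1 else 0) \<phi> =
    sgn_sigma (CARD('n) - q) * (S :: 'n::{finite,linorder} supercurrent) I I \<phi>"
proof -
  have "(\<Sum>K\<in>UNIV. \<Sum>L\<in>UNIV. (if K = I then 1 else 0) * (if L = I then 1 else 0) * S K L \<phi>) =
      (\<Sum>K\<in>UNIV. \<Sum>L\<in>UNIV. if L = I then if K = I then S I I \<phi> else 0 else 0)"
    by (intro sum.cong) auto
  then show ?thesis by (simp add: quadratic_functional_def)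
qed

lemma quadratic_functional_pair:
  fixes S :: "'n::{finite,linorder} supercurrent" and c :: real
  assumes "S I J \<phi> = S J I \<phi>"
  shows "quadratic_functional q S (\<lambda>K. (if K = I then 1 else 0) + c * (if K = J then 1 else 0)) \<phi> =
    sgn_sigma (CARD('n) - q) * (S I I \<phi> + 2 * c * S I J \<phi> + c * c * S J J \<phi>)"
proof -
  let ?e = "\<lambda>I K. if K = I then 1 else (0::real)"
  have *: "(\<Sum>K\<in>UNIV. \<Sum>L\<in>UNIV. ?e A K * ?e B L * S K L \<phi>) = S A B \<phi>" for A B
  proof -
    have "(\<Sum>K\<in>UNIV. \<Sum>L\<in>UNIV. ?e A K * ?e B L * S K L \<phi>) =
        (\<Sum>K\<in>UNIV. \<Sum>L\<in>UNIV. if L = B then if K = A then S A B \<phi> else 0 else 0)"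
      by (intro sum.cong) auto
    then show ?thesis by simp
  qed
  have "(\<Sum>K\<in>UNIV. \<Sum>L\<in>UNIV. (?e I K + c * ?e J K) * (?e I L + c * ?e J L) * S K L \<phi>) =
      (\<Sum>K\<in>UNIV. \<Sum>L\<in>UNIV. ?e I K * ?e I L * S K L \<phi>) + c * (\<Sum>K\<in>UNIV. \<Sum>L\<in>UNIV. ?e I K * ?e J L * S K L \<phi>) +
      c * (\<Sum>K\<in>UNIV. \<Sum>L\<in>UNIV. ?e J K * ?e I L * S K L \<phi>) + c * c * (\<Sum>K\<in>UNIV. \<Sum>L\<in>UNIV. ?e J K * ?e J L * S K L \<phi>)"
    unfolding sum_distrib_left sum.distrib[symmetric]
    by (intro sum.cong refl) (simp only: distrib_left distrib_right mult_ac add_ac)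
  then show ?thesis unfolding quadratic_functional_def * using assms by (simp add: algebra_simps)
qed

lemma positive_functional_cmult:
  "positive_functional \<Omega> P \<Longrightarrow> 0 \<le> c \<Longrightarrow> positive_functional \<Omega> (\<lambda>\<phi>. c * P \<phi>)"
  unfolding positive_functional_def by (auto simp: algebra_simps)

text \<open>Polarisation: \<open>4 S I J\<close> is the difference of the quadratic functionals for
  \<open>e\<^sub>I + e\<^sub>J\<close> and \<open>e\<^sub>I - e\<^sub>J\<close>, up to the sign
  \<open>\<sigma>\<^sub>n\<^sub>-\<^sub>q\<close>. By the parallelogram law their sum is twice the
  sum of two signed diagonal coefficients, each at most the trace.\<close>

lemma positive_current_coefficient:
  fixes S :: "'n::{finite,linorder} supercurrent"
  assumes S: "positive_current q \<Omega> S" and \<Omega>: "open \<Omega>"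
  obtains P N where "positive_functional \<Omega> P" "positive_functional \<Omega> N"
    "\<And>\<phi>. test_fun \<Omega> \<phi> \<Longrightarrow> S I J \<phi> = P \<phi> - N \<phi>"
    "\<And>\<phi>. test_fun \<Omega> \<phi> \<Longrightarrow> (\<And>x. 0 \<le> \<phi> x) \<Longrightarrow> P \<phi> \<le> trace_functional q S \<phi> \<and> N \<phi> \<le> trace_functional q S \<phi>"
proof -
  let ?n = "CARD('n)" and ?\<tau> = "trace_functional q S"
  have cur: "current q \<Omega> S" and sym: "current_symmetric \<Omega> S" using S by (auto simp: positive_current_def)
  have diag: "0 \<le> sgn_sigma (?n - q) * S K K \<phi>"
    if "test_fun \<Omega> \<phi>" "\<And>x. 0 \<le> \<phi> x" "card K = ?n - q" for K \<phi>
  proof -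
    have "positive_functional \<Omega> (quadratic_functional q S (\<lambda>L. if L = K then 1 else 0))"
      by (rule quadratic_functional_positive[OF S _ \<Omega>]) (use that in auto)
    from positive_functional.nonneg[OF this that(1,2)] show ?thesis
      by (simp add: quadratic_functional_single)
  qed
  have le_trace: "sgn_sigma (?n - q) * S K K \<phi> \<le> ?\<tau> \<phi>"
    if "test_fun \<Omega> \<phi>" "\<And>x. 0 \<le> \<phi> x" "card K = ?n - q" for K \<phi>
    unfolding trace_functional_def
    using that by (intro member_le_sum[of K _ "\<lambda>K. sgn_sigma (?n - q) * S K K \<phi>"] diag) auto
  show ?thesis
  proof (cases "card I = ?n - q \<and> card J = ?n - q")
    case False
    have "positive_functional \<Omega> (\<lambda>_. 0)" using \<Omega> by unfold_locales auto
    moreover have "0 \<le> ?\<tau> \<phi>" if "test_fun \<Omega> \<phi>" "\<And>x. 0 \<le> \<phi> x" for \<phi>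
      unfolding trace_functional_def using that by (intro sum_nonneg diag) auto
    ultimately show ?thesis
      using False current_eq_0[OF cur] by (intro that[of "\<lambda>_. 0" "\<lambda>_. 0"]) auto
  next
    case True
    define Q where "Q c = quadratic_functional q S (\<lambda>K. (if K = I then 1 else 0) + c * (if K = J then 1 else 0))" for c
    have Qpos: "positive_functional \<Omega> (\<lambda>\<phi>. 1 / 4 * Q c \<phi>)" for c
      unfolding Q_def
      by (intro positive_functional_cmult quadratic_functional_positive[OF S _ \<Omega>]) (use True in auto)
    have Q: "Q c \<phi> = sgn_sigma (?n - q) * (S I I \<phi> + 2 * c * S I J \<phi> + c * c * S J J \<phi>)" if "test_fun \<Omega> \<phi>" for c \<phi>
      unfolding Q_def by (rule quadratic_functional_pair) (use sym that in \<open>auto simp: current_symmetric_def\<close>)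
    have bound: "1 / 4 * Q c \<phi> \<le> ?\<tau> \<phi>" if "test_fun \<Omega> \<phi>" "\<And>x. 0 \<le> \<phi> x" "c = 1 \<or> c = -1" for c \<phi>
    proof -
      have "0 \<le> 1 / 4 * Q (- c) \<phi>" by (rule positive_functional.nonneg[OF Qpos that(1,2)])
      then have "Q c \<phi> \<le> Q c \<phi> + Q (- c) \<phi>" by simp
      also have "\<dots> = 2 * (sgn_sigma (?n - q) * S I I \<phi>) + 2 * (sgn_sigma (?n - q) * S J J \<phi>)"
        using that(3) by (auto simp: Q[OF that(1)] algebra_simps)
      also have "\<dots> \<le> 2 * ?\<tau> \<phi> + 2 * ?\<tau> \<phi>"
        using True le_trace[OF that(1,2)] by (intro add_mono mult_left_mono) auto
      finally show ?thesis by simp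
    qed
    \<comment> \<open>The quadratic functional carries this sign while \<open>S I J\<close> does
      not; choosing \<open>c = ?s\<close> and \<open>c = - ?s\<close> puts the difference in the
      right order.\<close>
    let ?s = "sgn_sigma (?n - q)"
    have "?s * ?s = 1" by simp
    then have s: "?s = 1 \<or> ?s = -1" using square_eq_1_iff by blast
    show ?thesis
    proof (rule that[of "\<lambda>\<phi>. 1 / 4 * Q ?s \<phi>" "\<lambda>\<phi>. 1 / 4 * Q (- ?s) \<phi>"])
      show "S I J \<phi> = 1 / 4 * Q ?s \<phi> - 1 / 4 * Q (- ?s) \<phi>" if "test_fun \<Omega> \<phi>" for \<phi>
        using s by (auto simp: Q[OF that] algebra_simps)
      show "1 / 4 * Q ?s \<phi> \<le> ?\<tau> \<phi> \<and> 1 / 4 * Q (- ?s) \<phi> \<le> ?\<tau> \<phi>"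
        if "test_fun \<Omega> \<phi>" "\<And>x. 0 \<le> \<phi> x" for \<phi>
        using bound[OF that, of ?s] bound[OF that, of "- ?s"] s by auto
    qed (rule Qpos)+
  qed
qed

lemma positive_current_coefficient_bound:
  fixes S :: "'n::{finite,linorder} supercurrent"
  assumes S: "positive_current q \<Omega> S" and \<Omega>: "open \<Omega>"
    and "test_fun \<Omega> \<phi>" "test_fun \<Omega> \<kappa>" "\<And>x. 0 \<le> \<kappa> x" "\<And>x. \<bar>\<phi> x\<bar> \<le> B * \<kappa> x" "0 \<le> B"
  shows "\<bar>S I J \<phi>\<bar> \<le> 2 * B * trace_functional q S \<kappa>"
proof -
  obtain P N where PN: "positive_functional \<Omega> P" "positive_functional \<Omega> N"
    "\<And>\<phi>. test_fun \<Omega> \<phi> \<Longrightarrow> S I J \<phi> = P \<phi> - N \<phi>"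
    "\<And>\<phi>. test_fun \<Omega> \<phi> \<Longrightarrow> (\<And>x. 0 \<le> \<phi> x) \<Longrightarrow> P \<phi> \<le> trace_functional q S \<phi> \<and> N \<phi> \<le> trace_functional q S \<phi>"
    using positive_current_coefficient[OF S \<Omega>, of I J] by blast
  have "\<bar>L \<phi>\<bar> \<le> B * trace_functional q S \<kappa>"
    if L: "positive_functional \<Omega> L" and "L \<kappa> \<le> trace_functional q S \<kappa>" for L
  proof -
    interpret L: positive_functional \<Omega> L by (rule L)
    have le: "L \<psi> \<le> B * L \<kappa>" if "test_fun \<Omega> \<psi>" "\<And>x. \<psi> x \<le> B * \<kappa> x" for \<psi>
      using L.mono[OF that(1) test_fun_cmult[OF assms(4), of B] that(2)] by (simp add: L.scale[OF assms(4)])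
    have "L \<phi> \<le> B * L \<kappa>" using assms(6) by (intro le assms(3)) (simp add: abs_le_iff)
    moreover have "L (\<lambda>x. -1 * \<phi> x) \<le> B * L \<kappa>"
      using assms(6) by (intro le test_fun_cmult assms(3)) (simp add: abs_le_iff)
    moreover have "B * L \<kappa> \<le> B * trace_functional q S \<kappa>" using that(2) assms(7) by (rule mult_left_mono)
    ultimately show ?thesis by (subst (asm) L.scale[OF assms(3)]) (simp add: abs_le_iff)
  qed
  from this[OF PN(1)] this[OF PN(2)] PN(4)[OF assms(4,5)] show ?thesis
    unfolding PN(3)[OF assms(3)] by (simp add: abs_le_iff)
qed

lemma trace_functional_eq:
  fixes S :: "'n::{finite,linorder} supercurrent"
  assumes "current q \<Omega> S" "test_fun \<Omega> \<phi>"
  shows "top_coeff (current_at S \<phi> * beta ^ q) = fact q * trace_functional q S \<phi>"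
proof -
  have ev: "even_form (\<lambda>K L. S K L \<phi>)" by (rule current_even_form[OF assms])
  have "top_coeff (current_at S \<phi> * beta ^ q) =
      fact q * (\<Sum>K | card K = CARD('n) - q. sgn_sigma (CARD('n) - q) * coeff_of (current_at S \<phi>) K K)"
    using assms by (intro top_coeff_mult_beta_power)
      (auto simp: coeff_of_current_at[of S \<phi>, OF ev] current_eq_0[OF assms] current_def[of q])
  then show ?thesis by (simp add: trace_functional_def coeff_of_current_at[of S \<phi>, OF ev])
qed

section \<open>The coefficient matrix of \<open>T \<and> \<beta>\<^sup>p\<^sup>-\<^sup>1\<close>\<close>

locale m_positive_setting =
  fixes \<Omega> :: "(real^'n::{finite,linorder}) set" and T :: "'n supercurrent" and m p :: nat
  assumes open_\<Omega>: "open \<Omega>"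
    and m1: "1 \<le> m" and mn: "m \<le> CARD('n)" and mp: "CARD('n) + 1 \<le> m + p"
    and m_positive_T: "m_positive_current m p \<Omega> T" and closed_T: "closed_current \<Omega> T"
    and positive_S: "positive_current (m + p - CARD('n)) \<Omega>
           (current_wedge T (form_power form_beta (CARD('n) - m)))"
begin

definition q :: nat where "q = m + p - CARD('n)"

definition S :: "'n supercurrent" where "S = current_wedge T (const_form (beta ^ (CARD('n) - m)))"

text \<open>Written as a fold so that \<open>S' \<and> \<alpha>\<close> is literally the product in
  \<open>m_positive_current\<close> for the list of \<open>q - 1\<close> copies of beta followed by
  \<open>\<alpha>\<close>.\<close>

definition S' :: "'n supercurrent" where
  "S' = foldl current_wedge S (map const_form (replicate (q - 1) beta))"

text \<open>
  As \<open>S' = T \<and> \<beta>\<^sup>p\<^sup>-\<^sup>1\<close> on test functions, \<open>S' \<and> \<alpha>\<close> has the top coefficient \<open>\<Sum>\<^sub>i\<^sub>j A i j (\<alpha>\<^sub>i\<^sub>j \<phi>)\<close>.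
\<close>

definition A :: "'n \<Rightarrow> 'n \<Rightarrow> 'n functional" where
  "A i j \<phi> = sgn_sigma CARD('n) * wedge_sign (-{i}) (-{j}) {i} {j} * S' (-{i}) (-{j}) \<phi>"

abbreviation \<tau> :: "'n functional" where "\<tau> \<equiv> trace_functional q S"

lemma q_pos: "0 < q"
  using mp by (simp add: q_def)

lemma current_T: "current p \<Omega> T"
  using m_positive_T by (simp add: m_positive_current_def)

lemma S_positive: "positive_current q \<Omega> S"
  using positive_S by (simp add: q_def S_def form_power_beta)

lemma current_S: "current q \<Omega> S" and symmetric_S: "current_symmetric \<Omega> S"
  using S_positive by (auto simp: positive_current_def)

lemma current_at_S:
  assumes "test_fun \<Omega> \<phi>"
  shows "current_at S \<phi> = current_at T \<phi> * beta ^ (CARD('n) - m)"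
  unfolding S_def
  by (rule current_at_wedge(1)[OF current_homogeneous[OF current_T assms] current_even_form[OF current_T assms]])

lemma S':
  assumes "test_fun \<Omega> \<phi>"
  shows "current_at S' \<phi> = current_at S \<phi> * beta ^ (q - 1)"
    and "even_form (\<lambda>K L. S' K L \<phi>)" and "homogeneous S' \<phi>"
  using current_at_foldl[of S \<phi> "replicate (q - 1) beta"]
    current_homogeneous[OF current_S assms] current_even_form[OF current_S assms]
  by (simp_all add: S'_def prod_list_replicate)

lemma S'_coeff:
  assumes "test_fun \<Omega> \<phi>"
  shows "S' K L \<phi> = coeff_of (current_at S \<phi> * beta ^ (q - 1)) K L"
  using coeff_of_current_at[of S' \<phi>, OF S'(2)[OF assms]] S'(1)[OF assms] by simp

lemma A_add: "test_fun \<Omega> \<phi> \<Longrightarrow> test_fun \<Omega> \<psi> \<Longrightarrow> A i j (\<lambda>x. \<phi> x + \<psi> x) = A i j \<phi> + A i j \<psi>"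
  by (simp add: A_def S'_coeff test_fun_add current_at_add[OF current_S] distrib_right
      plus_even_form.rep_eq distrib_left)

lemma A_cmult: "test_fun \<Omega> \<phi> \<Longrightarrow> A i j (\<lambda>x. c * \<phi> x) = c * A i j \<phi>"
  by (simp add: A_def S'_coeff test_fun_cmult current_at_cmult[OF current_S] scale.rep_eq)

lemma A_zero [simp]: "A i j (\<lambda>x. 0) = 0"
  using A_cmult[of "\<lambda>x. 0" i j 0] by simp

lemma A_symmetric:
  assumes "test_fun \<Omega> \<phi>"
  shows "A i j \<phi> = A j i \<phi>"
proof -
  have "symmetric_form (current_at S \<phi>)"
    using symmetric_S assms
    by (simp add: symmetric_form_def coeff_of_current_at[of S \<phi>, OF current_even_form[OF current_S assms]]
        current_symmetric_def)
  then have "symmetric_form (current_at S \<phi> * beta ^ (q - 1))"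
    by (intro symmetric_form_mult symmetric_form_power symmetric_form_beta)
  then have "S' (-{i}) (-{j}) \<phi> = S' (-{j}) (-{i}) \<phi>"
    unfolding S'_coeff[OF assms] symmetric_form_def by blast
  moreover have "wedge_sign (-{j}) (-{i}) {j} {i} = wedge_sign (-{i}) (-{j}) {i} {j}"
    by (rule wedge_sign_swap) (simp_all add: Compl_eq_Diff_UNIV card_Diff_subset)
  ultimately show ?thesis by (simp add: A_def)
qed

text \<open>The coefficients of \<open>S'\<close> at \<open>\<phi>\<close> are those of
  \<open>T\<close> at \<open>\<phi>\<close> multiplied by a constant form. Hence \<open>A\<close>
  vanishes on test functions supported off the support of \<open>T\<close>.\<close>

lemma A_local:
  assumes "test_fun \<Omega> \<phi>" "\<And>K L. T K L \<phi> = 0"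
  shows "A i j \<phi> = 0"
proof -
  have "current_at T \<phi> = 0"
    using assms(2) by (simp add: current_at_def zero_even_form_def)
  then have "current_at S \<phi> * beta ^ (q - 1) = 0" by (simp add: current_at_S[OF assms(1)])
  then show ?thesis by (simp add: A_def S'_coeff[OF assms(1)] zero_even_form.rep_eq)
qed

text \<open>Each coefficient of \<open>S'\<close> is a fixed linear combination of coefficients of
  \<open>S\<close>, all dominated by the trace. The constant \<open>c\<close> depends on the indices
  only, not on the test functions.\<close>

lemma A_bound:
  obtains c where "0 \<le> c"
    "\<And>\<phi> \<kappa> B. test_fun \<Omega> \<phi> \<Longrightarrow> test_fun \<Omega> \<kappa> \<Longrightarrow> (\<And>x. 0 \<le> \<kappa> x) \<Longrightarrow> (\<And>x. \<bar>\<phi> x\<bar> \<le> B * \<kappa> x) \<Longrightarrow> 0 \<le> B \<Longrightarrow>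
      \<bar>A i j \<phi>\<bar> \<le> c * (B * \<tau> \<kappa>)"
proof
  let ?K = "-{i}" and ?L = "-{j}"
  let ?w = "\<lambda>K' L'. wedge_sign K' L' (?K - K') (?L - L')"
  let ?b = "\<lambda>K' L'. coeff_of (beta ^ (q - 1) :: 'n even_form) (?K - K') (?L - L')"
  define s where "s = sgn_sigma CARD('n) * wedge_sign ?K ?L {i} {j}"
  define c where "c = \<bar>s\<bar> * (\<Sum>K'\<in>Pow ?K. \<Sum>L'\<in>Pow ?L. \<bar>?w K' L'\<bar> * 2 * \<bar>?b K' L'\<bar>)"
  show "0 \<le> c" unfolding c_def by (intro mult_nonneg_nonneg sum_nonneg) auto
  fix \<phi> \<kappa> B
  assume *: "test_fun \<Omega> \<phi>" "test_fun \<Omega> \<kappa>" "\<And>x. 0 \<le> \<kappa> x" "\<And>x. \<bar>\<phi> x\<bar> \<le> B * \<kappa> x" "0 \<le> B"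
  have "\<bar>S' ?K ?L \<phi>\<bar> = \<bar>\<Sum>K'\<in>Pow ?K. \<Sum>L'\<in>Pow ?L. ?w K' L' * S K' L' \<phi> * ?b K' L'\<bar>"
    by (simp add: S'_coeff[OF *(1)] times_even_form.rep_eq cwedge_def
        coeff_of_current_at[of S \<phi>, OF current_even_form[OF current_S *(1)]])
  also have "\<dots> \<le> (\<Sum>K'\<in>Pow ?K. \<Sum>L'\<in>Pow ?L. \<bar>?w K' L'\<bar> * 2 * \<bar>?b K' L'\<bar> * (B * \<tau> \<kappa>))"
  proof (intro order_trans[OF sum_abs] sum_mono)
    fix K' L'
    have "\<bar>S K' L' \<phi>\<bar> \<le> 2 * B * \<tau> \<kappa>"
      by (rule positive_current_coefficient_bound[OF S_positive open_\<Omega> *])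
    then have "\<bar>?w K' L'\<bar> * \<bar>S K' L' \<phi>\<bar> * \<bar>?b K' L'\<bar> \<le> \<bar>?w K' L'\<bar> * (2 * B * \<tau> \<kappa>) * \<bar>?b K' L'\<bar>"
      by (intro mult_right_mono mult_left_mono) auto
    then show "\<bar>?w K' L' * S K' L' \<phi> * ?b K' L'\<bar> \<le> \<bar>?w K' L'\<bar> * 2 * \<bar>?b K' L'\<bar> * (B * \<tau> \<kappa>)"
      by (simp add: abs_mult mult_ac)
  qed
  finally have "\<bar>S' ?K ?L \<phi>\<bar> \<le> (\<Sum>K'\<in>Pow ?K. \<Sum>L'\<in>Pow ?L. \<bar>?w K' L'\<bar> * 2 * \<bar>?b K' L'\<bar>) * (B * \<tau> \<kappa>)"
    by (simp add: sum_distrib_right)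
  then have "\<bar>s\<bar> * \<bar>S' ?K ?L \<phi>\<bar> \<le> c * (B * \<tau> \<kappa>)"
    unfolding c_def mult.assoc by (rule mult_left_mono) simp
  then show "\<bar>A i j \<phi>\<bar> \<le> c * (B * \<tau> \<kappa>)"
    by (simp add: A_def s_def abs_mult)
qed

text \<open>\<open>S'\<close> is \<open>T\<close> times one constant form, hence closed. The
  coefficient of \<open>dS'\<close> with full \<open>dx\<close> part and \<open>d\<xi>\<close> part
  \<open>-{j}\<close> is the divergence of column \<open>j\<close>, up to a factor that depends on
  \<open>j\<close> alone.\<close>

lemma A_closed:
  assumes \<phi>: "test_fun \<Omega> \<phi>"
  shows "(\<Sum>i\<in>UNIV. A i j (partial i \<phi>)) = 0"
proof -
  let ?c = "beta ^ (CARD('n) - m) * beta ^ (q - 1) :: 'n even_form"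
  let ?k = "sgn_sigma CARD('n) * shuffle_sign (-{j}) {j}"
  have S'_T: "S' K L \<psi> = current_wedge T (const_form ?c) K L \<psi>" if \<psi>: "test_fun \<Omega> \<psi>" for K L \<psi>
  proof -
    note h = current_homogeneous[OF current_T \<psi>] current_even_form[OF current_T \<psi>]
    have "current_at S \<psi> * beta ^ (q - 1) = current_at (current_wedge T (const_form ?c)) \<psi>"
      using current_at_wedge(1)[OF h, of ?c] by (simp add: current_at_S[OF \<psi>] mult.assoc)
    then show ?thesis
      using coeff_of_current_at[of "current_wedge T (const_form ?c)" \<psi>, OF current_at_wedge(2)[OF h]]
      by (simp add: S'_coeff[OF \<psi>])
  qed
  have "current_d (current_wedge T (const_form ?c)) UNIV (-{j}) \<phi> =
      cwedge (\<lambda>K L. current_d T K L \<phi>) (coeff_of ?c) UNIV (-{j})"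
    by (intro current_d_wedge_const_form current_homogeneous[OF current_T] test_fun_partial \<phi>)
  also have "\<dots> = 0"
    using closed_T \<phi> by (simp add: closed_current_def cwedge_def)
  finally have "(\<Sum>i\<in>UNIV. wedge_sign {i} {} (-{i}) (-{j}) * S' (-{i}) (-{j}) (partial i \<phi>)) = 0"
    by (simp add: current_d_def dist_partial_def S'_T[OF test_fun_partial[OF \<phi>]] Compl_eq_Diff_UNIV sum_negf)
  moreover have "A i j (partial i \<phi>) = ?k * (wedge_sign {i} {} (-{i}) (-{j}) * S' (-{i}) (-{j}) (partial i \<phi>))" for i
  proof -
    have "wedge_sign (-{i}) (-{j}) {i} {j} = shuffle_sign (-{j}) {j} * wedge_sign {i} {} (-{i}) (-{j})"
      using shuffle_sign_commute[of "{i}" "-{i}"]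
      by (simp add: wedge_sign_def Compl_eq_Diff_UNIV card_Diff_subset flip: power_mult_distrib)
    then show ?thesis by (simp add: A_def)
  qed
  ultimately show ?thesis by (simp add: sum_distrib_left[symmetric])
qed

lemma A_closed': "test_fun \<Omega> \<phi> \<Longrightarrow> (\<Sum>j\<in>UNIV. A i j (partial j \<phi>)) = 0"
  using A_closed[of \<phi> i] A_symmetric[OF test_fun_partial, of \<phi> i] by simp

text \<open>Divergence-freeness of the rows against \<open>w \<partial>\<^sub>i v\<close> and of the
  columns against \<open>v \<partial>\<^sub>j w\<close> makes both sides equal to minus the same
  mixed first-order sum.\<close>

lemma A_integration_by_parts:
  assumes w: "test_fun \<Omega> w" and v: "smooth_on UNIV v"
  shows "(\<Sum>i\<in>UNIV. \<Sum>j\<in>UNIV. A i j (\<lambda>x. w x * partial j (partial i v) x)) =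
    (\<Sum>i\<in>UNIV. \<Sum>j\<in>UNIV. A i j (\<lambda>x. v x * partial i (partial j w) x))"
proof -
  note d = smooth_differentiable
  have w': "smooth_on UNIV w" using w by (rule test_fun_smooth)
  have t: "test_fun \<Omega> (\<lambda>x. f x * g x)" "test_fun \<Omega> (\<lambda>x. g x * f x)"
    if "test_fun \<Omega> f" "smooth_on UNIV g" for f g
    by (rule test_fun_mult_right[OF that], rule test_fun_mult_left[OF that])
  have 1: "(\<Sum>j\<in>UNIV. A i j (\<lambda>x. w x * partial j (partial i v) x)) =
      - (\<Sum>j\<in>UNIV. A i j (\<lambda>x. partial j w x * partial i v x))" for i
  proof -
    have "0 = (\<Sum>j\<in>UNIV. A i j (partial j (\<lambda>x. w x * partial i v x)))"
      using A_closed'[OF t(1)[OF w smooth_partial[OF v]]] by simp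
    also have "\<dots> = (\<Sum>j\<in>UNIV. A i j (\<lambda>x. partial j w x * partial i v x) + A i j (\<lambda>x. w x * partial j (partial i v) x))"
      by (simp add: partial_mult d[OF w'] d[OF smooth_partial[OF v]] A_add t w test_fun_partial smooth_partial v)
    finally show ?thesis by (simp add: sum.distrib)
  qed
  have 2: "(\<Sum>i\<in>UNIV. A i j (\<lambda>x. v x * partial i (partial j w) x)) =
      - (\<Sum>i\<in>UNIV. A i j (\<lambda>x. partial j w x * partial i v x))" for j
  proof -
    have "0 = (\<Sum>i\<in>UNIV. A i j (partial i (\<lambda>x. v x * partial j w x)))"
      using A_closed[OF t(2)[OF test_fun_partial[OF w] v]] by simp
    also have "\<dots> = (\<Sum>i\<in>UNIV. A i j (\<lambda>x. partial j w x * partial i v x) + A i j (\<lambda>x. v x * partial i (partial j w) x))"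
      by (simp add: partial_mult d[OF v] d[OF smooth_partial[OF w']] A_add t w test_fun_partial smooth_partial v
          mult.commute[of "partial _ v _"])
    finally show ?thesis by (simp add: sum.distrib)
  qed
  have "(\<Sum>i\<in>UNIV. \<Sum>j\<in>UNIV. A i j (\<lambda>x. w x * partial j (partial i v) x)) =
      - (\<Sum>i\<in>UNIV. \<Sum>j\<in>UNIV. A i j (\<lambda>x. partial j w x * partial i v x))"
    by (simp add: 1 sum_negf)
  also have "\<dots> = (\<Sum>j\<in>UNIV. \<Sum>i\<in>UNIV. A i j (\<lambda>x. v x * partial i (partial j w) x))"
    by (subst sum.swap) (simp add: 2 sum_negf)
  also have "\<dots> = (\<Sum>i\<in>UNIV. \<Sum>j\<in>UNIV. A i j (\<lambda>x. v x * partial i (partial j w) x))"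
    by (rule sum.swap)
  finally show ?thesis .
qed

lemma A_pairing:
  assumes "\<And>K L x. card K \<noteq> 1 \<or> card L \<noteq> 1 \<Longrightarrow> \<alpha> K L x = 0"
  shows "current_top (current_wedge S' \<alpha>) \<phi> = (\<Sum>i\<in>UNIV. \<Sum>j\<in>UNIV. A i j (\<lambda>x. \<alpha> {i} {j} x * \<phi> x))"
proof -
  have "S' K L (\<lambda>x. 0) = 0" for K L
    using S'(3)[OF test_fun_zero] unfolding homogeneous_def by (metis mult_zero_left)
  from current_wedge_top_11[of \<alpha> S' \<phi>, OF assms this] show ?thesis
    by (simp add: current_top_def A_def sum_distrib_left mult.assoc)
qed

text \<open>Pairing with beta selects the diagonal, and
  \<open>S' \<and> \<beta> = S \<and> \<beta>\<^sup>q\<close>.\<close>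

lemma A_trace:
  assumes \<phi>: "test_fun \<Omega> \<phi>"
  shows "(\<Sum>i\<in>UNIV. A i i \<phi>) = fact q * \<tau> \<phi>"
proof -
  have eq: "form_beta = (const_form beta :: 'n form)"
    by (intro ext) (simp add: const_form_def beta.rep_eq form_beta_def)
  have "(\<Sum>i\<in>UNIV. A i i \<phi>) = (\<Sum>i\<in>UNIV. \<Sum>j\<in>UNIV. if j = i then A i i \<phi> else 0)"
    by simp
  also have "\<dots> = (\<Sum>i\<in>UNIV. \<Sum>j\<in>UNIV. A i j (\<lambda>x. form_beta {i} {j} x * \<phi> x))"
    by (intro sum.cong refl) (auto simp: form_beta_def)
  also have "\<dots> = current_top (current_wedge S' form_beta) \<phi>"
    by (rule A_pairing[symmetric]) (auto simp: form_beta_def)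
  also have "\<dots> = top_coeff (current_at S' \<phi> * beta)"
    unfolding eq using current_at_wedge[OF S'(3,2)[OF \<phi>]]
    by (simp add: current_top_eq)
  also have "\<dots> = top_coeff (current_at S \<phi> * beta ^ q)"
    using q_pos power_minus_mult[of q "beta :: 'n even_form"] by (simp add: S'(1)[OF \<phi>] mult.assoc)
  also have "\<dots> = fact q * \<tau> \<phi>" by (rule trace_functional_eq[OF current_S \<phi>])
  finally show ?thesis .
qed

lemma \<tau>_nonneg:
  assumes "test_fun \<Omega> \<phi>" "\<And>x. 0 \<le> \<phi> x"
  shows "0 \<le> \<tau> \<phi>"
proof -
  \<comment> \<open>Any pair of indices serves: whatever the coefficient, its positive functional
    \<open>P\<close> lies between 0 and the trace.\<close>
  obtain P where "positive_functional \<Omega> P" "P \<phi> \<le> \<tau> \<phi>"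
    using positive_current_coefficient[OF S_positive open_\<Omega>, of "{}" "{}"] assms by metis
  then show ?thesis using positive_functional.nonneg[of \<Omega> P \<phi>] assms by force
qed

lemma \<tau>_add: "test_fun \<Omega> \<phi> \<Longrightarrow> test_fun \<Omega> \<psi> \<Longrightarrow> \<tau> (\<lambda>x. \<phi> x + \<psi> x) = \<tau> \<phi> + \<tau> \<psi>"
  by (simp add: trace_functional_def current_add[OF current_S] distrib_left sum.distrib)

lemma \<tau>_cmult: "test_fun \<Omega> \<phi> \<Longrightarrow> \<tau> (\<lambda>x. c * \<phi> x) = c * \<tau> \<phi>"
  using current_homogeneous[OF current_S, of \<phi>]
  by (simp add: trace_functional_def homogeneous_def sum_distrib_left mult_ac)

lemma form_beta_m_positive: "form_smooth \<Omega> form_beta \<and> m_positive_form m \<Omega> (form_beta :: 'n form)"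
  unfolding m_positive_form_iff
proof (intro conjI ballI)
  show "form_smooth \<Omega> (form_beta :: 'n form)"
    unfolding form_smooth_def form_beta_def[abs_def] using smooth_const by (auto simp: smooth_on_def)
  show "form_bidegree \<Omega> 1 1 (form_beta :: 'n form)"
    by (auto simp: form_bidegree_def form_beta_def)
  show "form_symmetric \<Omega> (form_beta :: 'n form)"
    by (auto simp: form_symmetric_def form_beta_def)
  show "m_positive m (form_at form_beta x)" for x :: "real^'n::{finite,linorder}"
    by (simp add: form_at_beta m_positive_beta mn)
qed

lemma A_positive:
  assumes "form_smooth \<Omega> \<alpha>" "m_positive_form m \<Omega> \<alpha>"
    and "\<And>K L x. card K \<noteq> 1 \<or> card L \<noteq> 1 \<Longrightarrow> \<alpha> K L x = 0"
    and "test_fun \<Omega> \<phi>" "\<And>x. 0 \<le> \<phi> x"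
  shows "0 \<le> (\<Sum>i\<in>UNIV. \<Sum>j\<in>UNIV. A i j (\<lambda>x. \<alpha> {i} {j} x * \<phi> x))"
proof -
  have eq: "form_beta = (const_form beta :: 'n form)"
    by (intro ext) (simp add: const_form_def beta.rep_eq form_beta_def)
  let ?\<alpha>s = "replicate (q - 1) form_beta @ [\<alpha>]"
  have "length ?\<alpha>s = m + p - CARD('n)" using q_pos by (simp add: q_def)
  moreover have "\<forall>\<alpha>\<in>set ?\<alpha>s. form_smooth \<Omega> \<alpha> \<and> m_positive_form m \<Omega> \<alpha>"
    using form_beta_m_positive assms(1,2) by auto
  ultimately have "current_top_nonneg \<Omega>
      (foldl current_wedge (current_wedge T (form_power form_beta (CARD('n) - m))) ?\<alpha>s)"
    using m_positive_T unfolding m_positive_current_def by blast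
  then have "0 \<le> current_top (current_wedge S' \<alpha>) \<phi>"
    using assms(4,5) by (simp add: current_top_nonneg_def S'_def S_def eq[symmetric] form_power_beta[symmetric])
  then show ?thesis using A_pairing[of \<alpha> \<phi>] assms(3) by simp
qed

end

section \<open>Regularisation of m-convex functions\<close>

abbreviation hessian_current ::
  "(real^'n::{finite,linorder}) set \<Rightarrow> (real^'n::{finite,linorder} \<Rightarrow> ereal) \<Rightarrow> 'n::{finite,linorder} supercurrent" where
  "hessian_current \<Omega> u \<equiv> current_d (current_d_sharp (function_current \<Omega> u))"

lemma hessian_current_eq:
  "hessian_current \<Omega> u {i} {j} \<phi> = (LINT x:\<Omega>|lborel. real_of_ereal (u x) * partial j (partial i \<phi>) x)"
  by (simp add: current_d_def current_d_sharp_def dist_partial_def function_current_def wedge_sign_def)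

text \<open>The forms that test \<open>D\<close> may be built from \<open>D\<close> itself:
  inserting the constant form \<open>\<beta> + s a\<close>, where \<open>a\<close> is
  \<open>D\<close> frozen at \<open>\<phi>\<close>, yields exactly the hypothesis of
  \<open>m_positive_dual\<close>.\<close>

lemma hessian_current_m_positive:
  fixes \<Omega> :: "(real^'n::{finite,linorder}) set"
  assumes m: "1 \<le> m" "m \<le> CARD('n)"
    and D: "m_positive_current m (CARD('n) - 1) \<Omega> D"
    and \<phi>: "test_fun \<Omega> \<phi>" "\<And>x. 0 \<le> \<phi> x"
  shows "m_positive m (current_at D \<phi>)"
proof (rule m_positive_dual[OF m(2)])
  let ?n = "CARD('n)" and ?a = "current_at D \<phi>"
  have cur: "current (?n - 1) \<Omega> D" and sym: "current_symmetric \<Omega> D"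
    using D by (auto simp: m_positive_current_def)
  note h = current_homogeneous[OF cur \<phi>(1)] current_even_form[OF cur \<phi>(1)]
  have n1: "?n - (?n - 1) = 1" using m by linarith
  fix s j assume s: "0 \<le> s" and c: "m_positive m (beta + scale s ?a)" and j: "1 \<le> j" "j \<le> m"
  let ?c = "beta + scale s ?a"
  \<comment> \<open>There are \<open>m - 1\<close> forms to choose; the copies of beta join
    \<open>\<beta>\<^sup>n\<^sup>-\<^sup>m\<close> to give the power \<open>n - j\<close>.\<close>
  let ?as = "replicate (j - 1) ?c @ replicate (m - j) beta"
  have coeff: "coeff_of ?c K L = (if \<exists>i. K = {i} \<and> L = {i} then 1 else 0) + s * D K L \<phi>" for K L
    by (simp add: plus_even_form.rep_eq beta.rep_eq scale.rep_eq coeff_of_current_at[of D \<phi>, OF h(2)])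
  have smooth: "form_smooth \<Omega> (const_form a)" for a :: "'n even_form"
    unfolding form_smooth_def const_form_def[abs_def] using smooth_const by (auto simp: smooth_on_def)
  have c_form: "m_positive_form m \<Omega> (const_form ?c)"
    unfolding m_positive_form_iff
  proof (intro conjI ballI)
    show "form_bidegree \<Omega> 1 1 (const_form ?c)"
      unfolding form_bidegree_def const_form_def coeff
      using current_eq_0[OF cur \<phi>(1)] n1 by auto
    show "form_symmetric \<Omega> (const_form ?c)"
      unfolding form_symmetric_def const_form_def coeff
      using sym \<phi>(1) by (auto simp: current_symmetric_def)
    show "m_positive m (form_at (const_form ?c) x)" for x using c by simp
  qed
  have beta_form: "m_positive_form m \<Omega> (const_form (beta :: 'n even_form))"
    unfolding m_positive_form_iff
    by (auto simp: form_bidegree_def form_symmetric_def const_form_def beta.rep_eq m_positive_beta m)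
  have "length (map const_form ?as) = m + (?n - 1) - ?n" using j m by simp
  moreover have "\<forall>\<alpha>\<in>set (map const_form ?as). form_smooth \<Omega> \<alpha> \<and> m_positive_form m \<Omega> \<alpha>"
    using smooth c_form beta_form by auto
  ultimately have "current_top_nonneg \<Omega>
      (foldl current_wedge (current_wedge D (form_power form_beta (?n - m))) (map const_form ?as))"
    using D unfolding m_positive_current_def by blast
  then have "0 \<le> current_top (foldl current_wedge (current_wedge D (const_form (beta ^ (?n - m)))) (map const_form ?as)) \<phi>"
    using \<phi> by (simp add: current_top_nonneg_def form_power_beta)
  also have "\<dots> = top_coeff (current_at D \<phi> * beta ^ (?n - m) * prod_list ?as)"
    using current_at_foldl[OF current_wedge_const_form(2)[OF h(1)] current_at_wedge(2)[OF h], of "beta ^ (?n - m)" ?as]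
    by (simp only: current_top_eq current_at_wedge(1)[OF h])
  also have "current_at D \<phi> * beta ^ (?n - m) * prod_list ?as = ?a * ?c ^ (j - 1) * (beta ^ (?n - m) * beta ^ (m - j))"
    by (simp add: prod_list_replicate mult_ac)
  also have "beta ^ (?n - m) * beta ^ (m - j) = (beta ^ (?n - j) :: 'n even_form)"
    using j m by (simp flip: power_add)
  finally show "0 \<le> top_coeff (?a * ?c ^ (j - 1) * beta ^ (?n - j))" .
qed

lemma partial_partial_reflect:
  assumes "smooth_on UNIV \<rho>"
  shows "partial j (partial i (\<lambda>y. \<rho> (x - y))) = (\<lambda>y. partial j (partial i \<rho>) (x - y))"
proof -
  note s = smooth_partial[OF assms, of i]
  have "partial j (\<lambda>y. -1 * partial i \<rho> (x - y)) = (\<lambda>y. partial j (partial i \<rho>) (x - y))"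
    by (subst partial_mult) (simp_all add: smooth_differentiable[OF smooth_reflect[OF s]] partial_reflect[OF s])
  then show ?thesis by (simp add: partial_reflect[OF assms])
qed

text \<open>The current \<open>dd\<^sup># u\<close>, frozen at
  \<open>y \<mapsto> \<rho> (x - y)\<close>, has the second derivatives of the regularisation at
  \<open>x\<close> as coefficients. Restricting \<open>u\<close> to \<open>K\<close> makes it
  integrable and changes nothing at \<open>x\<close>, because the mollifier sees only
  \<open>cball x e\<close>.\<close>

lemma hessian_conv_m_positive:
  fixes \<Omega> :: "(real^'n::{finite,linorder}) set"
  assumes m: "1 \<le> m" "m \<le> CARD('n)" and D: "m_positive_current m (CARD('n) - 1) \<Omega> (hessian_current \<Omega> u)"
    and f: "integrable lborel (\<lambda>x. indicator K x * real_of_ereal (u x))" and "K \<subseteq> \<Omega>"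
    and \<rho>: "mollifier e \<rho>" and x: "cball x e \<subseteq> K"
  defines "v \<equiv> conv (\<lambda>x. indicator K x * real_of_ereal (u x)) \<rho>"
  obtains a where "m_positive m a" "\<And>i j. coeff_of a {i} {j} = partial j (partial i v) x"
    "\<And>K L. card K \<noteq> 1 \<or> card L \<noteq> 1 \<Longrightarrow> coeff_of a K L = 0" "symmetric_form a"
proof
  let ?D = "hessian_current \<Omega> u" and ?f = "\<lambda>x. indicator K x * real_of_ereal (u x)" and ?\<phi> = "\<lambda>y. \<rho> (x - y)"
  have t: "test_fun UNIV \<rho>" and nn: "\<And>x. 0 \<le> \<rho> x" and z: "\<And>x. e \<le> norm x \<Longrightarrow> \<rho> x = 0"
    using \<rho> by (auto simp: mollifier_def)
  have cur: "current (CARD('n) - 1) \<Omega> ?D" and sym: "current_symmetric \<Omega> ?D"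
    using D by (auto simp: m_positive_current_def)
  have \<phi>: "test_fun \<Omega> ?\<phi>"
  proof (rule test_funI)
    show "smooth_on UNIV ?\<phi>" by (rule smooth_reflect[OF test_fun_smooth[OF t]])
    show "compact (cball x e)" by simp
    show "cball x e \<subseteq> \<Omega>" using x \<open>K \<subseteq> \<Omega>\<close> by blast
    show "y \<in> cball x e" if "\<rho> (x - y) \<noteq> 0" for y
      using that z[of "x - y"] by (force simp: dist_norm)
  qed
  show "m_positive m (current_at ?D ?\<phi>)"
    by (rule hessian_current_m_positive[OF m D \<phi> nn])
  note coeff = coeff_of_current_at[of ?D ?\<phi>, OF current_even_form[OF cur \<phi>]]
  show "coeff_of (current_at ?D ?\<phi>) {i} {j} = partial j (partial i v) x" for i j
  proof -
    have "fun_support \<rho> \<subseteq> cball 0 e" using z by (intro fun_support_subset) force+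
    have z': "partial j (partial i \<rho>) w = 0" if "e < norm w" for w
    proof (rule not_in_fun_support[of w "partial j (partial i \<rho>)"])
      have "w \<notin> cball 0 e" using that by simp
      then show "w \<notin> fun_support (partial j (partial i \<rho>))"
        using \<open>fun_support \<rho> \<subseteq> cball 0 e\<close> fun_support_partial[of j "partial i \<rho>"] fun_support_partial[of i \<rho>] by blast
    qed
    have "?D {i} {j} ?\<phi> = (LINT y:\<Omega>|lborel. real_of_ereal (u y) * partial j (partial i \<rho>) (x - y))"
      by (simp add: hessian_current_eq partial_partial_reflect[OF test_fun_smooth[OF t]])
    also have "\<dots> = (LINT y|lborel. ?f y * partial j (partial i \<rho>) (x - y))"
      unfolding set_lebesgue_integral_def
    proof (rule Bochner_Integration.integral_cong)
      fix y
      show "indicator \<Omega> y *\<^sub>R (real_of_ereal (u y) * partial j (partial i \<rho>) (x - y)) =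
          ?f y * partial j (partial i \<rho>) (x - y)"
      proof (cases "y \<in> cball x e")
        case True
        then have "y \<in> K" "y \<in> \<Omega>" using x \<open>K \<subseteq> \<Omega>\<close> by auto
        then show ?thesis by simp
      next
        case False
        then show ?thesis using z'[of "x - y"] by (simp add: dist_norm)
      qed
    qed simp
    also have "\<dots> = partial j (partial i v) x"
      unfolding v_def partial_conv[OF f t] partial_conv[OF f test_fun_partial[OF t]] by (simp add: conv_def)
    finally show ?thesis by (simp add: coeff)
  qed
  have "CARD('n) - (CARD('n) - 1) = 1" using m by linarith
  then show "coeff_of (current_at ?D ?\<phi>) K L = 0" if "card K \<noteq> 1 \<or> card L \<noteq> 1" for K L
    using that current_eq_0[OF cur \<phi>] by (simp add: coeff)
  show "symmetric_form (current_at ?D ?\<phi>)"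
    using sym \<phi> by (simp add: symmetric_form_def coeff current_symmetric_def)
qed

section \<open>The mass estimate\<close>

context m_positive_setting
begin

text \<open>The Hessian form of \<open>v\<close> is known to be \<open>m\<close>-positive over
  \<open>U\<close> only, whereas \<open>A_positive\<close> wants a form on all of
  \<open>\<Omega>\<close>. A nonnegative cutoff factor that is 1 on the support of \<open>w\<close>
  keeps it in the cone and does not affect the product with \<open>w\<close>.\<close>

lemma hessian_test_inequality:
  assumes D: "m_positive_current m (CARD('n) - 1) \<Omega> (hessian_current \<Omega> u)"
    and f: "integrable lborel (\<lambda>x. indicator K x * real_of_ereal (u x))" and K: "K \<subseteq> \<Omega>"
    and \<rho>: "mollifier e \<rho>"
    and w: "test_fun U w" "\<And>x. 0 \<le> w x" and U: "open U" "U \<subseteq> \<Omega>" "\<And>x. x \<in> U \<Longrightarrow> cball x e \<subseteq> K"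
  defines "v \<equiv> conv (\<lambda>x. indicator K x * real_of_ereal (u x)) \<rho>"
  shows "0 \<le> (\<Sum>i\<in>UNIV. \<Sum>j\<in>UNIV. A i j (\<lambda>x. v x * partial i (partial j w) x))"
proof -
  have w\<Omega>: "test_fun \<Omega> w" by (rule test_fun_mono[OF w(1) U(2)])
  have v: "smooth_on UNIV v"
    unfolding v_def using \<rho> by (intro smooth_conv[OF f]) (simp add: mollifier_def)
  have "compact (fun_support w)" "fun_support w \<subseteq> U" using w(1) by (auto simp: test_fun_def)
  then obtain \<eta> W where \<eta>: "test_fun U \<eta>" "\<And>x. 0 \<le> \<eta> x" "fun_support w \<subseteq> W" "\<And>x. x \<in> W \<Longrightarrow> \<eta> x = 1"
    using cutoff_exists[of "fun_support w" U] U(1) by metis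
  define \<alpha> :: "'n form" where
    "\<alpha> K L x = (if card K = 1 \<and> card L = 1 then \<eta> x * partial (the_elem L) (partial (the_elem K) v) x else 0)" for K L x
  have \<alpha>_11: "\<alpha> K L x = 0" if "card K \<noteq> 1 \<or> card L \<noteq> 1" for K L x
    using that by (auto simp: \<alpha>_def)
  have \<alpha>_eq: "\<alpha> {i} {j} x = \<eta> x * partial j (partial i v) x" for i j x by (simp add: \<alpha>_def)
  have at: "\<exists>a. (\<forall>K L. \<alpha> K L x = coeff_of (scale (\<eta> x) a) K L) \<and> m_positive m a \<and> symmetric_form a" for x
  proof (cases "x \<in> U")
    case True
    obtain a where a: "m_positive m a" "\<And>i j. coeff_of a {i} {j} = partial j (partial i v) x"
        "\<And>K L. card K \<noteq> 1 \<or> card L \<noteq> 1 \<Longrightarrow> coeff_of a K L = 0" "symmetric_form a"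
      using hessian_conv_m_positive[OF m1 mn D f K \<rho> U(3)[OF True]] unfolding v_def by blast
    have "\<alpha> K L x = coeff_of (scale (\<eta> x) a) K L" for K L
    proof (cases "card K = 1 \<and> card L = 1")
      case True
      then obtain i j where "K = {i}" "L = {j}" by (auto simp: card_1_singleton_iff)
      then show ?thesis by (simp add: \<alpha>_eq scale.rep_eq a(2))
    next
      case False
      then show ?thesis using \<alpha>_11[of K L x] a(3)[of K L] by (simp add: scale.rep_eq)
    qed
    then show ?thesis using a by blast
  next
    case False
    then have "\<eta> x = 0" using \<eta>(1) by (intro not_in_fun_support[of x \<eta>]) (auto simp: test_fun_def)
    \<comment> \<open>Outside \<open>U\<close> the form is zero; beta, scaled by
      \<open>\<eta> x = 0\<close>, serves as the witness.\<close>
    then show ?thesis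
      using m_positive_beta[OF mn] symmetric_form_beta
      by (intro exI[of _ beta]) (simp add: \<alpha>_def zero_even_form.rep_eq)
  qed
  have "form_smooth \<Omega> \<alpha>"
    unfolding form_smooth_def
  proof (intro allI)
    fix K L
    have "smooth_on UNIV (\<alpha> K L)"
    proof (cases "card K = 1 \<and> card L = 1")
      case True
      then show ?thesis
        using test_fun_smooth[OF \<eta>(1)] v by (simp add: \<alpha>_def[abs_def] smooth_mult smooth_partial)
    next
      case False
      then show ?thesis unfolding \<alpha>_def[abs_def] by (simp only: if_False smooth_const)
    qed
    then show "smooth_on \<Omega> (\<alpha> K L)" by (simp add: smooth_on_def)
  qed
  moreover have "m_positive_form m \<Omega> \<alpha>"
    unfolding m_positive_form_iff
  proof (intro conjI ballI)
    show "form_bidegree \<Omega> 1 1 \<alpha>" using \<alpha>_11 by (auto simp: form_bidegree_def)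
    show "form_symmetric \<Omega> \<alpha>"
      unfolding form_symmetric_def
    proof (intro allI ballI)
      fix K L x
      obtain a where "\<And>K L. \<alpha> K L x = coeff_of (scale (\<eta> x) a) K L" "symmetric_form a"
        using at[of x] by blast
      then show "\<alpha> K L x = \<alpha> L K x" by (simp add: scale.rep_eq symmetric_form_def)
    qed
    fix x
    obtain a where a: "\<And>K L. \<alpha> K L x = coeff_of (scale (\<eta> x) a) K L" "m_positive m a"
      using at[of x] by blast
    have "form_at \<alpha> x = scale (\<eta> x) a"
      using a(1) by (simp add: form_at_def coeff_of_inverse)
    then show "m_positive m (form_at \<alpha> x)"
      using m_positive_scale[OF a(2) \<eta>(2)] by simp
  qed
  ultimately have "0 \<le> (\<Sum>i\<in>UNIV. \<Sum>j\<in>UNIV. A i j (\<lambda>x. \<alpha> {i} {j} x * w x))"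
    using \<alpha>_11 w\<Omega> w(2) by (rule A_positive)
  moreover have "(\<lambda>x. \<alpha> {i} {j} x * w x) = (\<lambda>x. w x * partial j (partial i v) x)" for i j
  proof
    fix x
    have "\<eta> x * w x = w x"
      using in_fun_support[of w x] \<eta>(3,4) by (cases "w x = 0") auto
    then show "\<alpha> {i} {j} x * w x = w x * partial j (partial i v) x"
      by (simp add: \<alpha>_eq)
  qed
  ultimately show ?thesis by (simp only: A_integration_by_parts[OF w\<Omega> v])
qed

text \<open>Every point of the support of \<open>\<phi>\<close> has a neighbourhood on which
  \<open>T\<close> vanishes; a finite partition of unity reduces \<open>\<phi>\<close> to test
  functions in such neighbourhoods.\<close>

lemma T_vanishes:
  assumes \<phi>: "test_fun \<Omega> \<phi>" "fun_support \<phi> \<inter> current_support \<Omega> T = {}"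
  shows "T K L \<phi> = 0"
proof -
  have "\<forall>x\<in>fun_support \<phi>. \<exists>U. open U \<and> x \<in> U \<and> (\<forall>\<psi> K L. test_fun (\<Omega> \<inter> U) \<psi> \<longrightarrow> T K L \<psi> = 0)"
    using \<phi> by (auto simp: current_support_def test_fun_def)
  then obtain U where U: "\<And>x. x \<in> fun_support \<phi> \<Longrightarrow> open (U x)" "\<And>x. x \<in> fun_support \<phi> \<Longrightarrow> x \<in> U x"
    "\<And>x \<psi> K L. x \<in> fun_support \<phi> \<Longrightarrow> test_fun (\<Omega> \<inter> U x) \<psi> \<Longrightarrow> T K L \<psi> = 0" by metis
  have "compact (fun_support \<phi>)" "fun_support \<phi> \<subseteq> \<Omega>" using \<phi>(1) by (auto simp: test_fun_def)
  moreover have "fun_support \<phi> \<subseteq> (\<Union>x\<in>fun_support \<phi>. \<Omega> \<inter> U x)" using U(2) calculation by auto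
  ultimately obtain I where I: "I \<subseteq> fun_support \<phi>" "finite I" "fun_support \<phi> \<subseteq> (\<Union>x\<in>I. \<Omega> \<inter> U x)"
    using compactE_image[of "fun_support \<phi>" "fun_support \<phi>" "\<lambda>x. \<Omega> \<inter> U x"] U(1) open_\<Omega> by (metis open_Int)
  have "test_fun (\<Union>x\<in>I. \<Omega> \<inter> U x) \<phi>" using \<phi>(1) I(3) by (simp add: test_fun_def)
  then have "\<exists>g. (\<forall>i x. 0 \<le> g i x \<and> g i x \<le> (1::real)) \<and>
      (\<forall>i\<in>I. test_fun (\<Omega> \<inter> U i) (\<lambda>x. g i x * \<phi> x)) \<and> (\<forall>x. (\<Sum>i\<in>I. g i x * \<phi> x) = \<phi> x)"
    by (rule test_fun_partition[OF I(2), rotated]) (use U(1) I(1) open_\<Omega> in auto)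
  then obtain g where g: "\<And>x. x \<in> I \<Longrightarrow> test_fun (\<Omega> \<inter> U x) (\<lambda>y. g x y * \<phi> y)"
      "\<And>y. (\<Sum>x\<in>I. g x y * \<phi> y) = \<phi> y" by blast
  have "T K L (\<lambda>y. \<Sum>x\<in>J. g x y * \<phi> y) = 0" if "J \<subseteq> I" for J
    using finite_subset[OF that I(2)] that
  proof (induction J rule: finite_induct)
    case empty
    have "T K L (\<lambda>x. 0 * 0) = 0 * T K L (\<lambda>x. 0)"
      using current_homogeneous[OF current_T test_fun_zero] unfolding homogeneous_def by blast
    then show ?case by simp
  next
    case (insert x J)
    have t: "test_fun \<Omega> (\<lambda>y. g z y * \<phi> y)" if "z \<in> I" for z
      using g(1)[OF that] by (rule test_fun_mono) auto
    have "T K L (\<lambda>y. g x y * \<phi> y + (\<Sum>z\<in>J. g z y * \<phi> y)) =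
        T K L (\<lambda>y. g x y * \<phi> y) + T K L (\<lambda>y. \<Sum>z\<in>J. g z y * \<phi> y)"
      using insert.prems by (intro current_add[OF current_T] test_fun_sum t) auto
    also have "\<dots> = 0" using insert U(3)[of x] g(1)[of x] I(1) by auto
    finally show ?case using insert.hyps by simp
  qed
  from this[OF order_refl] show ?thesis by (simp add: g(2))
qed

text \<open>Stated for a functional \<open>L\<close> below the trace so that it covers both parts
  \<open>P\<close> and \<open>N\<close> of every coefficient. A bound on the trace of the
  regularised functions bounds their integrals for the Riesz measure of \<open>L\<close>, to which
  Fatou's lemma applies.\<close>

lemma mass_estimate:
  assumes conn: "connected \<Omega>" and bdd: "bounded \<Omega>" and u: "m_convex_on m \<Omega> u"
    and near: "bounded_near_boundary_support \<Omega> T u" and K: "compact K" "K \<subseteq> \<Omega>"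
    and L: "positive_functional \<Omega> L" "\<And>\<phi>. test_fun \<Omega> \<phi> \<Longrightarrow> (\<And>x. 0 \<le> \<phi> x) \<Longrightarrow> L \<phi> \<le> \<tau> \<phi>"
  shows "(\<integral>\<^sup>+x\<in>K. e2ennreal \<bar>u x\<bar> \<partial>positive_functional.riesz_measure \<Omega> L) < \<infinity>"
proof -
  interpret L: positive_functional \<Omega> L by (rule L(1))
  let ?\<nu> = "L.riesz_measure"
  have sub: "subharmonic_on \<Omega> u" and D: "m_positive_current m (CARD('n) - 1) \<Omega> (hessian_current \<Omega> u)"
    using u by (auto simp: m_convex_on_def)
  obtain V M where V: "open V" "frontier \<Omega> \<inter> closure (current_support \<Omega> T) \<subseteq> V"
    "\<And>x. x \<in> \<Omega> \<inter> V \<Longrightarrow> \<bar>u x\<bar> \<le> ereal M"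
    using near unfolding bounded_near_boundary_support_def by blast
  define M' where "M' = max M 0"
  have VM: "\<bar>u x\<bar> \<le> ereal M'" if "x \<in> \<Omega> \<inter> V" for x
    using V(3)[OF that] by (rule order_trans) (simp add: M'_def)
  define Z where "Z = closure (current_support \<Omega> T)"
  have "current_support \<Omega> T \<subseteq> \<Omega>" by (auto simp: current_support_def)
  then have Z: "compact Z" "Z \<subseteq> closure \<Omega>"
    unfolding Z_def using bdd by (auto intro: bounded_subset closure_mono[THEN subsetD])
  \<comment> \<open>Points of \<open>Z\<close> outside \<open>\<Omega>\<close> lie on the frontier
    and hence in \<open>V\<close>. Removing \<open>V\<close> leaves a compact part of
    \<open>\<Omega>\<close>, the region in which \<open>u\<close> is not controlled.\<close>
  have L0: "compact (Z - V)" "Z - V \<subseteq> \<Omega>"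
    using Z V(1,2) interior_open[OF open_\<Omega>] by (auto intro: compact_diff simp: Z_def frontier_def)
  obtain \<eta> W where \<eta>: "test_fun \<Omega> \<eta>" "\<And>x. 0 \<le> \<eta> x" "open W" "(Z - V) \<union> K \<subseteq> W" "\<And>x. x \<in> W \<Longrightarrow> \<eta> x = 1"
    using cutoff_exists[of "(Z - V) \<union> K" \<Omega>] L0 K open_\<Omega> by (metis Un_least compact_Un)
  have \<eta>s: "smooth_on UNIV \<eta>" by (rule test_fun_smooth[OF \<eta>(1)])
  let ?Y = "fun_support \<eta>"
  have Y: "compact ?Y" "?Y \<subseteq> \<Omega>" using \<eta>(1) by (auto simp: test_fun_def)
  define w where "w x = \<eta> x * (1 / 2 * (x \<bullet> x))" for x
  have half: "smooth_on UNIV (\<lambda>x::real^'n::{finite,linorder}. 1 / 2 * (x \<bullet> x))"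
    by (intro smooth_mult smooth_const smooth_inner_self)
  have half': "partial j (\<lambda>x::real^'n::{finite,linorder}. 1 / 2 * (x \<bullet> x)) = (\<lambda>x. x $ j)" for j
    by (subst partial_mult) (simp_all add: partial_inner_self smooth_differentiable[OF smooth_inner_self])
  have "test_fun \<Omega> w"
    unfolding w_def[abs_def] by (rule test_fun_mult_right[OF \<eta>(1) half])
  moreover have "0 \<le> w x" for x using \<eta>(2)[of x] by (simp add: w_def)
  moreover have "x \<in> ?Y" if "w x \<noteq> 0" for x using that by (intro in_fun_support) (auto simp: w_def)
  ultimately have w: "test_fun \<Omega> w" "\<And>x. 0 \<le> w x" "\<And>x. w x \<noteq> 0 \<Longrightarrow> x \<in> ?Y" by blast+
  \<comment> \<open>What remains of the Hessian of \<open>w\<close> after \<open>\<eta>\<close>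
    times the identity: the terms with derivatives of \<open>\<eta>\<close>, which vanish on
    \<open>W\<close>.\<close>
  define r where "r i j x = partial i (partial j w) x - (if i = j then \<eta> x else 0)" for i j x
  have r_test: "test_fun \<Omega> (r i j)" for i j
    unfolding r_def[abs_def] using \<eta>(1) w(1) by (cases "i = j") (auto intro!: test_fun_diff test_fun_partial)
  have r_supp: "x \<in> ?Y - W" if "r i j x \<noteq> 0" for i j x
  proof
    have "partial i (partial j w) x \<noteq> 0 \<or> \<eta> x \<noteq> 0" using that by (auto simp: r_def split: if_splits)
    moreover have "fun_support w \<subseteq> ?Y" using w(3) by (intro fun_support_subset) auto
    ultimately show "x \<in> ?Y"
      using in_fun_support[of "partial i (partial j w)" x] in_fun_support[of \<eta> x]
        fun_support_partial[of i "partial j w"] fun_support_partial[of j w] by blast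
    show "x \<notin> W"
    proof
      assume "x \<in> W"
      have "partial j w y = y $ j" if "y \<in> W" for y
      proof -
        have "partial j w y = partial j (\<lambda>x. 1 / 2 * (x \<bullet> x)) y"
          by (rule partial_eq_on_open[OF \<eta>(3) that]) (simp add: w_def \<eta>(5))
        then show ?thesis by (simp only: half')
      qed
      then have "partial i (partial j w) x = partial i (\<lambda>y. y $ j) x"
        by (rule partial_eq_on_open[OF \<eta>(3) \<open>x \<in> W\<close>])
      then show False using that \<eta>(5)[OF \<open>x \<in> W\<close>] by (simp add: r_def partial_coordinate split: if_splits)
    qed
  qed
  have "compact ((?Y - W) \<inter> Z)" using Y Z \<eta>(3) by (intro compact_Int compact_diff)
  moreover have "(?Y - W) \<inter> Z \<subseteq> V \<inter> \<Omega>" using Y \<eta>(4) by blast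
  \<comment> \<open>Near the part of \<open>Z\<close> where \<open>r\<close> can be nonzero,
    \<open>\<kappa> = 1\<close>; so \<open>v r\<close> and \<open>\<kappa> v r\<close> have the same
    value under \<open>A\<close>, and on the support of \<open>\<kappa>\<close> the function
    \<open>u\<close> is bounded by \<open>M'\<close>.\<close>
  ultimately obtain \<kappa> W1 where \<kappa>: "test_fun (V \<inter> \<Omega>) \<kappa>" "\<And>x. 0 \<le> \<kappa> x" "open W1" "(?Y - W) \<inter> Z \<subseteq> W1"
      "\<And>x. x \<in> W1 \<Longrightarrow> \<kappa> x = 1"
    using cutoff_exists[of "(?Y - W) \<inter> Z" "V \<inter> \<Omega>"] V(1) open_\<Omega> by (metis open_Int)
  have \<kappa>\<Omega>: "test_fun \<Omega> \<kappa>" by (rule test_fun_mono[OF \<kappa>(1)]) auto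
  have \<kappa>s: "smooth_on UNIV \<kappa>" by (rule test_fun_smooth[OF \<kappa>(1)])
  let ?X = "fun_support \<kappa>"
  have X: "compact ?X" "?X \<subseteq> V \<inter> \<Omega>" using \<kappa>(1) by (auto simp: test_fun_def)
  \<comment> \<open>Radii up to \<open>e1\<close> keep the mollification around \<open>?Y\<close>
    and \<open>?X\<close> inside \<open>\<Omega>\<close>; radii up to \<open>e2\<close> keep it
    inside \<open>V\<close> around \<open>?X\<close>, so that \<open>v\<close> inherits the bound
    \<open>M'\<close> there.\<close>
  obtain e1 where e1: "e1 > 0" "(\<Union>x\<in>?Y \<union> ?X. cball x e1) \<subseteq> \<Omega>"
    using compact_subset_open_imp_cball_epsilon_subset[of "?Y \<union> ?X" \<Omega>] X Y open_\<Omega> by (metis Un_least compact_Un le_inf_iff)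
  obtain e2 where e2: "e2 > 0" "(\<Union>x\<in>?X. cball x e2) \<subseteq> V \<inter> \<Omega>"
    using compact_subset_open_imp_cball_epsilon_subset[OF X(1) _ X(2)] V(1) open_\<Omega> by blast
  define K' where "K' = (\<Union>x\<in>?Y \<union> ?X. cball x e1)"
  have K': "compact K'" "K' \<subseteq> \<Omega>"
    unfolding K'_def using compact_UN_cball[OF compact_Un[OF Y(1) X(1)]] e1(2) by auto
  \<comment> \<open>Half of \<open>e1\<close> is spent on the open neighbourhood \<open>U\<close> of
    \<open>?Y\<close> over which the Hessian form of \<open>v\<close> has to be
    \<open>m\<close>-positive.\<close>
  define e0 where "e0 = min (e1 / 2) e2"
  have "e0 > 0" using e1 e2 by (simp add: e0_def)
  define U where "U = (\<Union>x\<in>?Y. ball x (e1 / 2))"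
  have U: "open U" "U \<subseteq> K'" "?Y \<subseteq> U"
    using e1(1) by (auto simp: U_def K'_def intro!: bexI)
  have U_ball: "cball x e \<subseteq> K'" if x: "x \<in> U" and e: "e \<le> e0" for x e
  proof
    fix y assume y: "y \<in> cball x e"
    obtain z where z: "z \<in> ?Y" "dist z x < e1 / 2" using x by (auto simp: U_def)
    then have "dist z y \<le> e1" using y e dist_triangle[of z y x] by (auto simp: e0_def)
    then show "y \<in> K'" using z(1) by (auto simp: K'_def)
  qed
  \<comment> \<open>With \<open>M0 \<ge> 0\<close> the bound also holds for \<open>f\<close> off
    \<open>K'\<close> and where \<open>u = -\<infinity>\<close>, since \<open>f\<close> is 0
    there.\<close>
  obtain M0 :: real where M0: "M0 \<ge> 0" "\<And>x. x \<in> K' \<Longrightarrow> u x \<le> ereal M0"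
    using subharmonic_bounded_above[OF open_\<Omega> sub K'] by blast
  define f where "f x = indicator K' x * real_of_ereal (u x)" for x
  have f: "integrable lborel f"
    unfolding f_def by (rule subharmonic_locally_integrable[OF open_\<Omega> conn sub K'])
  have f_le: "f x \<le> M0" for x
    using M0(2)[of x] M0(1) by (cases "u x") (auto simp: f_def indicator_def)
  \<comment> \<open>\<open>C\<close> is chosen before \<open>v\<close>: this is the uniformity in
    the mollifier on which Fatou's lemma depends.\<close>
  have "\<forall>i j. \<exists>C\<ge>0. \<forall>v. smooth_on UNIV v \<longrightarrow> (\<forall>x\<in>?X. \<bar>v x\<bar> \<le> M') \<longrightarrow> A i j (\<lambda>x. v x * r i j x) \<le> C"
  proof (intro allI)
    fix i j
    obtain R where R: "\<And>x. \<bar>r i j x\<bar> \<le> R" using test_fun_bounded[OF r_test] by blast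
    have "R \<ge> 0" using R[of 0] by linarith
    obtain c where c: "0 \<le> c"
      "\<And>\<phi> \<kappa> B. test_fun \<Omega> \<phi> \<Longrightarrow> test_fun \<Omega> \<kappa> \<Longrightarrow> (\<And>x. 0 \<le> \<kappa> x) \<Longrightarrow> (\<And>x. \<bar>\<phi> x\<bar> \<le> B * \<kappa> x) \<Longrightarrow> 0 \<le> B \<Longrightarrow>
        \<bar>A i j \<phi>\<bar> \<le> c * (B * \<tau> \<kappa>)" using A_bound[of i j] by blast
    have "M' \<ge> 0" by (simp add: M'_def)
    show "\<exists>C\<ge>0. \<forall>v. smooth_on UNIV v \<longrightarrow> (\<forall>x\<in>?X. \<bar>v x\<bar> \<le> M') \<longrightarrow> A i j (\<lambda>x. v x * r i j x) \<le> C"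
    proof (intro exI[of _ "c * (M' * R * \<tau> \<kappa>)"] conjI allI impI)
      show "0 \<le> c * (M' * R * \<tau> \<kappa>)"
        using c(1) \<open>R \<ge> 0\<close> \<open>M' \<ge> 0\<close> \<tau>_nonneg[OF \<kappa>\<Omega> \<kappa>(2)] by simp
      fix v assume v: "smooth_on UNIV v" "\<forall>x\<in>?X. \<bar>v x\<bar> \<le> M'"
      have vr: "test_fun \<Omega> (\<lambda>x. v x * r i j x)" by (rule test_fun_mult_left[OF r_test v(1)])
      have t1: "test_fun \<Omega> (\<lambda>x. \<kappa> x * (v x * r i j x))" by (rule test_fun_mult_left[OF vr \<kappa>s])
      have t2: "test_fun \<Omega> (\<lambda>x. (1 - \<kappa> x) * (v x * r i j x))"
        by (rule test_fun_mult_left[OF vr smooth_diff[OF smooth_const \<kappa>s]])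
      have "fun_support (\<lambda>x. (1 - \<kappa> x) * (v x * r i j x)) \<subseteq> (?Y - W) - W1"
      proof (rule fun_support_subset)
        show "closed ((?Y - W) - W1)" using \<eta>(3) \<kappa>(3) by (intro closed_Diff) auto
        show "x \<in> (?Y - W) - W1" if "(1 - \<kappa> x) * (v x * r i j x) \<noteq> 0" for x
          using that r_supp[of i j x] \<kappa>(5)[of x] by auto
      qed
      moreover have "current_support \<Omega> T \<subseteq> Z" unfolding Z_def by (rule closure_subset)
      ultimately have "fun_support (\<lambda>x. (1 - \<kappa> x) * (v x * r i j x)) \<inter> current_support \<Omega> T = {}"
        using \<kappa>(4) by blast
      then have "A i j (\<lambda>x. (1 - \<kappa> x) * (v x * r i j x)) = 0"
        using t2 by (intro A_local T_vanishes)
      then have "A i j (\<lambda>x. v x * r i j x) = A i j (\<lambda>x. \<kappa> x * (v x * r i j x))"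
        using A_add[OF t1 t2, of i j] by (simp add: algebra_simps)
      also have "\<dots> \<le> \<bar>A i j (\<lambda>x. \<kappa> x * (v x * r i j x))\<bar>" by simp
      also have "\<dots> \<le> c * (M' * R * \<tau> \<kappa>)"
      proof (rule c(2)[OF t1 \<kappa>\<Omega> \<kappa>(2)])
        show "0 \<le> M' * R" using \<open>R \<ge> 0\<close> \<open>M' \<ge> 0\<close> by simp
        show "\<bar>\<kappa> x * (v x * r i j x)\<bar> \<le> M' * R * \<kappa> x" for x
        proof (cases "\<kappa> x = 0")
          case False
          then have "\<bar>v x\<bar> \<le> M'" using v(2) in_fun_support[of \<kappa> x] by blast
          then have "\<bar>v x\<bar> * \<bar>r i j x\<bar> \<le> M' * R" using R \<open>M' \<ge> 0\<close> by (intro mult_mono) auto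
          then have "\<kappa> x * (\<bar>v x\<bar> * \<bar>r i j x\<bar>) \<le> \<kappa> x * (M' * R)" using \<kappa>(2) by (rule mult_left_mono)
          then show ?thesis using \<kappa>(2)[of x] by (simp add: abs_mult mult_ac)
        qed simp
      qed
      finally show "A i j (\<lambda>x. v x * r i j x) \<le> c * (M' * R * \<tau> \<kappa>)" .
    qed
  qed
  then obtain C where C: "\<And>i j v. smooth_on UNIV v \<Longrightarrow> (\<forall>x\<in>?X. \<bar>v x\<bar> \<le> M') \<Longrightarrow> A i j (\<lambda>x. v x * r i j x) \<le> C i j"
    by metis
  define C1 where "C1 = (\<Sum>i\<in>UNIV. \<Sum>j\<in>UNIV. C i j) / fact q"
  have main: "L (\<lambda>x. \<eta> x * (M0 - conv f \<rho> x)) \<le> M0 * \<tau> \<eta> + C1" (is ?le)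
    and nonneg: "\<And>x. 0 \<le> \<eta> x * (M0 - conv f \<rho> x)"
    and test: "test_fun \<Omega> (\<lambda>x. \<eta> x * (M0 - conv f \<rho> x))"
    if \<rho>: "mollifier e \<rho>" and e: "e > 0" "e \<le> e0" for e \<rho>
  proof -
    let ?v = "conv f \<rho>"
    have v: "smooth_on UNIV ?v" using \<rho> by (intro smooth_conv[OF f]) (simp add: mollifier_def)
    have v_le: "?v x \<le> M0" for x by (rule conv_le[OF f \<rho>]) (rule f_le)
    show nn: "0 \<le> \<eta> x * (M0 - ?v x)" for x using \<eta>(2)[of x] v_le[of x] by simp
    show t: "test_fun \<Omega> (\<lambda>x. \<eta> x * (M0 - ?v x))"
      by (intro test_fun_mult_right[OF \<eta>(1)] smooth_diff smooth_const v)
    have v_X: "\<bar>?v x\<bar> \<le> M'" if "x \<in> ?X" for x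
    proof -
      have "\<bar>f y\<bar> \<le> M'" if "dist x y < e" for y
      proof -
        have "y \<in> cball x e2" using that e by (simp add: e0_def)
        then have "\<bar>u y\<bar> \<le> ereal M'" using e2(2) \<open>x \<in> ?X\<close> by (intro VM) blast
        then have "\<bar>real_of_ereal (u y)\<bar> \<le> M'" by (cases "u y") auto
        then show ?thesis by (auto simp: f_def indicator_def M'_def)
      qed
      then have "?v x \<le> M'" "- M' \<le> ?v x"
        by (intro conv_le[OF f \<rho>] conv_ge[OF f \<rho>]; force simp: abs_le_iff)+
      then show ?thesis by (simp add: abs_le_iff)
    qed
    have "test_fun U w" using U(3) w by (intro test_funI[OF test_fun_smooth[OF w(1)] Y(1)]) auto
    then have "0 \<le> (\<Sum>i\<in>UNIV. \<Sum>j\<in>UNIV. A i j (\<lambda>x. ?v x * partial i (partial j w) x))"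
      unfolding f_def[abs_def]
      by (rule hessian_test_inequality[OF D f[unfolded f_def[abs_def]] K'(2) \<rho> _ w(2) U(1)])
        (use U(2) K'(2) U_ball[OF _ e(2)] in blast)+
    also have "\<dots> = (\<Sum>i\<in>UNIV. \<Sum>j\<in>UNIV. (if j = i then A i i (\<lambda>x. ?v x * \<eta> x) else 0) + A i j (\<lambda>x. ?v x * r i j x))"
    proof (intro sum.cong refl)
      fix i j
      have t: "test_fun \<Omega> (\<lambda>x. ?v x * r i j x)" "test_fun \<Omega> (\<lambda>x. ?v x * \<eta> x)"
        by (rule test_fun_mult_left[OF r_test v], rule test_fun_mult_left[OF \<eta>(1) v])
      show "A i j (\<lambda>x. ?v x * partial i (partial j w) x) =
          (if j = i then A i i (\<lambda>x. ?v x * \<eta> x) else 0) + A i j (\<lambda>x. ?v x * r i j x)"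
      proof (cases "j = i")
        case True
        have "(\<lambda>x. ?v x * partial i (partial j w) x) = (\<lambda>x. ?v x * \<eta> x + ?v x * r i j x)"
          using True by (simp add: r_def algebra_simps)
        then show ?thesis using A_add[OF t(2,1), of i j] True by simp
      next
        case False
        then show ?thesis by (auto simp: r_def[abs_def])
      qed
    qed
    also have "\<dots> = fact q * \<tau> (\<lambda>x. ?v x * \<eta> x) + (\<Sum>i\<in>UNIV. \<Sum>j\<in>UNIV. A i j (\<lambda>x. ?v x * r i j x))"
      by (simp add: sum.distrib A_trace test_fun_mult_left[OF \<eta>(1) v])
    also have "\<dots> \<le> fact q * \<tau> (\<lambda>x. ?v x * \<eta> x) + (\<Sum>i\<in>UNIV. \<Sum>j\<in>UNIV. C i j)"
      using v_X by (intro add_left_mono sum_mono C v) auto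
    finally have "- \<tau> (\<lambda>x. ?v x * \<eta> x) \<le> C1"
      by (simp add: C1_def field_simps)
    have eq: "(\<lambda>x. \<eta> x * (M0 - ?v x)) = (\<lambda>x. M0 * \<eta> x + (-1) * (?v x * \<eta> x))"
      by (auto simp: algebra_simps)
    have "L (\<lambda>x. \<eta> x * (M0 - ?v x)) \<le> \<tau> (\<lambda>x. \<eta> x * (M0 - ?v x))"
      by (rule L(2)[OF t nn])
    also have "\<dots> = M0 * \<tau> \<eta> - \<tau> (\<lambda>x. ?v x * \<eta> x)"
      unfolding eq \<tau>_add[OF test_fun_cmult[OF \<eta>(1)] test_fun_cmult[OF test_fun_mult_left[OF \<eta>(1) v]]]
        \<tau>_cmult[OF \<eta>(1)] \<tau>_cmult[OF test_fun_mult_left[OF \<eta>(1) v]] by simp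
    finally show ?le using \<open>- \<tau> (\<lambda>x. ?v x * \<eta> x) \<le> C1\<close> by simp
  qed
  define e where "e k = e0 / real (Suc k)" for k
  have e: "e k > 0" "e k \<le> e0" for k using \<open>e0 > 0\<close> by (auto simp: e_def field_simps)
  have e_lim: "e \<longlonglongrightarrow> 0" unfolding e_def by (rule LIMSEQ_Suc[OF lim_const_over_n])
  have "\<forall>k. \<exists>\<rho>::real^'n::{finite,linorder} \<Rightarrow> real. mollifier (e k) \<rho>" using mollifier_exists[OF e(1)] by metis
  then obtain \<rho> :: "nat \<Rightarrow> real^'n::{finite,linorder} \<Rightarrow> real" where \<rho>: "\<And>k. mollifier (e k) (\<rho> k)" by metis
  define g where "g k x = ennreal (\<eta> x * (M0 - conv f (\<rho> k) x))" for k x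
  have g_meas: "g k \<in> borel_measurable ?\<nu>" for k
    unfolding g_def
    by (intro measurable_compose[OF _ measurable_ennreal] L.measurable_riesz smooth_borel_measurable test_fun_smooth[OF test[OF \<rho> e]])
  have g_int: "(\<integral>\<^sup>+x. g k x \<partial>?\<nu>) \<le> ennreal (M0 * \<tau> \<eta> + C1)" for k
  proof -
    note t = test[OF \<rho>[of k] e[of k]]
    have "(\<integral>\<^sup>+x. g k x \<partial>?\<nu>) = ennreal (LINT x|?\<nu>. \<eta> x * (M0 - conv f (\<rho> k) x))"
      unfolding g_def
      using L.test_fun_integrable_riesz[OF t] nonneg[OF \<rho>[of k] e[of k]] by (intro nn_integral_eq_integral) auto
    also have "\<dots> = ennreal (L (\<lambda>x. \<eta> x * (M0 - conv f (\<rho> k) x)))"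
      using L.riesz_representation[OF t] by simp
    also have "\<dots> \<le> ennreal (M0 * \<tau> \<eta> + C1)" by (intro ennreal_leI main[OF \<rho> e])
    finally show ?thesis .
  qed
  have fin_ae: "AE y in lborel. y \<in> K' \<longrightarrow> u y \<noteq> -\<infinity>"
    by (rule subharmonic_finite_AE[OF open_\<Omega> conn sub K'])
  \<comment> \<open>By upper semicontinuity \<open>u < c\<close> on a ball about \<open>x\<close>,
    so averages with small radius are at most \<open>c\<close>. Working with every \<open>c\<close>
    above \<open>u x\<close> includes the case \<open>u x = -\<infinity>\<close>.\<close>
  have upper: "ennreal (M0 - c) \<le> liminf (\<lambda>k. g k x)" if x: "x \<in> K" and c: "u x < ereal c" for x c
  proof -
    have "x \<in> \<Omega>" "\<eta> x = 1" using x K \<eta>(4,5) by auto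
    then have "x \<in> ?Y" by (intro in_fun_support) simp
    have "x \<in> {y \<in> \<Omega>. u y < ereal c}" using \<open>x \<in> \<Omega>\<close> c by simp
    then obtain d where d: "d > 0" "ball x d \<subseteq> {y \<in> \<Omega>. u y < ereal c}"
      by (rule openE[OF subharmonic_open_less[OF open_\<Omega> sub]])
    have "\<forall>\<^sub>F k in sequentially. e k < d" using order_tendstoD(2)[OF e_lim d(1)] .
    then have "\<forall>\<^sub>F k in sequentially. ennreal (M0 - c) \<le> g k x"
    proof eventually_elim
      case (elim k)
      have "conv f (\<rho> k) x \<le> c"
      proof (rule conv_le_AE[OF f \<rho>])
        show "AE y in lborel. dist x y < e k \<longrightarrow> f y \<le> c"
          using fin_ae
        proof eventually_elim
          case (elim y)
          show ?case
          proof
            assume y: "dist x y < e k"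
            then have "dist x y < d" using \<open>e k < d\<close> by simp
            then have "u y < ereal c" using d(2) by auto
            moreover have "y \<in> cball x (e k)" using y by simp
            then have "y \<in> K'" using U_ball[OF _ e(2)] U(3) \<open>x \<in> ?Y\<close> by blast
            ultimately show "f y \<le> c" using elim by (cases "u y") (auto simp: f_def)
          qed
        qed
      qed
      then show "ennreal (M0 - c) \<le> g k x" unfolding g_def \<open>\<eta> x = 1\<close> by (intro ennreal_leI) simp
    qed
    then show ?thesis by (rule Liminf_bounded)
  qed
  \<comment> \<open>On \<open>K\<close> one has \<open>\<eta> = 1\<close> and
    \<open>\<bar>u\<bar> \<le> (M0 - u) + M0\<close>. Where \<open>u = -\<infinity>\<close> the
    lower limit is infinite, so finiteness of the integral also shows that this set carries no mass
    in \<open>K\<close>.\<close>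
  have pointwise: "e2ennreal \<bar>u x\<bar> * indicator K x \<le> liminf (\<lambda>k. g k x) + ennreal M0 * indicator K x" for x
  proof (cases "x \<in> K")
    case True
    have "x \<in> ?Y" using True \<eta>(4,5) by (intro in_fun_support) auto
    then have "x \<in> K'" using U by auto
    show ?thesis
    proof (cases "u x")
      case (real a)
      have "a \<le> M0" using M0(2)[OF \<open>x \<in> K'\<close>] real by simp
      have "ennreal (M0 - a) \<le> liminf (\<lambda>k. g k x)"
      proof (rule ennreal_le_epsilon)
        fix d :: real assume "d > 0"
        have "ennreal (M0 - a) \<le> ennreal (M0 - (a + d)) + ennreal d"
          using \<open>d > 0\<close> by (cases "a + d \<le> M0") (auto simp: ennreal_neg simp flip: ennreal_plus intro!: ennreal_leI)
        also have "\<dots> \<le> liminf (\<lambda>k. g k x) + ennreal d"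
          using upper[OF True, of "a + d"] real \<open>d > 0\<close> by (intro add_right_mono) simp
        finally show "ennreal (M0 - a) \<le> liminf (\<lambda>k. g k x) + ennreal d" .
      qed
      moreover have "ennreal \<bar>a\<bar> \<le> ennreal (M0 - a) + ennreal M0"
        using \<open>a \<le> M0\<close> M0(1) by (auto simp flip: ennreal_plus intro!: ennreal_leI)
      ultimately have "ennreal \<bar>a\<bar> \<le> liminf (\<lambda>k. g k x) + ennreal M0"
        by (meson add_right_mono order_trans)
      then show ?thesis using True real by simp
    next
      case PInf
      then show ?thesis using M0(2)[OF \<open>x \<in> K'\<close>] by simp
    next
      case MInf
      have "of_nat N \<le> liminf (\<lambda>k. g k x)" for N
        using upper[OF True, of "M0 - real N"] MInf by (simp add: ennreal_of_nat_eq_real_of_nat)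
      then have "liminf (\<lambda>k. g k x) = \<infinity>"
        by (metis ennreal_Ex_less_of_nat infinity_ennreal_def less_top not_less)
      then show ?thesis by simp
    qed
  qed simp
  have "K \<in> sets ?\<nu>" by (rule L.sets_rieszI[OF borel_compact[OF K(1)] K(2)])
  have "(\<integral>\<^sup>+x\<in>K. e2ennreal \<bar>u x\<bar> \<partial>?\<nu>) \<le> (\<integral>\<^sup>+x. liminf (\<lambda>k. g k x) + ennreal M0 * indicator K x \<partial>?\<nu>)"
    by (intro nn_integral_mono pointwise)
  also have "\<dots> = (\<integral>\<^sup>+x. liminf (\<lambda>k. g k x) \<partial>?\<nu>) + ennreal M0 * emeasure ?\<nu> K"
    using g_meas \<open>K \<in> sets ?\<nu>\<close> by (subst nn_integral_add) (auto simp: nn_integral_cmult_indicator)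
  also have "(\<integral>\<^sup>+x. liminf (\<lambda>k. g k x) \<partial>?\<nu>) \<le> liminf (\<lambda>k. \<integral>\<^sup>+x. g k x \<partial>?\<nu>)"
    by (rule nn_integral_liminf[OF g_meas])
  also have "liminf (\<lambda>k. \<integral>\<^sup>+x. g k x \<partial>?\<nu>) \<le> ennreal (M0 * \<tau> \<eta> + C1)"
    using g_int by (intro order_trans[OF Liminf_le_Limsup Limsup_bounded]) auto
  also have "ennreal (M0 * \<tau> \<eta> + C1) + ennreal M0 * emeasure ?\<nu> K < \<infinity>"
    using L.riesz_compact_finite[OF K] by (simp add: ennreal_mult_less_top)
  finally show ?thesis by (simp add: add_right_mono)
qed

theorem locally_finite_mass:
  assumes "connected \<Omega>" "bounded \<Omega>" "m_convex_on m \<Omega> u" "bounded_near_boundary_support \<Omega> T u"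
  shows "product_locally_finite_mass \<Omega> u S"
proof -
  let ?F = "\<lambda>x. e2ennreal \<bar>u x\<bar>"
  have sub: "subharmonic_on \<Omega> u" using assms(3) by (simp add: m_convex_on_def)
  have F: "?F \<in> borel_measurable (restrict_space borel \<Omega>)"
    using subharmonic_measurable[OF open_\<Omega> sub] by measurable
  have "\<forall>I J. \<exists>\<mu> h. polar_decomposition \<Omega> (S I J) \<mu> h \<and>
      (\<forall>K. compact K \<longrightarrow> K \<subseteq> \<Omega> \<longrightarrow> emeasure (density \<mu> ?F) K < \<infinity>)"
  proof (intro allI)
    fix I J
    obtain P N where PN: "positive_functional \<Omega> P" "positive_functional \<Omega> N"
      "\<And>\<phi>. test_fun \<Omega> \<phi> \<Longrightarrow> S I J \<phi> = P \<phi> - N \<phi>"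
      "\<And>\<phi>. test_fun \<Omega> \<phi> \<Longrightarrow> (\<And>x. 0 \<le> \<phi> x) \<Longrightarrow> P \<phi> \<le> \<tau> \<phi> \<and> N \<phi> \<le> \<tau> \<phi>"
      using positive_current_coefficient[OF S_positive open_\<Omega>, of I J] by blast
    obtain \<mu> h where \<mu>: "polar_decomposition \<Omega> (S I J) \<mu> h"
      "\<And>F. F \<in> borel_measurable (restrict_space borel \<Omega>) \<Longrightarrow>
         (\<integral>\<^sup>+x. F x \<partial>\<mu>) \<le> (\<integral>\<^sup>+x. F x \<partial>positive_functional.riesz_measure \<Omega> P) +
           (\<integral>\<^sup>+x. F x \<partial>positive_functional.riesz_measure \<Omega> N)"
      using polar_decomposition_difference[OF PN(1,2,3)] by blast
    have sets: "sets \<mu> = sets (restrict_space borel \<Omega>)" using \<mu>(1) by (simp add: polar_decomposition_def)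
    have "emeasure (density \<mu> ?F) K < \<infinity>" if K: "compact K" "K \<subseteq> \<Omega>" for K
    proof -
      have KR: "K \<in> sets (restrict_space borel \<Omega>)"
        using borel_compact[OF K(1)] K(2) open_\<Omega> by (simp add: sets_restrict_space_iff)
      have "emeasure (density \<mu> ?F) K = (\<integral>\<^sup>+x. ?F x * indicator K x \<partial>\<mu>)"
        using F KR measurable_cong_sets[OF sets refl, of borel] sets by (intro emeasure_density) auto
      \<comment> \<open>The total variation is replaced by the two Riesz measures, to each of which
        \<open>mass_estimate\<close> applies.\<close>
      also have "\<dots> \<le> (\<integral>\<^sup>+x. ?F x * indicator K x \<partial>positive_functional.riesz_measure \<Omega> P) +
           (\<integral>\<^sup>+x. ?F x * indicator K x \<partial>positive_functional.riesz_measure \<Omega> N)"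
        by (intro \<mu>(2) borel_measurable_times_ennreal F borel_measurable_indicator KR)
      also have "\<dots> < \<infinity>"
        using mass_estimate[OF assms K PN(1)] mass_estimate[OF assms K PN(2)] PN(4) by simp
      finally show ?thesis .
    qed
    with \<mu>(1) show "\<exists>\<mu> h. polar_decomposition \<Omega> (S I J) \<mu> h \<and>
      (\<forall>K. compact K \<longrightarrow> K \<subseteq> \<Omega> \<longrightarrow> emeasure (density \<mu> ?F) K < \<infinity>)" by blast
  qed
  then obtain \<mu> h where "\<And>I J. polar_decomposition \<Omega> (S I J) (\<mu> I J) (h I J)"
    "\<And>I J K. compact K \<Longrightarrow> K \<subseteq> \<Omega> \<Longrightarrow> emeasure (density (\<mu> I J) ?F) K < \<infinity>" by metis
  then show ?thesis
    unfolding product_locally_finite_mass_def mass_def by (intro exI[of _ \<mu>] exI[of _ h]) simp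
qed

end

theorem theorem3:
  fixes \<Omega> :: "(real^'n::{finite,linorder}) set"
    and T :: "'n supercurrent"
    and u :: "real^'n::{finite,linorder} \<Rightarrow> ereal"
    and m p :: nat
  assumes "bounded \<Omega>" and "strictly_convex_domain \<Omega>"
    and "1 \<le> m" and "m \<le> CARD('n)"
    and "m + p \<ge> CARD('n) + 1"
    and "m_positive_current m p \<Omega> T" and "closed_current \<Omega> T"
    and "positive_current (m + p - CARD('n)) \<Omega>
           (current_wedge T (form_power form_beta (CARD('n) - m)))"
    and "m_convex_on m \<Omega> u"
    and "bounded_near_boundary_support \<Omega> T u"
  shows "product_locally_finite_mass \<Omega> u
           (current_wedge T (form_power form_beta (CARD('n) - m)))"
proof -
  interpret m_positive_setting \<Omega> T m p
    using assms by unfold_locales (auto simp: strictly_convex_domain_def)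
  have "product_locally_finite_mass \<Omega> u S"
    using assms by (intro locally_finite_mass) (auto simp: strictly_convex_domain_def)
  then show ?thesis by (simp add: S_def form_power_beta)
qed

end
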